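(* Let $d\in\{2,3\}$, $p(\varrho)=\varrho^\gamma$, $\gamma\ge1$, $T>0$. Let $(\mathcal{V},\mathcal{D})$ be a measure-valued solution (in the sense of the definition given in the context) on $(0,T)\times\mathbb{T}^d$ of $$\partial_t\varrho+\operatorname{div}(\varrho\mathbf{w})-\operatorname{div}(\varrho\nabla p(\varrho))=0,\qquad \partial_t(\varrho\mathbf{w})+\operatorname{div}(\varrho\mathbf{w}\otimes\mathbf{w})=\operatorname{div}(\varrho\nabla p(\varrho)\otimes\mathbf{w}).$$ Let $(\bar\varrho,\bar{\mathbf w})$ be a strong solution to the same system with $$\bar\varrho\in C^1([0,T];C^2(\mathbb{T}^d)),\quad \bar{\mathbf w}\in C^1([0,T];C^2(\mathbb{T}^d;\mathbb{R}^d)),\quad \bar\varrho>0,$$ emanating from initial data $(\bar\varrho_0,\bar{\mathbf w}_0)\in C^2(\mathbb{T}^d)\times C^2(\mathbb{T}^d;\mathbb{R}^d)$ with $\bar\varrho_0>0$. If the initial data coincide, i.e. $$\mathcal{V}_{0,x}=\delta_{(\bar\varrho_0(x),\sqrt{\bar\varrho_0(x)}\,\bar{\mathbf w}_0(x))}\quad\text{for a.e. }x\in\mathbb{T}^d,$$ then $\mathcal{D}=0$ and $$\mathcal{V}_{\tau,x}=\delta_{(\bar\varrho(\tau,x),\ \sqrt{\bar\varrho}\,\bar{\mathbf w}(\tau,x),\ \nabla Q(\bar\varrho)(\tau,x))}\quad\text{for a.e. }(\tau,x)\in(0,T)\times\mathbb{T}^d.$$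
   Context: Notation. $\mathbb{T}^d$ is the flat torus, $d\in\{2,3\}$; $p(\varrho)=\varrho^\gamma$, $\gamma\ge1$; $E(\varrho)=\int_0^\varrho p(s)\,ds$; $Q:[0,\infty)\to\mathbb{R}$ is given by $Q'(\varrho)=\sqrt{\varrho}\,p'(\varrho)$, $Q(0)=0$. In components the second equation reads $\partial_t(\varrho w_j)+\sum_i\partial_{x_i}(\varrho w_iw_j)=\sum_i\partial_{x_i}(\varrho\,\partial_{x_i}p(\varrho)\,w_j)$. A strong solution satisfies the equations pointwise. For vectors $\mathbf a,\mathbf b$ and a vector field $\boldsymbol\phi$, $(\mathbf a\otimes\mathbf b):\nabla\boldsymbol\phi=\sum_{i,j}a_jb_i\,\partial_{x_i}\phi_j$. $\mathcal{M}(X)$ denotes finite signed Radon measures on $X$, $\mathcal{P}(X)$ probability measures, $L^\infty_{\text{weak-( * )}}$ weakly-( * ) measurable essentially bounded maps, $C_{\rm weak}$ weakly continuous functions. For a parametrized measure $\mathcal{V}$, $\langle\mathcal{V}_{t,x};b\rangle=\int b\,d\mathcal{V}_{t,x}$. Phase space: $\mathcal{F}=\{(s,\mathbf{z},\mathbf{F}): s\in[0,\infty),\ \mathbf{z}\in\mathbb{R}^d,\ \mathbf{F}\in\mathbb{R}^d\}$, where $s$ corresponds to $\varrho$, $\mathbf z$ to $\sqrt{\varrho}\,\mathbf w$ and $\mathbf F$ to $\nabla Q(\varrho)$; $s,\mathbf z,\mathbf F$ also denote the coordinate functions. Initial data $(\varrho_0,\mathbf w_0)$ with $\varrho_0\ge0$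 and $\int_{\mathbb{T}^d}(\frac12\varrho_0|\mathbf w_0|^2+E(\varrho_0))dx<\infty$ are encoded in the initial measure $\mathcal{V}_{0,x}=\delta_{(\varrho_0(x),\sqrt{\varrho_0(x)}\mathbf{w}_0(x))}\in\mathcal{P}([0,\infty)\times\mathbb{R}^d)$. Definition (measure-valued solution). A parametrized measure $\mathcal{V}\in L^\infty_{\text{weak-( * )}}((0,T)\times\mathbb{T}^d;\mathcal{P}(\mathcal{F}))$ is a measure-valued solution in $(0,T)\times\mathbb{T}^d$ with initial data $(\varrho_0,\mathbf{w}_0)$ and dissipation defect $\mathcal{D}\in L^\infty(0,T)$, $\mathcal{D}\ge0$, if the following hold. (1) Regularity: $\varrho:=\langle\mathcal{V}_{t,x};s\rangle\in C_{\rm weak}(0,T;L^{\gamma+1}(\mathbb{T}^d))$; $\varrho^\alpha=\langle\mathcal{V}_{t,x};s^\alpha\rangle\in C_{\rm weak}(0,T;L^{(\gamma+1)/\alpha}(\mathbb{T}^d))$ for $0<\alpha<\gamma+1$; $\langle\mathcal{V}_{t,x};\mathbf z\rangle\in L^\infty(0,T;L^2(\mathbb{T}^d))$ with $\sqrt{\varrho}\langle\mathcal{V}_{t,x};\mathbf z\rangle=\langle\mathcal{V}_{t,x};\sqrt{s}\,\mathbf z\rangle$; $Q(\varrho)=\langle\mathcal{V}_{t,x};Q(s)\rangle\in L^2(0,T;W^{1,2}(\mathbb{T}^d))$ with $\nabla Q(\varrho)=\langle\mathcal{V}_{t,x};\mathbf F\rangle$. (2) Continuity equation: for a.e. $\tau\in(0,T)$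 and all $\psi\in C^1([0,T]\times\mathbb{T}^d)$, $$\int_{\mathbb{T}^d}\varrho(\tau,\cdot)\psi(\tau,\cdot)dx-\int_{\mathbb{T}^d}\varrho_0\psi(0,\cdot)dx=\int_0^\tau\!\!\int_{\mathbb{T}^d}\big[\varrho\,\partial_t\psi+\sqrt\varrho\,\langle\mathcal{V}_{t,x};\mathbf z\rangle\cdot\nabla\psi-\sqrt\varrho\,\nabla Q(\varrho)\cdot\nabla\psi\big]dx\,dt.$$ (3) Momentum equation: there exist $r^M\in L^\infty_{\text{weak-( * )}}(0,T;\mathcal{M}(\mathbb{T}^d;\mathbb{R}^{d\times d}))+\mathcal{M}([0,T]\times\mathbb{T}^d;\mathbb{R}^{d\times d})$ and $\xi\in L^1(0,T)$ such that for a.e. $\tau\in(0,T)$, all $\epsilon>0$ and all $\boldsymbol\phi\in C^1([0,T]\times\mathbb{T}^d;\mathbb{R}^d)$, $$\int_{\mathbb{T}^d}\sqrt{\varrho}(\tau,x)\langle\mathcal{V}_{\tau,x};\mathbf z\rangle\cdot\boldsymbol\phi(\tau,x)dx-\int_{\mathbb{T}^d}\langle\mathcal{V}_{0,x};\sqrt s\,\mathbf z\rangle\cdot\boldsymbol\phi(0,x)dx$$ $$=\int_0^\tau\!\!\int_{\mathbb{T}^d}\big[\sqrt\varrho\langle\mathcal{V}_{t,x};\mathbf z\rangle\cdot\partial_t\boldsymbol\phi+\langle\mathcal{V}_{t,x};\mathbf z\otimes\mathbf z\rangle:\nabla\boldsymbol\phi-\langle\mathcal{V}_{t,x};\mathbf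 z\otimes\mathbf F\rangle:\nabla\boldsymbol\phi\big]dx\,dt+\langle r^M;\nabla\boldsymbol\phi\rangle_{\mathcal{M}([0,\tau]\times\mathbb{T}^d),C([0,\tau]\times\mathbb{T}^d)},$$ $$\big|\langle r^M;\nabla\boldsymbol\phi\rangle_{\mathcal{M}([0,\tau]\times\mathbb{T}^d),C([0,\tau]\times\mathbb{T}^d)}\big|\le\Big(1+\frac1{4\epsilon}\Big)\int_0^\tau\xi(t)\mathcal{D}(t)\|\boldsymbol\phi(t)\|_{C^1(\mathbb{T}^d)}dt+\epsilon\|\boldsymbol\phi\|_{C^1([0,\tau]\times\mathbb{T}^d)}\mathcal{D}(\tau).$$ (4) Energy inequality: there exist $\mathcal{R}\in L^\infty_{\text{weak-( * )}}(0,T;\mathcal{M}(\mathbb{T}^d))+\mathcal{M}([0,T]\times\mathbb{T}^d)$ and a constant $C$ such that for a.e. $\tau\in(0,T)$ and all $\epsilon>0$, $$\int_{\mathbb{T}^d}\langle\mathcal{V}_{\tau,x};\tfrac12|\mathbf z|^2+E(s)\rangle dx+\int_0^\tau\!\!\int_{\mathbb{T}^d}\langle\mathcal{V}_{t,x};|\mathbf F|^2\rangle dx\,dt+\mathcal{D}(\tau)$$ $$\le\int_{\mathbb{T}^d}\langle\mathcal{V}_{0,x};\tfrac12|\mathbf z|^2+E(s)\rangle dx+\int_0^\tau\!\!\int_{\mathbb{T}^d}\langle\mathcal{V}_{t,x};\mathbf z\cdot\mathbf F\rangle dx\,dt+\int_{(0,\tau)\times\mathbb{T}^d}d\mathcal{R},$$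 $$\Big|\int_{(0,\tau)\times\mathbb{T}^d}d\mathcal{R}\Big|\le C\Big(1+\frac1{4\epsilon}\Big)\int_0^\tau\mathcal{D}(t)dt+\epsilon\,\mathcal{D}(\tau),$$ and $\langle\mathcal{V}_{t,x};E(s)\rangle=E(\varrho)$. *)

theory Defs
  imports "HOL-Probability.Giry_Monad"
begin

section \<open>Constitutive functions\<close>

definition pres :: "real \<Rightarrow> real \<Rightarrow> real" where
  "pres \<gamma> r = r powr \<gamma>"

definition Epot :: "real \<Rightarrow> real \<Rightarrow> real" where
  "Epot \<gamma> r = integral {0..r} (pres \<gamma>)"

text \<open>The function with \<open>Q' = sqrt r * p' r\<close> and \<open>Q 0 = 0\<close>; see \<open>Qfun_0\<close> and
  \<open>Qfun_has_derivative\<close> below.\<close>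

definition Qfun :: "real \<Rightarrow> real \<Rightarrow> real" where
  "Qfun \<gamma> r = integral {0..r} (\<lambda>s. sqrt s * deriv (pres \<gamma>) s)"

lemma Qfun_0: "Qfun \<gamma> 0 = 0"
  by (simp add: Qfun_def)

lemma deriv_pres: "s > 0 \<Longrightarrow> deriv (pres \<gamma>) s = \<gamma> * s powr (\<gamma> - 1)"
  unfolding pres_def
  by (rule DERIV_imp_deriv) (auto intro!: derivative_eq_intros simp: powr_diff)

lemma Epot_eq: "\<gamma> \<ge> 1 \<Longrightarrow> r \<ge> 0 \<Longrightarrow> Epot \<gamma> r = r powr (\<gamma> + 1) / (\<gamma> + 1)"
  using has_integral_powr_from_0[of \<gamma> r] unfolding Epot_def pres_def
  by (auto intro: integral_unique)

lemma Qfun_eq: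
  assumes "\<gamma> \<ge> 1" "r \<ge> 0"
  shows "Qfun \<gamma> r = \<gamma> * r powr (\<gamma> + 1/2) / (\<gamma> + 1/2)"
proof -
  have "((\<lambda>s. \<gamma> * s powr (\<gamma> - 1/2)) has_integral
      \<gamma> * (r powr (\<gamma> - 1/2 + 1) / (\<gamma> - 1/2 + 1))) {0..r}"
    using assms by (intro has_integral_mult_right has_integral_powr_from_0) auto
  also have "?this \<longleftrightarrow> ((\<lambda>s. sqrt s * deriv (pres \<gamma>) s) has_integral
      \<gamma> * (r powr (\<gamma> - 1/2 + 1) / (\<gamma> - 1/2 + 1))) {0..r}"
  proof (rule has_integral_spike_eq[where S = "{0}"])
    fix s assume "s \<in> {0..r} - {0}"
    then have "s > 0" by auto
    then have "sqrt s * s powr (\<gamma> - 1) = s powr (1/2 + (\<gamma> - 1))"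
      by (simp only: powr_add powr_half_sqrt)
    also have "1/2 + (\<gamma> - 1) = \<gamma> - 1/2" by simp
    finally show "sqrt s * deriv (pres \<gamma>) s = \<gamma> * s powr (\<gamma> - 1/2)"
      using \<open>s > 0\<close> by (simp add: deriv_pres)
  qed auto
  finally show ?thesis
    unfolding Qfun_def by (simp add: integral_unique add.commute)
qed

lemma Qfun_has_derivative:
  assumes "\<gamma> \<ge> 1" "r > 0"
  shows "(Qfun \<gamma> has_real_derivative sqrt r * deriv (pres \<gamma>) r) (at r)"
proof -
  have "((\<lambda>r. \<gamma> * r powr (\<gamma> + 1/2) / (\<gamma> + 1/2)) has_real_derivative
      \<gamma> * ((\<gamma> + 1/2) * r powr (\<gamma> + 1/2 - 1)) / (\<gamma> + 1/2)) (at r)"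
    using assms by (intro DERIV_cdivide DERIV_cmult has_real_derivative_powr) auto
  also have "\<gamma> * ((\<gamma> + 1/2) * r powr (\<gamma> + 1/2 - 1)) / (\<gamma> + 1/2) = \<gamma> * r powr (\<gamma> - 1/2)"
    using assms by simp
  finally have "((\<lambda>r. \<gamma> * r powr (\<gamma> + 1/2) / (\<gamma> + 1/2)) has_real_derivative
      \<gamma> * r powr (\<gamma> - 1/2)) (at r)" .
  moreover have "\<gamma> * r powr (\<gamma> - 1/2) = sqrt r * deriv (pres \<gamma>) r"
  proof -
    have "sqrt r * r powr (\<gamma> - 1) = r powr (1/2 + (\<gamma> - 1))"
      using assms by (simp only: powr_add powr_half_sqrt)
    also have "1/2 + (\<gamma> - 1) = \<gamma> - 1/2" by simp
    finally show ?thesis using assms by (simp add: deriv_pres)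
  qed
  ultimately show ?thesis
    using assms Qfun_eq
    by (auto intro: has_field_derivative_transform_within_open[where S = "{0<..}"])
qed


section \<open>Function spaces on the flat torus\<close>

text \<open>A function on the torus is a function on \<open>\<real>\<^sup>d\<close> with period 1 in each coordinate.  As a
  measurable space the torus is the half-open unit cell, which carries the same Borel sets and
  the same Lebesgue measure.\<close>

definition torus :: "(real^'d) set" where
  "torus = {x. \<forall>i. 0 \<le> x $ i \<and> x $ i < 1}"

definition periodic :: "(real^'d \<Rightarrow> 'a) \<Rightarrow> bool" where
  "periodic f \<longleftrightarrow> (\<forall>x i. f (x + axis i 1) = f x)"

definition pd :: "'d \<Rightarrow> (real^'d \<Rightarrow> 'a::real_normed_vector) \<Rightarrow> real^'d \<Rightarrow> 'a" where
  "pd i f x = frechet_derivative f (at x) (axis i 1)"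

definition grad :: "(real^'d \<Rightarrow> real) \<Rightarrow> real^'d \<Rightarrow> real^'d" where
  "grad f x = (\<chi> i. pd i f x)"

definition C1_torus :: "(real^'d \<Rightarrow> 'a::real_normed_vector) \<Rightarrow> bool" where
  "C1_torus f \<longleftrightarrow> periodic f \<and> f differentiable_on UNIV \<and> (\<forall>i. continuous_on UNIV (pd i f))"

definition C2_torus :: "(real^'d \<Rightarrow> 'a::real_normed_vector) \<Rightarrow> bool" where
  "C2_torus f \<longleftrightarrow> C1_torus f \<and> (\<forall>i. C1_torus (pd i f))"

text \<open>The choice among equivalent norms is immaterial below: constants are absorbed by \<open>\<xi>\<close> and
  \<open>\<epsilon>\<close> in \<open>mv_momentum\<close>.\<close>

definition C1_norm :: "(real^'d \<Rightarrow> 'a::real_normed_vector) \<Rightarrow> real" where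
  "C1_norm f = (SUP x. norm (f x)) + (\<Sum>i\<in>UNIV. SUP x. norm (pd i f x))"

definition C2_norm :: "(real^'d \<Rightarrow> 'a::real_normed_vector) \<Rightarrow> real" where
  "C2_norm f = C1_norm f + (\<Sum>i\<in>UNIV. \<Sum>j\<in>UNIV. SUP x. norm (pd j (pd i f) x))"

text \<open>The space \<open>C\<^sup>1([0,T]; C\<^sup>2)\<close>: Banach-space valued differentiability, one-sided at the
  end points.\<close>

definition C1_C2 :: "real \<Rightarrow> (real \<Rightarrow> real^'d \<Rightarrow> 'a::real_normed_vector) \<Rightarrow> bool" where
  "C1_C2 T f \<longleftrightarrow> (\<exists>f'. \<forall>t\<in>{0..T}. C2_torus (f t) \<and> C2_torus (f' t) \<and>
     ((\<lambda>s. C2_norm (\<lambda>x. (f s x - f t x) /\<^sub>R (s - t) - f' t x)) \<longlongrightarrow> 0) (at t within {0..T}) \<and>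
     ((\<lambda>s. C2_norm (\<lambda>x. f' s x - f' t x)) \<longlongrightarrow> 0) (at t within {0..T}))"

definition tderiv :: "real \<Rightarrow> (real \<Rightarrow> real^'d \<Rightarrow> 'a::real_normed_vector) \<Rightarrow> real \<Rightarrow> real^'d \<Rightarrow> 'a" where
  "tderiv T f t x = vector_derivative (\<lambda>s. f s x) (at t within {0..T})"

definition C1_space_time :: "real \<Rightarrow> (real \<Rightarrow> real^'d \<Rightarrow> 'a::real_normed_vector) \<Rightarrow> bool" where
  "C1_space_time T \<phi> \<longleftrightarrow>
     (\<forall>t\<in>{0..T}. periodic (\<phi> t) \<and> \<phi> t differentiable_on UNIV) \<and>
     (\<forall>x. (\<lambda>s. \<phi> s x) differentiable_on {0..T}) \<and>
     continuous_on ({0..T} \<times> UNIV) (\<lambda>(t, x). \<phi> t x) \<and>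
     continuous_on ({0..T} \<times> UNIV) (\<lambda>(t, x). tderiv T \<phi> t x) \<and>
     (\<forall>i. continuous_on ({0..T} \<times> UNIV) (\<lambda>(t, x). pd i (\<phi> t) x))"

text \<open>The norm of \<open>C\<^sup>1([0,\<tau>] \<times> torus)\<close> for \<open>\<tau> \<le> T\<close>.\<close>

definition C1_space_time_norm ::
    "real \<Rightarrow> real \<Rightarrow> (real \<Rightarrow> real^'d \<Rightarrow> 'a::real_normed_vector) \<Rightarrow> real" where
  "C1_space_time_norm T \<tau> \<phi> =
     (SUP (t, x)\<in>{0..\<tau>} \<times> UNIV. norm (\<phi> t x)) +
     (SUP (t, x)\<in>{0..\<tau>} \<times> UNIV. norm (tderiv T \<phi> t x)) +
     (\<Sum>i\<in>UNIV. SUP (t, x)\<in>{0..\<tau>} \<times> UNIV. norm (pd i (\<phi> t) x))"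

definition Lp :: "real \<Rightarrow> (real^'d \<Rightarrow> real) \<Rightarrow> bool" where
  "Lp q f \<longleftrightarrow> set_borel_measurable lebesgue torus f \<and>
     set_integrable lebesgue torus (\<lambda>x. \<bar>f x\<bar> powr q)"

text \<open>\<open>C\<^sub>w\<^sub>e\<^sub>a\<^sub>k(0,T; L\<^sup>q)\<close> for \<open>1 < q < \<infinity>\<close>, tested with the dual space \<open>L\<^sup>q\<^sup>'\<close>, where
  \<open>q' = q / (q - 1)\<close>.  Since \<open>f\<close> comes from an almost everywhere defined parametrized measure,
  it is only required to have a weakly continuous representative.\<close>

definition Cweak :: "real \<Rightarrow> real \<Rightarrow> (real \<Rightarrow> real^'d \<Rightarrow> real) \<Rightarrow> bool" where
  "Cweak T q f \<longleftrightarrow> (\<exists>r. (\<forall>t\<in>{0<..<T}. Lp q (r t)) \<and>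
     (\<forall>g. Lp (q / (q - 1)) g \<longrightarrow>
        continuous_on {0<..<T} (\<lambda>t. LINT x:torus|lebesgue. r t x * g x)) \<and>
     (AE (t, x) in lebesgue_on ({0<..<T} \<times> torus). r t x = f t x))"

definition Linf_L2 :: "real \<Rightarrow> (real \<Rightarrow> real^'d \<Rightarrow> 'a::euclidean_space) \<Rightarrow> bool" where
  "Linf_L2 T f \<longleftrightarrow>
     set_borel_measurable lebesgue ({0<..<T} \<times> torus) (\<lambda>(t, x). f t x) \<and>
     (\<exists>K. AE t in lebesgue_on {0<..<T}.
        set_integrable lebesgue torus (\<lambda>x. (norm (f t x))\<^sup>2) \<and>
        (LINT x:torus|lebesgue. (norm (f t x))\<^sup>2) \<le> K)"

text \<open>Weak gradient on the torus.  By density, \<open>C\<^sup>1\<close> and smooth test functions give the same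
  notion.\<close>

definition has_weak_gradient :: "(real^'d \<Rightarrow> real) \<Rightarrow> (real^'d \<Rightarrow> real^'d) \<Rightarrow> bool" where
  "has_weak_gradient q g \<longleftrightarrow> set_integrable lebesgue torus q \<and> set_integrable lebesgue torus g \<and>
     (\<forall>\<psi> i. C1_torus \<psi> \<longrightarrow>
        (LINT x:torus|lebesgue. q x * pd i \<psi> x) = - (LINT x:torus|lebesgue. g x $ i * \<psi> x))"

text \<open>The function \<open>q\<close> belongs to \<open>L\<^sup>2(0,T; W\<^sup>1\<^sup>,\<^sup>2)\<close> and has spatial gradient \<open>g\<close>.  As the
  spaces are separable, strong measurability in time amounts to joint measurability.\<close>

definition L2_W12 :: "real \<Rightarrow> (real \<Rightarrow> real^'d \<Rightarrow> real) \<Rightarrow> (real \<Rightarrow> real^'d \<Rightarrow> real^'d) \<Rightarrow> bool" where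
  "L2_W12 T q g \<longleftrightarrow>
     set_borel_measurable lebesgue ({0<..<T} \<times> torus) (\<lambda>(t, x). q t x) \<and>
     set_borel_measurable lebesgue ({0<..<T} \<times> torus) (\<lambda>(t, x). g t x) \<and>
     set_integrable lebesgue ({0<..<T} \<times> torus) (\<lambda>(t, x). (q t x)\<^sup>2) \<and>
     set_integrable lebesgue ({0<..<T} \<times> torus) (\<lambda>(t, x). (norm (g t x))\<^sup>2) \<and>
     (AE t in lebesgue_on {0<..<T}. has_weak_gradient (q t) (g t))"


section \<open>Finite signed measures\<close>

text \<open>On the spaces used below (compact metrizable, with their Borel sets) every finite signed
  Borel measure is Radon.\<close>

definition signed_measure :: "'a measure \<Rightarrow> ('a set \<Rightarrow> real) \<Rightarrow> bool" where
  "signed_measure M \<mu> \<longleftrightarrow> (\<forall>A :: nat \<Rightarrow> 'a set. range A \<subseteq> sets M \<longrightarrow> disjoint_family A \<longrightarrow>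
     (\<lambda>n. \<mu> (A n)) sums \<mu> (\<Union>n. A n))"

text \<open>The two parts of the Jordan decomposition.\<close>

definition pos_part :: "'a measure \<Rightarrow> ('a set \<Rightarrow> real) \<Rightarrow> 'a measure" where
  "pos_part M \<mu> = measure_of (space M) (sets M) (\<lambda>A. SUP B\<in>{B \<in> sets M. B \<subseteq> A}. ennreal (\<mu> B))"

definition neg_part :: "'a measure \<Rightarrow> ('a set \<Rightarrow> real) \<Rightarrow> 'a measure" where
  "neg_part M \<mu> = pos_part M (\<lambda>A. - \<mu> A)"

definition signed_integral :: "'a measure \<Rightarrow> ('a set \<Rightarrow> real) \<Rightarrow> ('a \<Rightarrow> real) \<Rightarrow> real" where
  "signed_integral M \<mu> f = (\<integral>x. f x \<partial>pos_part M \<mu>) - (\<integral>x. f x \<partial>neg_part M \<mu>)"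

definition total_variation :: "'a measure \<Rightarrow> ('a set \<Rightarrow> real) \<Rightarrow> real" where
  "total_variation M \<mu> = measure (pos_part M \<mu>) (space M) + measure (neg_part M \<mu>) (space M)"

lemma signed_integral_measure:
  assumes "finite_measure M"
  shows "signed_integral M (measure M) f = (\<integral>x. f x \<partial>M)"
proof -
  interpret finite_measure M by fact
  have 1: "(SUP B\<in>{B \<in> sets M. B \<subseteq> A}. ennreal (measure M B)) = emeasure M A"
    if "A \<in> sets M" for A
    using that by (intro antisym SUP_least SUP_upper2[of A])
      (auto simp: emeasure_eq_measure[symmetric] intro: emeasure_mono)
  have "pos_part M (measure M) = measure_of (space M) (sets M) (emeasure M)"
    unfolding pos_part_def by (intro measure_of_eq) (auto simp: 1 sets.space_closed sets.sigma_sets_eq)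
  then have pos: "pos_part M (measure M) = M"
    by (simp add: measure_of_of_measure)
  have 2: "(SUP B\<in>{B \<in> sets M. B \<subseteq> A}. ennreal (- measure M B)) = 0" for A
    by (rule SUP_eq_const) (auto simp: ennreal_neg)
  have "neg_part M (measure M) = null_measure M"
    unfolding neg_part_def pos_part_def 2
    by (rule measure_eqI) (auto simp: emeasure_sigma)
  with pos show ?thesis
    by (simp add: signed_integral_def)
qed

abbreviation torus_borel :: "(real^'d) measure" where
  "torus_borel \<equiv> restrict_space borel torus"

abbreviation space_time_borel :: "real \<Rightarrow> (real \<times> (real^'d)) measure" where
  "space_time_borel T \<equiv> restrict_space borel ({0..T} \<times> torus)"

text \<open>\<open>L\<^sup>\<infinity>(0,T; \<M>(torus))\<close> with weak-(*) measurability.\<close>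

definition Linf_weakstar_meas :: "real \<Rightarrow> (real \<Rightarrow> (real^'d) set \<Rightarrow> real) \<Rightarrow> bool" where
  "Linf_weakstar_meas T \<mu> \<longleftrightarrow>
     (AE t in lebesgue_on {0<..<T}. signed_measure torus_borel (\<mu> t)) \<and>
     (\<forall>g. periodic g \<longrightarrow> continuous_on UNIV g \<longrightarrow>
        set_borel_measurable lebesgue {0<..<T} (\<lambda>t. signed_integral torus_borel (\<mu> t) g)) \<and>
     (\<exists>K. AE t in lebesgue_on {0<..<T}. total_variation torus_borel (\<mu> t) \<le> K)"

text \<open>An element of \<open>L\<^sup>\<infinity>(0,T; \<M>(torus; \<real>\<^sup>d\<^sup>\<times>\<^sup>d)) + \<M>([0,T] \<times> torus; \<real>\<^sup>d\<^sup>\<times>\<^sup>d)\<close> is given by the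
  summands \<open>\<mu>\<close> and \<open>\<nu>\<close>, each a matrix of signed measures; it is paired with a continuous matrix
  field over the closed set \<open>[0,\<tau>] \<times> torus\<close>.\<close>

definition matrix_pairing ::
    "real \<Rightarrow> ('d \<Rightarrow> 'd \<Rightarrow> real \<Rightarrow> (real^'d) set \<Rightarrow> real) \<Rightarrow>
     ('d \<Rightarrow> 'd \<Rightarrow> (real \<times> (real^'d)) set \<Rightarrow> real) \<Rightarrow> real \<Rightarrow>
     ('d \<Rightarrow> 'd \<Rightarrow> real \<Rightarrow> real^'d \<Rightarrow> real) \<Rightarrow> real" where
  "matrix_pairing T \<mu> \<nu> \<tau> G = (\<Sum>i\<in>UNIV. \<Sum>j\<in>UNIV.
     (LINT t:{0<..<\<tau>}|lebesgue. signed_integral torus_borel (\<mu> i j t) (G i j t)) +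
     signed_integral (space_time_borel T) (\<nu> i j) (\<lambda>(t, x). indicator {0..\<tau>} t * G i j t x))"


section \<open>Measure-valued solutions\<close>

text \<open>Points of the phase space are triples \<open>(s, z, F)\<close>.\<close>

type_synonym 'd phase = "real \<times> (real^'d) \<times> (real^'d)"

definition phase_space :: "'d::finite phase set" where
  "phase_space = {(s, z, F). s \<ge> 0}"

abbreviation phase_borel :: "'d::finite phase measure" where
  "phase_borel \<equiv> restrict_space borel phase_space"

definition C0_phase :: "('d::finite phase \<Rightarrow> real) \<Rightarrow> bool" where
  "C0_phase b \<longleftrightarrow> continuous_on phase_space b \<and>
     (\<forall>e>0. \<exists>R. \<forall>y\<in>phase_space. norm y > R \<longrightarrow> \<bar>b y\<bar> < e)"

type_synonym 'd young = "real \<Rightarrow> real^'d \<Rightarrow> 'd phase measure"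

definition expect :: "'d::finite young \<Rightarrow> ('d phase \<Rightarrow> 'a::euclidean_space) \<Rightarrow> real \<Rightarrow> real^'d \<Rightarrow> 'a" where
  "expect \<V> b t x = (\<integral>y. b y \<partial>\<V> t x)"

abbreviation dens :: "'d::finite young \<Rightarrow> real \<Rightarrow> real^'d \<Rightarrow> real" where
  "dens \<V> \<equiv> expect \<V> (\<lambda>(s, z, F). s)"

abbreviation zmean :: "'d::finite young \<Rightarrow> real \<Rightarrow> real^'d \<Rightarrow> real^'d" where
  "zmean \<V> \<equiv> expect \<V> (\<lambda>(s, z, F). z)"

abbreviation Fmean :: "'d::finite young \<Rightarrow> real \<Rightarrow> real^'d \<Rightarrow> real^'d" where
  "Fmean \<V> \<equiv> expect \<V> (\<lambda>(s, z, F). F)"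

text \<open>\<open>L\<^sup>\<infinity>((0,T) \<times> torus; \<P>(phase_space))\<close> with weak-(*) measurability.\<close>

definition parametrized_measure :: "real \<Rightarrow> 'd::finite young \<Rightarrow> bool" where
  "parametrized_measure T \<V> \<longleftrightarrow>
     (AE (t, x) in lebesgue_on ({0<..<T} \<times> torus).
        prob_space (\<V> t x) \<and> sets (\<V> t x) = sets phase_borel) \<and>
     (\<forall>b. C0_phase b \<longrightarrow>
        set_borel_measurable lebesgue ({0<..<T} \<times> torus) (\<lambda>(t, x). expect \<V> b t x))"

text \<open>The initial Dirac measures live on \<open>[0,\<infinity>) \<times> \<real>\<^sup>d\<close> (no gradient component).\<close>

definition initial_measure ::
    "(real^'d \<Rightarrow> real) \<Rightarrow> (real^'d \<Rightarrow> real^'d) \<Rightarrow> real^'d \<Rightarrow> (real \<times> (real^'d)) measure" where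
  "initial_measure \<rho>0 w0 x =
     return (restrict_space borel ({0..} \<times> UNIV)) (\<rho>0 x, sqrt (\<rho>0 x) *\<^sub>R w0 x)"

definition initial_data :: "real \<Rightarrow> (real^'d \<Rightarrow> real) \<Rightarrow> (real^'d \<Rightarrow> real^'d) \<Rightarrow> bool" where
  "initial_data \<gamma> \<rho>0 w0 \<longleftrightarrow>
     set_borel_measurable lebesgue torus \<rho>0 \<and> set_borel_measurable lebesgue torus w0 \<and>
     (AE x in lebesgue_on torus. \<rho>0 x \<ge> 0) \<and>
     set_integrable lebesgue torus (\<lambda>x. 1/2 * \<rho>0 x * (norm (w0 x))\<^sup>2 + Epot \<gamma> (\<rho>0 x))"

text \<open>The Bochner integral of a non-integrable function is 0 by convention, so the existence of
  the integrals occurring in the definition is stated explicitly: here for the moments under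
  \<open>\<V> t x\<close> (all moments that are used are dominated by these three and constants), and in the
  equations below for the integrals over the torus and over space-time.\<close>

definition finite_moments :: "real \<Rightarrow> real \<Rightarrow> 'd::finite young \<Rightarrow> bool" where
  "finite_moments \<gamma> T \<V> \<longleftrightarrow> (AE (t, x) in lebesgue_on ({0<..<T} \<times> torus).
     integrable (\<V> t x) (\<lambda>(s, z, F). Epot \<gamma> s) \<and>
     integrable (\<V> t x) (\<lambda>(s, z, F). (norm z)\<^sup>2) \<and>
     integrable (\<V> t x) (\<lambda>(s, z, F). (norm F)\<^sup>2))"

definition mv_regularity :: "real \<Rightarrow> real \<Rightarrow> 'd::finite young \<Rightarrow> bool" where
  "mv_regularity \<gamma> T \<V> \<longleftrightarrow>
     Cweak T (\<gamma> + 1) (dens \<V>) \<and>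
     (\<forall>\<alpha>. 0 < \<alpha> \<and> \<alpha> < \<gamma> + 1 \<longrightarrow>
        (AE (t, x) in lebesgue_on ({0<..<T} \<times> torus).
           dens \<V> t x powr \<alpha> = expect \<V> (\<lambda>(s, z, F). s powr \<alpha>) t x) \<and>
        Cweak T ((\<gamma> + 1) / \<alpha>) (\<lambda>t x. dens \<V> t x powr \<alpha>)) \<and>
     Linf_L2 T (zmean \<V>) \<and>
     (AE (t, x) in lebesgue_on ({0<..<T} \<times> torus).
        sqrt (dens \<V> t x) *\<^sub>R zmean \<V> t x = expect \<V> (\<lambda>(s, z, F). sqrt s *\<^sub>R z) t x) \<and>
     (AE (t, x) in lebesgue_on ({0<..<T} \<times> torus).
        Qfun \<gamma> (dens \<V> t x) = expect \<V> (\<lambda>(s, z, F). Qfun \<gamma> s) t x) \<and>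
     L2_W12 T (\<lambda>t x. Qfun \<gamma> (dens \<V> t x)) (Fmean \<V>)"

text \<open>By \<open>mv_regularity\<close>, \<open>Fmean \<V>\<close> is the weak gradient of \<open>Qfun \<gamma> \<circ> dens \<V>\<close>, and is used for
  it here.\<close>

definition mv_continuity :: "real \<Rightarrow> (real^'d \<Rightarrow> real) \<Rightarrow> 'd::finite young \<Rightarrow> bool" where
  "mv_continuity T \<rho>0 \<V> \<longleftrightarrow>
     (AE \<tau> in lebesgue_on {0<..<T}. \<forall>\<psi>. C1_space_time T \<psi> \<longrightarrow>
        (let f = (\<lambda>(t, x). dens \<V> t x * tderiv T \<psi> t x
               + sqrt (dens \<V> t x) * (zmean \<V> t x \<bullet> grad (\<psi> t) x)
               - sqrt (dens \<V> t x) * (Fmean \<V> t x \<bullet> grad (\<psi> t) x)) in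
         set_integrable lebesgue torus (\<lambda>x. dens \<V> \<tau> x * \<psi> \<tau> x) \<and>
         set_integrable lebesgue torus (\<lambda>x. \<rho>0 x * \<psi> 0 x) \<and>
         set_integrable lebesgue ({0<..<\<tau>} \<times> torus) f \<and>
         (LINT x:torus|lebesgue. dens \<V> \<tau> x * \<psi> \<tau> x) - (LINT x:torus|lebesgue. \<rho>0 x * \<psi> 0 x)
           = (LINT p:{0<..<\<tau>} \<times> torus|lebesgue. f p)))"

definition mv_momentum :: "real \<Rightarrow> (real^'d \<Rightarrow> (real \<times> (real^'d)) measure) \<Rightarrow>
    'd::finite young \<Rightarrow> (real \<Rightarrow> real) \<Rightarrow> bool" where
  "mv_momentum T \<V>0 \<V> \<D> \<longleftrightarrow>
     (\<exists>\<mu> \<nu> \<xi>.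
        (\<forall>i j. Linf_weakstar_meas T (\<mu> i j)) \<and>
        (\<forall>i j. signed_measure (space_time_borel T) (\<nu> i j)) \<and>
        set_integrable lebesgue {0<..<T} \<xi> \<and>
        (AE \<tau> in lebesgue_on {0<..<T}. \<forall>\<epsilon>>0. \<forall>\<phi> :: real \<Rightarrow> real^'d \<Rightarrow> real^'d.
           C1_space_time T \<phi> \<longrightarrow>
           (let f = (\<lambda>(t, x). sqrt (dens \<V> t x) * (zmean \<V> t x \<bullet> tderiv T \<phi> t x)
                  + (\<Sum>i\<in>UNIV. \<Sum>j\<in>UNIV.
                       expect \<V> (\<lambda>(s, z, F). z $ j * z $ i) t x * pd i (\<phi> t) x $ j)
                  - (\<Sum>i\<in>UNIV. \<Sum>j\<in>UNIV.
                       expect \<V> (\<lambda>(s, z, F). z $ j * F $ i) t x * pd i (\<phi> t) x $ j));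
                u0 = (\<lambda>x. \<integral>(s, z). sqrt s *\<^sub>R z \<partial>\<V>0 x);
                r = matrix_pairing T \<mu> \<nu> \<tau> (\<lambda>i j t x. pd i (\<phi> t) x $ j) in
            set_integrable lebesgue torus
              (\<lambda>x. sqrt (dens \<V> \<tau> x) * (zmean \<V> \<tau> x \<bullet> \<phi> \<tau> x)) \<and>
            set_integrable lebesgue torus (\<lambda>x. u0 x \<bullet> \<phi> 0 x) \<and>
            set_integrable lebesgue ({0<..<\<tau>} \<times> torus) f \<and>
            (LINT x:torus|lebesgue. sqrt (dens \<V> \<tau> x) * (zmean \<V> \<tau> x \<bullet> \<phi> \<tau> x))
              - (LINT x:torus|lebesgue. u0 x \<bullet> \<phi> 0 x)
              = (LINT p:{0<..<\<tau>} \<times> torus|lebesgue. f p) + r \<and>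
            \<bar>r\<bar> \<le> (1 + 1 / (4 * \<epsilon>)) * (LINT t:{0<..<\<tau>}|lebesgue. \<xi> t * \<D> t * C1_norm (\<phi> t))
                  + \<epsilon> * C1_space_time_norm T \<tau> \<phi> * \<D> \<tau>)))"

definition mv_energy :: "real \<Rightarrow> real \<Rightarrow> (real^'d \<Rightarrow> (real \<times> (real^'d)) measure) \<Rightarrow>
    'd::finite young \<Rightarrow> (real \<Rightarrow> real) \<Rightarrow> bool" where
  "mv_energy \<gamma> T \<V>0 \<V> \<D> \<longleftrightarrow>
     (\<exists>(\<mu> :: real \<Rightarrow> (real^'d) set \<Rightarrow> real) (\<nu> :: (real \<times> (real^'d)) set \<Rightarrow> real) C.
        Linf_weakstar_meas T \<mu> \<and> signed_measure (space_time_borel T) \<nu> \<and>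
        (AE \<tau> in lebesgue_on {0<..<T}. \<forall>\<epsilon>>0.
           (let e = expect \<V> (\<lambda>(s, z, F). 1/2 * (norm z)\<^sup>2 + Epot \<gamma> s);
                e0 = (\<lambda>x. \<integral>(s, z). 1/2 * (norm z)\<^sup>2 + Epot \<gamma> s \<partial>\<V>0 x);
                FF = (\<lambda>(t, x). expect \<V> (\<lambda>(s, z, F). (norm F)\<^sup>2) t x);
                zF = (\<lambda>(t, x). expect \<V> (\<lambda>(s, z, F). z \<bullet> F) t x);
                R = (LINT t:{0<..<\<tau>}|lebesgue. \<mu> t torus) + \<nu> ({0<..<\<tau>} \<times> torus) in
            set_integrable lebesgue torus (e \<tau>) \<and>
            set_integrable lebesgue torus e0 \<and>
            set_integrable lebesgue ({0<..<\<tau>} \<times> torus) FF \<and>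
            set_integrable lebesgue ({0<..<\<tau>} \<times> torus) zF \<and>
            (LINT x:torus|lebesgue. e \<tau> x) + (LINT p:{0<..<\<tau>} \<times> torus|lebesgue. FF p) + \<D> \<tau>
              \<le> (LINT x:torus|lebesgue. e0 x) + (LINT p:{0<..<\<tau>} \<times> torus|lebesgue. zF p) + R \<and>
            \<bar>R\<bar> \<le> C * (1 + 1 / (4 * \<epsilon>)) * (LINT t:{0<..<\<tau>}|lebesgue. \<D> t) + \<epsilon> * \<D> \<tau>))) \<and>
     (AE (t, x) in lebesgue_on ({0<..<T} \<times> torus).
        expect \<V> (\<lambda>(s, z, F). Epot \<gamma> s) t x = Epot \<gamma> (dens \<V> t x))"

definition dissipation_defect :: "real \<Rightarrow> (real \<Rightarrow> real) \<Rightarrow> bool" where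
  "dissipation_defect T \<D> \<longleftrightarrow> set_borel_measurable lebesgue {0<..<T} \<D> \<and>
     (\<exists>K. AE t in lebesgue_on {0<..<T}. \<D> t \<le> K) \<and> (AE t in lebesgue_on {0<..<T}. 0 \<le> \<D> t)"

definition mv_solution :: "real \<Rightarrow> real \<Rightarrow> (real^'d \<Rightarrow> real) \<Rightarrow> (real^'d \<Rightarrow> real^'d) \<Rightarrow>
    'd::finite young \<Rightarrow> (real \<Rightarrow> real) \<Rightarrow> bool" where
  "mv_solution \<gamma> T \<rho>0 w0 \<V> \<D> \<longleftrightarrow>
     initial_data \<gamma> \<rho>0 w0 \<and> parametrized_measure T \<V> \<and> dissipation_defect T \<D> \<and>
     finite_moments \<gamma> T \<V> \<and> mv_regularity \<gamma> T \<V> \<and> mv_continuity T \<rho>0 \<V> \<and>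
     mv_momentum T (initial_measure \<rho>0 w0) \<V> \<D> \<and>
     mv_energy \<gamma> T (initial_measure \<rho>0 w0) \<V> \<D>"


section \<open>Strong solutions\<close>

definition strong_solution :: "real \<Rightarrow> real \<Rightarrow> (real \<Rightarrow> real^'d \<Rightarrow> real) \<Rightarrow>
    (real \<Rightarrow> real^'d \<Rightarrow> real^'d) \<Rightarrow> bool" where
  "strong_solution \<gamma> T \<rho> w \<longleftrightarrow>
     (\<forall>t\<in>{0<..<T}. \<forall>x.
        tderiv T \<rho> t x + (\<Sum>i\<in>UNIV. pd i (\<lambda>x. \<rho> t x * w t x $ i) x)
          - (\<Sum>i\<in>UNIV. pd i (\<lambda>x. \<rho> t x * pd i (\<lambda>x. pres \<gamma> (\<rho> t x)) x) x) = 0 \<and>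
        (\<forall>j. tderiv T (\<lambda>t x. \<rho> t x * w t x $ j) t x
              + (\<Sum>i\<in>UNIV. pd i (\<lambda>x. \<rho> t x * w t x $ i * w t x $ j) x)
            = (\<Sum>i\<in>UNIV. pd i (\<lambda>x. \<rho> t x * pd i (\<lambda>x. pres \<gamma> (\<rho> t x)) x * w t x $ j) x)))"

end

theory Submission
  imports Defs
begin

text \<open>The proof is a relative energy argument.  Since the moments of orders 1 and 3/2 of the first
  coordinate are compatible, strict convexity forces \<open>s = \<rho>\<close> almost surely under \<open>\<V>\<close>.  The relative
  energy is
  \<open>\<integral> (\<langle>\<V>; |z - sqrt \<rho> W|\<^sup>2 / 2\<rangle> + E(\<rho>) - E(r) - p(r) (\<rho> - r)) dx + \<D>\<close>, where \<open>(r, W)\<close> is the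
  strong solution.  Testing the momentum equation with \<open>W\<close> and the continuity equation with
  \<open>|W|\<^sup>2 / 2 - p(r)\<close> bounds it by the defect terms plus the space-time integral of an
  expression that is quadratic in \<open>z - sqrt \<rho> W\<close> and \<open>F - sqrt \<rho> \<nabla>p(r)\<close>, up to one linear term
  \<open>sqrt \<rho> (F - sqrt \<rho> \<nabla>p(r)) \<bullet> U - (\<rho> - r) \<partial>\<^sub>t p(r)\<close> with \<open>U = W - \<nabla>p(r)\<close>.  Replacing \<open>sqrt \<rho>\<close> by \<open>sqrt r\<close> there costs
  only a quadratic error, and then \<open>sqrt r U\<close> is an admissible test field for the weak gradient of
  \<open>Q(\<rho>)\<close>, so no chain rule for Sobolev functions is needed; the linear parts cancel by the equation
  for \<open>r\<close>.  Gronwall's lemma on each \<open>(0, \<sigma>)\<close> with \<open>\<sigma> < T\<close>, where the energy is bounded, finishes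
  the proof.\<close>

section \<open>Relative pressure potentials\<close>

text \<open>The weight |W|^2/2 - p(r) in the continuity equation is forced: it is the coefficient of
  the density when |z - sqrt \<rho> W|^2/2 and the Bregman distance of \<open>Epot\<close> are
  expanded, and the rest, r p(r) - E(r), depends on the strong solution alone. Possible vacuum
  shapes the estimate. The density may vanish and only Q(\<rho>) has a weak gradient, so F - sqrt
  \<rho> h, with h the gradient of p(r), need not be a gradient; sqrt r U, in contrast, is C1,
  because r is bounded away from zero. The energy inequality supplies the dissipation -|F - sqrt
  \<rho> h|^2. A quarter of it pays for the coupling with z - sqrt \<rho> W and a quarter for
  exchanging sqrt \<rho> with sqrt r. The remaining half is kept: it is the only control of F and
  identifies the third coordinate once the relative energy vanishes. The defect terms carry
  \<epsilon> times \<open>\<D> \<tau>\<close>; for small \<epsilon> one half of the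
  \<open>\<D> \<tau>\<close> on the left absorbs them. Space-time integrability is available only up
  to almost every \<tau> < T, with constants that may degenerate as \<tau> tends to T.\<close>

lemma nonneg_if_deriv_sign:
  fixes f f' :: "real \<Rightarrow> real"
  assumes cont: "continuous_on {0..} f"
    and der: "\<And>x. x > 0 \<Longrightarrow> (f has_real_derivative f' x) (at x)"
    and sgn: "\<And>x. x > 0 \<Longrightarrow> 0 \<le> f' x * (x - r)"
    and r: "r > 0" "f r = 0" and x: "x \<ge> 0"
  shows "f x \<ge> 0"
proof -
  \<comment> \<open>The mean value theorem asks for the derivative only inside the interval, so
    \<open>a = 0\<close> is allowed although the power functions below need not be differentiable
    there.\<close>
  have mv: "\<exists>u. a < u \<and> u < b \<and> f b - f a = (b - a) * f' u" if "0 \<le> a" "a < b" for a b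
  proof -
    have "continuous_on {a..b} f"
      using that by (intro continuous_on_subset[OF cont]) auto
    moreover have "(f has_derivative (\<lambda>d. f' u * d)) (at u)" if "a < u" "u < b" for u
      using der[of u] \<open>0 \<le> a\<close> that by (simp add: has_field_derivative_def)
    ultimately obtain u where "a < u" "u < b" "f b - f a = f' u * (b - a)"
      using mvt[of a b f "\<lambda>u d. f' u * d"] \<open>a < b\<close> by metis
    then show ?thesis by (auto simp: mult.commute)
  qed
  consider "x = r" | "x < r" | "r < x" by linarith
  then show ?thesis
  proof cases
    case 1
    then show ?thesis using r by simp
  next
    case 2
    obtain u where u: "x < u" "u < r" "f r - f x = (r - x) * f' u" using mv[OF x 2] by auto
    have "f' u \<le> 0"
      using sgn[of u] u x by (auto simp: zero_le_mult_iff)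
    then have "(r - x) * f' u \<le> 0" using 2 by (simp add: mult_nonneg_nonpos)
    then show ?thesis using u r by simp
  next
    case 3
    obtain u where u: "r < u" "u < x" "f x - f r = (x - r) * f' u" using mv[of r x] r 3 by auto
    have "f' u \<ge> 0"
      using sgn[of u] u r by (auto simp: zero_le_mult_iff)
    then show ?thesis using u r 3 by simp
  qed
qed

text \<open>Bregman distance of \<open>Epot\<close>, whose derivative is the pressure;
  \<open>Qfun_rel\<close> is the Bregman distance of \<open>Qfun\<close>.\<close>

definition Epot_rel :: "real \<Rightarrow> real \<Rightarrow> real \<Rightarrow> real" where
  "Epot_rel \<gamma> \<rho> r = Epot \<gamma> \<rho> - Epot \<gamma> r - r powr \<gamma> * (\<rho> - r)"

definition Qfun_rel :: "real \<Rightarrow> real \<Rightarrow> real \<Rightarrow> real" where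
  "Qfun_rel \<gamma> \<rho> r = Qfun \<gamma> \<rho> - Qfun \<gamma> r - \<gamma> * r powr (\<gamma> - 1/2) * (\<rho> - r)"

lemma continuous_on_powr_const: "a > 0 \<Longrightarrow> continuous_on {0..} (\<lambda>x::real. x powr a)"
  by (intro continuous_on_powr') (auto intro!: continuous_intros)

lemma Epot_has_derivative:
  assumes "\<gamma> \<ge> 1" "x > 0"
  shows "(Epot \<gamma> has_real_derivative x powr \<gamma>) (at x)"
proof -
  have "((\<lambda>x. x powr (\<gamma> + 1) / (\<gamma> + 1)) has_real_derivative x powr \<gamma>) (at x)"
    using assms by (auto intro!: derivative_eq_intros)
  then show ?thesis
    using assms Epot_eq by (auto intro: has_field_derivative_transform_within_open[where S = "{0<..}"])
qed

lemma sqrt_mult_powr: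
  assumes "r > 0"
  shows "sqrt r * r powr (\<gamma> - 1) = r powr (\<gamma> - 1/2)"
proof -
  have "sqrt r * r powr (\<gamma> - 1) = r powr (1/2 + (\<gamma> - 1))"
    using assms by (simp only: powr_add powr_half_sqrt)
  also have "1/2 + (\<gamma> - 1) = \<gamma> - 1/2" by simp
  finally show ?thesis .
qed

lemma Qfun_has_derivative':
  assumes "\<gamma> \<ge> 1" "r > 0"
  shows "(Qfun \<gamma> has_real_derivative \<gamma> * r powr (\<gamma> - 1/2)) (at r)"
proof -
  have "sqrt r * deriv (pres \<gamma>) r = \<gamma> * r powr (\<gamma> - 1/2)"
    using assms sqrt_mult_powr[OF assms(2), of \<gamma>] by (simp add: deriv_pres)
  then show ?thesis using Qfun_has_derivative[OF assms] by simp
qed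

lemma continuous_on_Epot: "\<gamma> \<ge> 1 \<Longrightarrow> continuous_on {0..} (Epot \<gamma>)"
  by (subst continuous_on_cong[OF refl Epot_eq])
    (auto intro!: continuous_intros continuous_on_powr_const)

lemma continuous_on_Qfun: "\<gamma> \<ge> 1 \<Longrightarrow> continuous_on {0..} (Qfun \<gamma>)"
  by (subst continuous_on_cong[OF refl Qfun_eq])
    (auto intro!: continuous_intros continuous_on_powr_const)

lemma powr_diff_sign:
  assumes "a \<ge> 0" "x > 0" "r > 0"
  shows "0 \<le> (x powr a - r powr a) * (x - r :: real)"
proof (cases "x \<le> r")
  case True
  then have "x powr a \<le> r powr a" using assms powr_mono2[of a x r] by simp
  then show ?thesis using True by (simp add: mult_nonpos_nonpos)
next
  case False
  then have "r powr a \<le> x powr a" using assms powr_mono2[of a r x] by simp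
  then show ?thesis using False by simp
qed

lemma Epot_rel_has_derivative:
  assumes "\<gamma> \<ge> 1" "x > 0"
  shows "((\<lambda>\<rho>. Epot_rel \<gamma> \<rho> r) has_real_derivative x powr \<gamma> - r powr \<gamma>) (at x)"
proof -
  have "((\<lambda>\<rho>. Epot \<gamma> \<rho> - Epot \<gamma> r - r powr \<gamma> * (\<rho> - r)) has_real_derivative
      x powr \<gamma> - 0 - r powr \<gamma> * (1 - 0)) (at x)"
    by (intro DERIV_diff DERIV_cmult DERIV_const DERIV_ident Epot_has_derivative assms)
  then show ?thesis by (simp add: Epot_rel_def)
qed

lemma Qfun_rel_has_derivative:
  assumes "\<gamma> \<ge> 1" "x > 0"
  shows "((\<lambda>\<rho>. Qfun_rel \<gamma> \<rho> r) has_real_derivative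
    \<gamma> * (x powr (\<gamma> - 1/2) - r powr (\<gamma> - 1/2))) (at x)"
proof -
  have "((\<lambda>\<rho>. Qfun \<gamma> \<rho> - Qfun \<gamma> r - \<gamma> * r powr (\<gamma> - 1/2) * (\<rho> - r)) has_real_derivative
      \<gamma> * x powr (\<gamma> - 1/2) - 0 - \<gamma> * r powr (\<gamma> - 1/2) * (1 - 0)) (at x)"
    by (intro DERIV_diff DERIV_cmult DERIV_const DERIV_ident Qfun_has_derivative' assms)
  then show ?thesis by (simp add: Qfun_rel_def right_diff_distrib)
qed

lemma Qfun_rel_nonneg:
  assumes "\<gamma> \<ge> 1" "r > 0" "\<rho> \<ge> 0"
  shows "Qfun_rel \<gamma> \<rho> r \<ge> 0"
proof (rule nonneg_if_deriv_sign[where r = r and x = \<rho> and f = "\<lambda>\<rho>. Qfun_rel \<gamma> \<rho> r" and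
      f' = "\<lambda>\<rho>. \<gamma> * (\<rho> powr (\<gamma> - 1/2) - r powr (\<gamma> - 1/2))"])
  show "continuous_on {0..} (\<lambda>\<rho>. Qfun_rel \<gamma> \<rho> r)"
    unfolding Qfun_rel_def using assms by (intro continuous_intros continuous_on_Qfun)
  fix x :: real assume x: "x > 0"
  show "((\<lambda>\<rho>. Qfun_rel \<gamma> \<rho> r) has_real_derivative
      \<gamma> * (x powr (\<gamma> - 1/2) - r powr (\<gamma> - 1/2))) (at x)"
    using assms x by (intro Qfun_rel_has_derivative)
  show "0 \<le> \<gamma> * (x powr (\<gamma> - 1/2) - r powr (\<gamma> - 1/2)) * (x - r)"
    using powr_diff_sign[of "\<gamma> - 1/2" x r] assms x by (simp add: mult.assoc)
qed (use assms in \<open>auto simp: Qfun_rel_def\<close>)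

text \<open>As functions of \<rho> both sides vanish at r, and the derivative of their difference is
  a nonnegative multiple of sqrt x - sqrt r, which has the sign of x - r. The bound holds for all
  densities, large ones included, with a factor that depends only on r.\<close>

lemma Qfun_rel_le:
  assumes "\<gamma> \<ge> 1" "r > 0" "\<rho> \<ge> 0"
  shows "Qfun_rel \<gamma> \<rho> r \<le> \<gamma> / sqrt r * Epot_rel \<gamma> \<rho> r"
proof -
  have "0 \<le> \<gamma> / sqrt r * Epot_rel \<gamma> \<rho> r - Qfun_rel \<gamma> \<rho> r"
  proof (rule nonneg_if_deriv_sign[where r = r and x = \<rho> and
        f = "\<lambda>\<rho>. \<gamma> / sqrt r * Epot_rel \<gamma> \<rho> r - Qfun_rel \<gamma> \<rho> r" and
        f' = "\<lambda>\<rho>. \<gamma> / sqrt r * (\<rho> powr \<gamma> - r powr \<gamma>) - \<gamma> * (\<rho> powr (\<gamma> - 1/2) - r powr (\<gamma> - 1/2))"])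
    show "continuous_on {0..} (\<lambda>\<rho>. \<gamma> / sqrt r * Epot_rel \<gamma> \<rho> r - Qfun_rel \<gamma> \<rho> r)"
      unfolding Qfun_rel_def Epot_rel_def using assms
      by (intro continuous_intros continuous_on_Qfun continuous_on_Epot) auto
    fix x :: real assume x: "x > 0"
    show "((\<lambda>\<rho>. \<gamma> / sqrt r * Epot_rel \<gamma> \<rho> r - Qfun_rel \<gamma> \<rho> r) has_real_derivative
        \<gamma> / sqrt r * (x powr \<gamma> - r powr \<gamma>) - \<gamma> * (x powr (\<gamma> - 1/2) - r powr (\<gamma> - 1/2))) (at x)"
      using assms x by (intro DERIV_diff DERIV_cmult Qfun_rel_has_derivative Epot_rel_has_derivative)
    have *: "y powr \<gamma> = sqrt y * y powr (\<gamma> - 1/2)" if "y > 0" for y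
    proof -
      have "sqrt y * y powr (\<gamma> - 1/2) = y powr (1/2 + (\<gamma> - 1/2))"
        using that by (simp only: powr_add powr_half_sqrt)
      then show ?thesis by simp
    qed
    \<comment> \<open>Writing y^\<gamma> as sqrt y times y^(\<gamma> - 1/2) makes the contributions
      of r^(\<gamma> - 1/2) cancel; this dictates the factor \<gamma> / sqrt r.\<close>
    have "\<gamma> / sqrt r * (x powr \<gamma> - r powr \<gamma>) - \<gamma> * (x powr (\<gamma> - 1/2) - r powr (\<gamma> - 1/2))
        = \<gamma> / sqrt r * x powr (\<gamma> - 1/2) * (sqrt x - sqrt r)"
      unfolding *[OF x] *[OF assms(2)] using assms(2)
      by (simp add: divide_simps) (simp add: algebra_simps)
    moreover have "0 \<le> (sqrt x - sqrt r) * (x - r)"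
      by (metis linorder_le_cases diff_ge_0_iff_ge mult_nonneg_nonneg mult_nonpos_nonpos
          diff_le_0_iff_le real_sqrt_le_iff)
    ultimately show "0 \<le> (\<gamma> / sqrt r * (x powr \<gamma> - r powr \<gamma>) - \<gamma> * (x powr (\<gamma> - 1/2) - r powr (\<gamma> - 1/2))) * (x - r)"
      using assms x by (simp add: mult.assoc)
  qed (use assms in \<open>auto simp: Qfun_rel_def Epot_rel_def\<close>)
  then show ?thesis by simp
qed

text \<open>The derivative of the difference is x (x^(\<gamma> - 1) - r^(\<gamma> - 1)), and
  \<gamma> \<ge> 1 gives its sign. For \<gamma> > 1 the Taylor constant \<gamma> r^(\<gamma> - 1) /
  2 would be too large near vacuum.\<close>

lemma Epot_rel_ge:
  assumes "\<gamma> \<ge> 1" "r > 0" "\<rho> \<ge> 0"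
  shows "r powr (\<gamma> - 1) / 2 * (\<rho> - r)\<^sup>2 \<le> Epot_rel \<gamma> \<rho> r"
proof -
  have "0 \<le> Epot_rel \<gamma> \<rho> r - r powr (\<gamma> - 1) / 2 * (\<rho> - r)\<^sup>2"
  proof (rule nonneg_if_deriv_sign[where r = r and x = \<rho> and
        f = "\<lambda>\<rho>. Epot_rel \<gamma> \<rho> r - r powr (\<gamma> - 1) / 2 * (\<rho> - r)\<^sup>2" and
        f' = "\<lambda>\<rho>. (\<rho> powr \<gamma> - r powr \<gamma>) - r powr (\<gamma> - 1) * (\<rho> - r)"])
    show "continuous_on {0..} (\<lambda>\<rho>. Epot_rel \<gamma> \<rho> r - r powr (\<gamma> - 1) / 2 * (\<rho> - r)\<^sup>2)"
      unfolding Epot_rel_def using assms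
      by (intro continuous_intros continuous_on_Epot) auto
    fix x :: real assume x: "x > 0"
    show "((\<lambda>\<rho>. Epot_rel \<gamma> \<rho> r - r powr (\<gamma> - 1) / 2 * (\<rho> - r)\<^sup>2) has_real_derivative
        (x powr \<gamma> - r powr \<gamma>) - r powr (\<gamma> - 1) * (x - r)) (at x)"
      using assms x by (auto intro!: derivative_eq_intros Epot_rel_has_derivative)
    have *: "y powr \<gamma> = y * y powr (\<gamma> - 1)" if "y > 0" for y :: real
      using that by (simp add: powr_diff)
    have "(x powr \<gamma> - r powr \<gamma>) - r powr (\<gamma> - 1) * (x - r) = x * (x powr (\<gamma> - 1) - r powr (\<gamma> - 1))"
      unfolding *[OF x] *[OF assms(2)] by (simp add: algebra_simps)
    then show "0 \<le> (x powr \<gamma> - r powr \<gamma> - r powr (\<gamma> - 1) * (x - r)) * (x - r)"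
      using powr_diff_sign[of "\<gamma> - 1" x r] assms x by (simp add: mult.assoc)
  qed (use assms in \<open>auto simp: Epot_rel_def\<close>)
  then show ?thesis by simp
qed

lemma Epot_rel_nonneg:
  assumes "\<gamma> \<ge> 1" "r > 0" "\<rho> \<ge> 0"
  shows "0 \<le> Epot_rel \<gamma> \<rho> r"
proof -
  have "0 \<le> r powr (\<gamma> - 1) / 2 * (\<rho> - r)\<^sup>2" by simp
  then show ?thesis using Epot_rel_ge[OF assms] by linarith
qed

lemma Epot_rel_eq_0D:
  assumes "\<gamma> \<ge> 1" "r > 0" "\<rho> \<ge> 0" "Epot_rel \<gamma> \<rho> r = 0"
  shows "\<rho> = r"
proof -
  have "r powr (\<gamma> - 1) / 2 * (\<rho> - r)\<^sup>2 \<le> 0"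
    using Epot_rel_ge[OF assms(1-3)] assms(4) by simp
  then show ?thesis using assms(2) by (simp add: mult_le_0_iff)
qed

text \<open>From \<rho> - r = (sqrt \<rho> - sqrt r)(sqrt \<rho> + sqrt r), where the second factor
  is at least sqrt r. This is the price of replacing sqrt \<rho> by sqrt r.\<close>

lemma sqrt_diff_sq_le_Epot_rel:
  assumes "\<gamma> \<ge> 1" "r > 0" "\<rho> \<ge> 0"
  shows "(sqrt \<rho> - sqrt r)\<^sup>2 \<le> 2 * r powr (- \<gamma>) * Epot_rel \<gamma> \<rho> r"
proof -
  have "(\<rho> - r)\<^sup>2 = (sqrt \<rho> - sqrt r)\<^sup>2 * (sqrt \<rho> + sqrt r)\<^sup>2"
    using assms by (simp flip: power_mult_distrib add: algebra_simps)
  moreover have "r \<le> (sqrt \<rho> + sqrt r)\<^sup>2"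
    using assms by (simp add: power2_sum)
  ultimately have 1: "(sqrt \<rho> - sqrt r)\<^sup>2 * r \<le> (\<rho> - r)\<^sup>2"
    by (simp add: mult_left_mono)
  have "(sqrt \<rho> - sqrt r)\<^sup>2 = r powr (- \<gamma>) * r powr (\<gamma> - 1) * ((sqrt \<rho> - sqrt r)\<^sup>2 * r)"
    using assms by (simp add: powr_diff powr_minus field_simps)
  also have "\<dots> \<le> r powr (- \<gamma>) * r powr (\<gamma> - 1) * (\<rho> - r)\<^sup>2"
    using 1 by (intro mult_left_mono) auto
  also have "\<dots> = 2 * r powr (- \<gamma>) * (r powr (\<gamma> - 1) / 2 * (\<rho> - r)\<^sup>2)" by simp
  also have "\<dots> \<le> 2 * r powr (- \<gamma>) * Epot_rel \<gamma> \<rho> r"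
    using Epot_rel_ge[OF assms] by (intro mult_left_mono) auto
  finally show ?thesis .
qed

section \<open>Differential calculus on the torus\<close>

lemma pd_eqI: "(f has_derivative D) (at x) \<Longrightarrow> pd i f x = D (axis i 1)"
  unfolding pd_def by (metis frechet_derivative_at)

lemma has_derivative_pd:
  "f differentiable (at x) \<Longrightarrow> \<exists>D. (f has_derivative D) (at x) \<and> (\<forall>i. pd i f x = D (axis i 1))"
  by (meson differentiable_def pd_eqI)

lemma has_derivative_shift_iff:
  fixes f :: "'a::real_normed_vector \<Rightarrow> 'b::real_normed_vector"
  shows "((\<lambda>x. f (x + a)) has_derivative D) (at x) \<longleftrightarrow> (f has_derivative D) (at (x + a))"
proof -
  have *: "((\<lambda>x. g (x + b)) has_derivative D) (at y)" if "(g has_derivative D) (at (y + b))"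
    for g :: "'a \<Rightarrow> 'b" and y b
  proof -
    have "((\<lambda>x. x + b) has_derivative (\<lambda>x. x)) (at y)"
      by (auto intro!: derivative_eq_intros)
    from has_derivative_compose[OF this that] show ?thesis .
  qed
  show ?thesis using *[of f x a] *[of "\<lambda>x. f (x + a)" "x + a" "- a"] by auto
qed

text \<open>\<open>frechet_derivative\<close> is a Hilbert choice; translation by a period leaves
  the predicate it chooses from unchanged, so the choices agree even at points of
  non-differentiability.\<close>

lemma periodic_pd:
  assumes "periodic f"
  shows "periodic (pd i f)"
proof -
  have "(\<lambda>y. f (y + axis j 1)) = f" for j
    using assms by (auto simp: periodic_def)
  then have "frechet_derivative f (at (x + axis j 1)) = frechet_derivative f (at x)" for x j
    unfolding frechet_derivative_def
    using has_derivative_shift_iff[of f "axis j 1" _ x] by simp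
  then show ?thesis by (simp add: periodic_def pd_def)
qed

lemma periodic_shift_int:
  fixes f :: "real^'d \<Rightarrow> 'a"
  assumes "periodic f"
  shows "f (x + of_int n *\<^sub>R axis i 1) = f x"
proof -
  have nat: "f (x + of_nat m *\<^sub>R axis i 1) = f x" for m x
  proof (induction m)
    case (Suc m)
    have "f (x + of_nat (Suc m) *\<^sub>R axis i 1) = f ((x + of_nat m *\<^sub>R axis i 1) + axis i 1)"
      by (simp add: algebra_simps)
    then show ?case using assms Suc by (simp add: periodic_def)
  qed simp
  show ?thesis
  proof (cases n)
    case (nonneg m)
    then show ?thesis using nat[of x m] by simp
  next
    case (neg m)
    then have *: "(x + of_int n *\<^sub>R axis i 1) + of_nat (Suc m) *\<^sub>R axis i 1 = x"
      by (simp add: add.assoc flip: scaleR_add_left)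
    show ?thesis using nat[of "x + of_int n *\<^sub>R axis i 1" "Suc m"] unfolding * by simp
  qed
qed

text \<open>The coordinates are reduced one at a time by integer shifts. Suprema over the whole
  space thereby become suprema over the compact unit cube.\<close>

lemma periodic_frac:
  fixes f :: "real^'d \<Rightarrow> 'a"
  assumes "periodic f"
  shows "f (\<chi> i. frac (x $ i)) = f x"
proof -
  have "f (\<chi> i. if i \<in> S then frac (x $ i) else x $ i) = f x" if "finite S" for S
    using that
  proof (induction S)
    case (insert j S)
    have *: "(\<chi> i. if i \<in> insert j S then frac (x $ i) else x $ i)
        = (\<chi> i. if i \<in> S then frac (x $ i) else x $ i) + of_int (- \<lfloor>x $ j\<rfloor>) *\<^sub>R axis j 1"
      using insert.hyps by (auto simp: vec_eq_iff axis_def frac_def)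
    show ?case unfolding * periodic_shift_int[OF assms] by (rule insert.IH)
  qed simp
  from this[of UNIV] show ?thesis by simp
qed

lemma periodic_bounded:
  fixes f :: "real \<Rightarrow> real^'d \<Rightarrow> 'a::real_normed_vector"
  assumes per: "\<And>t. t \<in> {0..T} \<Longrightarrow> periodic (f t)"
    and cont: "continuous_on ({0..T} \<times> UNIV) (\<lambda>(t, x). f t x)"
  shows "\<exists>B>0. \<forall>t\<in>{0..T}. \<forall>x. norm (f t x) \<le> B"
proof -
  let ?K = "{0..T} \<times> cbox 0 (1 :: real^'d)"
  have "compact ((\<lambda>(t, x). f t x) ` ?K)"
    by (intro compact_continuous_image continuous_on_subset[OF cont] compact_Times) auto
  then obtain B where B: "B > 0" "\<And>y. y \<in> (\<lambda>(t, x). f t x) ` ?K \<Longrightarrow> norm y \<le> B"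
    using compact_imp_bounded bounded_pos by metis
  show ?thesis
  proof (intro exI[of _ B] conjI ballI allI)
    show "B > 0" by fact
    fix t x assume t: "t \<in> {0..T}"
    have "(\<chi> i. frac (x $ i)) \<in> cbox 0 (1 :: real^'d)"
      by (auto simp: mem_box_cart less_imp_le frac_lt_1)
    with t have "f t (\<chi> i. frac (x $ i)) \<in> (\<lambda>(t, x). f t x) ` ?K" by force
    from B(2)[OF this] show "norm (f t x) \<le> B"
      using periodic_frac[OF per[OF t]] by simp
  qed
qed

lemma periodic_continuous_bounded:
  fixes f :: "real^'d \<Rightarrow> 'a::real_normed_vector"
  assumes "periodic f" "continuous_on UNIV f"
  shows "\<exists>B. \<forall>x. norm (f x) \<le> B"
proof -
  \<comment> \<open>A time-independent function is treated on the degenerate interval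
    \<open>{0..0}\<close>.\<close>
  have "continuous_on ({0..0::real} \<times> UNIV) (\<lambda>(t, x). f x)"
    unfolding case_prod_beta
    by (rule continuous_on_compose2[OF assms(2)]) (auto intro!: continuous_intros)
  from periodic_bounded[OF assms(1) this] show ?thesis by auto
qed

section \<open>Fields that are C1 in space and continuous in time\<close>

lemma continuous_on_section:
  assumes "continuous_on (A \<times> UNIV) (\<lambda>(t, x). f t x)" "t \<in> A"
  shows "continuous_on UNIV (f t)"
proof -
  have "continuous_on UNIV (\<lambda>x. (\<lambda>(t, x). f t x) (t, x))"
    by (rule continuous_on_compose2[OF assms(1)]) (use assms(2) in \<open>auto intro!: continuous_intros\<close>)
  then show ?thesis by simp
qed

text \<open>No time derivative is asked for: fields such as \<open>h\<close>, \<open>U\<close> and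
  \<open>\<phi>\<close> are differentiated in space and used as test functions at fixed times
  only.\<close>

definition space_C1 :: "real \<Rightarrow> (real \<Rightarrow> real^'d \<Rightarrow> 'a::real_normed_vector) \<Rightarrow> bool" where
  "space_C1 T f \<longleftrightarrow>
     (\<forall>t\<in>{0..T}. periodic (f t) \<and> f t differentiable_on UNIV) \<and>
     continuous_on ({0..T} \<times> UNIV) (\<lambda>(t, x). f t x) \<and>
     (\<forall>i. continuous_on ({0..T} \<times> UNIV) (\<lambda>(t, x). pd i (f t) x))"

lemma space_C1_differentiable:
  "space_C1 T f \<Longrightarrow> t \<in> {0..T} \<Longrightarrow> f t differentiable (at x)"
  by (auto simp: space_C1_def differentiable_on_def)

lemma space_C1_continuous: "space_C1 T f \<Longrightarrow> continuous_on ({0..T} \<times> UNIV) (\<lambda>(t, x). f t x)"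
  by (simp add: space_C1_def)

lemma space_C1_continuous_pd:
  "space_C1 T f \<Longrightarrow> continuous_on ({0..T} \<times> UNIV) (\<lambda>(t, x). pd i (f t) x)"
  by (simp add: space_C1_def)

lemma space_C1_C1_torus: "space_C1 T f \<Longrightarrow> t \<in> {0..T} \<Longrightarrow> C1_torus (f t)"
  unfolding space_C1_def C1_torus_def by (auto intro: continuous_on_section)

lemma space_C1_bounded:
  assumes "space_C1 T f"
  shows "\<exists>B>0. \<forall>t\<in>{0..T}. \<forall>x. norm (f t x) \<le> B"
  using periodic_bounded[of T f] assms unfolding space_C1_def by blast

lemma space_C1_bounded_pd:
  fixes f :: "real \<Rightarrow> real^'d \<Rightarrow> 'a::real_normed_vector"
  assumes "space_C1 T f"
  shows "\<exists>B>0. \<forall>t\<in>{0..T}. \<forall>x i. norm (pd i (f t) x) \<le> B"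
proof -
  have "\<forall>i. \<exists>B>0. \<forall>t\<in>{0..T}. \<forall>x. norm (pd i (f t) x) \<le> B"
  proof
    fix i
    show "\<exists>B>0. \<forall>t\<in>{0..T}. \<forall>x. norm (pd i (f t) x) \<le> B"
      using assms periodic_pd unfolding space_C1_def by (intro periodic_bounded) blast+
  qed
  then obtain B where B: "\<And>i. B i > 0" "\<And>i t x. t \<in> {0..T} \<Longrightarrow> norm (pd i (f t) x) \<le> B i"
    by metis
  show ?thesis
  proof (intro exI[of _ "\<Sum>i\<in>UNIV. B i"] conjI ballI allI)
    show "(\<Sum>i\<in>UNIV. B i) > 0" using B(1) by (intro sum_pos) auto
    fix t x i assume "t \<in> {0..T}"
    then have "norm (pd i (f t) x) \<le> B i" using B(2) by blast
    also have "\<dots> \<le> (\<Sum>i\<in>UNIV. B i)" using B(1) by (intro member_le_sum) (auto simp: less_imp_le)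
    finally show "norm (pd i (f t) x) \<le> (\<Sum>i\<in>UNIV. B i)" .
  qed
qed

lemma space_C1I:
  assumes "\<And>t. t \<in> {0..T} \<Longrightarrow> periodic (f t)"
    and "\<And>t x. t \<in> {0..T} \<Longrightarrow> \<exists>D. (f t has_derivative D) (at x) \<and> (\<forall>i. D (axis i 1) = g i t x)"
    and "continuous_on ({0..T} \<times> UNIV) (\<lambda>(t, x). f t x)"
    and "\<And>i. continuous_on ({0..T} \<times> UNIV) (\<lambda>(t, x). g i t x)"
  shows "space_C1 T f" and "\<And>i t x. t \<in> {0..T} \<Longrightarrow> pd i (f t) x = g i t x"
proof -
  show *: "pd i (f t) x = g i t x" if "t \<in> {0..T}" for i t x
    using assms(2)[OF that, of x] pd_eqI by metis
  show "space_C1 T f"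
    unfolding space_C1_def
  proof (intro conjI ballI allI)
    fix t assume "t \<in> {0..T}"
    then show "f t differentiable_on UNIV"
      using assms(2) unfolding differentiable_on_def differentiable_def by blast
  next
    fix i
    show "continuous_on ({0..T} \<times> UNIV) (\<lambda>(t, x). pd i (f t) x)"
      using assms(4)[of i] by (rule continuous_on_eq) (auto simp: *)
  qed (use assms in auto)
qed

text \<open>Meant for closed formulas that hold only on \<open>{0..T}\<close>, where the density is
  known to be positive.\<close>

lemma space_C1_cong:
  assumes "space_C1 T f" "\<And>t x. t \<in> {0..T} \<Longrightarrow> f t x = g t x"
  shows "space_C1 T g"
proof -
  have eq: "f t = g t" if "t \<in> {0..T}" for t using assms(2) that by auto
  have "continuous_on ({0..T} \<times> UNIV) (\<lambda>(t, x). g t x)"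
    using assms(1)[THEN space_C1_continuous] by (rule continuous_on_eq) (auto simp: assms(2))
  moreover have "continuous_on ({0..T} \<times> UNIV) (\<lambda>(t, x). pd i (g t) x)" for i
    using assms(1)[THEN space_C1_continuous_pd, of i] by (rule continuous_on_eq) (auto simp: eq)
  ultimately show ?thesis using assms(1) eq unfolding space_C1_def by metis
qed

lemma pd_bilinear:
  assumes "bounded_bilinear h" "f differentiable (at x)" "g differentiable (at x)"
  shows "pd i (\<lambda>x. h (f x) (g x)) x = h (f x) (pd i g x) + h (pd i f x) (g x)"
proof -
  obtain D where D: "(f has_derivative D) (at x)" "\<forall>i. pd i f x = D (axis i 1)"
    using has_derivative_pd[OF assms(2)] by blast
  obtain E where E: "(g has_derivative E) (at x)" "\<forall>i. pd i g x = E (axis i 1)"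
    using has_derivative_pd[OF assms(3)] by blast
  show ?thesis
    using pd_eqI[OF bounded_bilinear.FDERIV[OF assms(1) D(1) E(1)]] D(2) E(2) by simp
qed

lemmas pd_mult = pd_bilinear[OF bounded_bilinear_mult]

lemma pd_linear:
  assumes "bounded_linear h" "f differentiable (at x)"
  shows "pd i (\<lambda>x. h (f x)) x = h (pd i f x)"
proof -
  obtain D where D: "(f has_derivative D) (at x)" "\<forall>i. pd i f x = D (axis i 1)"
    using has_derivative_pd[OF assms(2)] by blast
  show ?thesis
    using pd_eqI[OF bounded_linear.has_derivative[OF assms(1) D(1)]] D(2) by simp
qed

lemma pd_diff:
  assumes "f differentiable (at x)" "g differentiable (at x)"
  shows "pd i (\<lambda>x. f x - g x) x = pd i f x - pd i g x"
proof -
  obtain D where D: "(f has_derivative D) (at x)" "\<forall>i. pd i f x = D (axis i 1)"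
    using has_derivative_pd[OF assms(1)] by blast
  obtain E where E: "(g has_derivative E) (at x)" "\<forall>i. pd i g x = E (axis i 1)"
    using has_derivative_pd[OF assms(2)] by blast
  show ?thesis
    using pd_eqI[OF has_derivative_diff[OF D(1) E(1)]] D(2) E(2) by simp
qed

lemma pd_compose:
  assumes "f differentiable (at x)" "(h has_real_derivative h') (at (f x))"
  shows "pd i (\<lambda>x. h (f x)) x = h' * pd i f x"
proof -
  obtain D where D: "(f has_derivative D) (at x)" "\<forall>i. pd i f x = D (axis i 1)"
    using has_derivative_pd[OF assms(1)] by blast
  have "((\<lambda>x. h (f x)) has_derivative (\<lambda>y. D y * h')) (at x)"
    using DERIV_compose_FDERIV[OF assms(2) D(1)] .
  from pd_eqI[OF this] show ?thesis using D(2) by simp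
qed

lemma space_C1_bilinear:
  assumes h: "bounded_bilinear h" and f: "space_C1 T f" and g: "space_C1 T g"
  shows "space_C1 T (\<lambda>t x. h (f t x) (g t x))"
proof (rule space_C1I(1)[where g = "\<lambda>i t x. h (f t x) (pd i (g t) x) + h (pd i (f t) x) (g t x)"])
  fix t x assume t: "t \<in> {0..T}"
  show "periodic (\<lambda>x. h (f t x) (g t x))"
    using f g t by (auto simp: space_C1_def periodic_def)
  obtain D where D: "(f t has_derivative D) (at x)" "\<forall>i. pd i (f t) x = D (axis i 1)"
    using has_derivative_pd[OF space_C1_differentiable[OF f t]] by blast
  obtain E where E: "(g t has_derivative E) (at x)" "\<forall>i. pd i (g t) x = E (axis i 1)"
    using has_derivative_pd[OF space_C1_differentiable[OF g t]] by blast
  show "\<exists>D. ((\<lambda>x. h (f t x) (g t x)) has_derivative D) (at x) \<and>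
      (\<forall>i. D (axis i 1) = h (f t x) (pd i (g t) x) + h (pd i (f t) x) (g t x))"
    using bounded_bilinear.FDERIV[OF h D(1) E(1)] D(2) E(2) by auto
next
  note c = space_C1_continuous[OF f] space_C1_continuous[OF g]
    space_C1_continuous_pd[OF f] space_C1_continuous_pd[OF g]
  note b = bounded_bilinear.continuous_on[OF h]
  show "continuous_on ({0..T} \<times> UNIV) (\<lambda>(t, x). h (f t x) (g t x))"
    using b[OF c(1,2)] by (simp add: case_prod_beta)
  show "continuous_on ({0..T} \<times> UNIV) (\<lambda>(t, x). h (f t x) (pd i (g t) x) + h (pd i (f t) x) (g t x))" for i
    using continuous_on_add[OF b[OF c(1) c(4)[of i]] b[OF c(3)[of i] c(2)]] by (simp add: case_prod_beta)
qed

lemmas space_C1_mult = space_C1_bilinear[OF bounded_bilinear_mult]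

lemma space_C1_linear:
  assumes h: "bounded_linear h" and f: "space_C1 T f"
  shows "space_C1 T (\<lambda>t x. h (f t x))"
proof (rule space_C1I(1)[where g = "\<lambda>i t x. h (pd i (f t) x)"])
  fix t x assume t: "t \<in> {0..T}"
  show "periodic (\<lambda>x. h (f t x))"
    using f t by (auto simp: space_C1_def periodic_def)
  obtain D where D: "(f t has_derivative D) (at x)" "\<forall>i. pd i (f t) x = D (axis i 1)"
    using has_derivative_pd[OF space_C1_differentiable[OF f t]] by blast
  show "\<exists>D. ((\<lambda>x. h (f t x)) has_derivative D) (at x) \<and> (\<forall>i. D (axis i 1) = h (pd i (f t) x))"
    using bounded_linear.has_derivative[OF h D(1)] D(2) by auto
next
  note b = bounded_linear.continuous_on[OF h]
  show "continuous_on ({0..T} \<times> UNIV) (\<lambda>(t, x). h (f t x))"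
    using b[OF space_C1_continuous[OF f]] by (simp add: case_prod_beta)
  show "continuous_on ({0..T} \<times> UNIV) (\<lambda>(t, x). h (pd i (f t) x))" for i
    using b[OF space_C1_continuous_pd[OF f, of i]] by (simp add: case_prod_beta)
qed

lemma space_C1_diff:
  assumes f: "space_C1 T f" and g: "space_C1 T g"
  shows "space_C1 T (\<lambda>t x. f t x - g t x)"
proof (rule space_C1I(1)[where g = "\<lambda>i t x. pd i (f t) x - pd i (g t) x"])
  fix t x assume t: "t \<in> {0..T}"
  show "periodic (\<lambda>x. f t x - g t x)"
    using f g t by (auto simp: space_C1_def periodic_def)
  obtain D where D: "(f t has_derivative D) (at x)" "\<forall>i. pd i (f t) x = D (axis i 1)"
    using has_derivative_pd[OF space_C1_differentiable[OF f t]] by blast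
  obtain E where E: "(g t has_derivative E) (at x)" "\<forall>i. pd i (g t) x = E (axis i 1)"
    using has_derivative_pd[OF space_C1_differentiable[OF g t]] by blast
  show "\<exists>D. ((\<lambda>x. f t x - g t x) has_derivative D) (at x) \<and>
      (\<forall>i. D (axis i 1) = pd i (f t) x - pd i (g t) x)"
    using has_derivative_diff[OF D(1) E(1)] D(2) E(2) by auto
next
  show "continuous_on ({0..T} \<times> UNIV) (\<lambda>(t, x). f t x - g t x)"
    using continuous_on_diff[OF space_C1_continuous[OF f] space_C1_continuous[OF g]]
    by (simp add: case_prod_beta)
  show "continuous_on ({0..T} \<times> UNIV) (\<lambda>(t, x). pd i (f t) x - pd i (g t) x)" for i
    using continuous_on_diff[OF space_C1_continuous_pd[OF f, of i] space_C1_continuous_pd[OF g, of i]]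
    by (simp add: case_prod_beta)
qed

lemma space_C1_compose:
  assumes f: "space_C1 T f" and pos: "\<And>t x. t \<in> {0..T} \<Longrightarrow> f t x > 0"
    and h: "\<And>y. y > 0 \<Longrightarrow> (h has_real_derivative h' y) (at y)"
    and h': "continuous_on {0<..} h'"
  shows "space_C1 T (\<lambda>t x. h (f t x))"
proof (rule space_C1I(1)[where g = "\<lambda>i t x. h' (f t x) * pd i (f t) x"])
  fix t x assume t: "t \<in> {0..T}"
  show "periodic (\<lambda>x. h (f t x))"
    using f t by (auto simp: space_C1_def periodic_def)
  obtain D where D: "(f t has_derivative D) (at x)" "\<forall>i. pd i (f t) x = D (axis i 1)"
    using has_derivative_pd[OF space_C1_differentiable[OF f t]] by blast
  have "((\<lambda>x. h (f t x)) has_derivative (\<lambda>y. D y * h' (f t x))) (at x)"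
    using DERIV_compose_FDERIV[OF h[OF pos[OF t]] D(1)] .
  then show "\<exists>D. ((\<lambda>x. h (f t x)) has_derivative D) (at x) \<and> (\<forall>i. D (axis i 1) = h' (f t x) * pd i (f t) x)"
    using D(2) by (auto intro!: exI[of _ "\<lambda>y. D y * h' (f t x)"])
next
  have *: "continuous_on ({0..T} \<times> UNIV) (\<lambda>p. k (case p of (t, x) \<Rightarrow> f t x))"
    if "continuous_on {0<..} k" for k :: "real \<Rightarrow> real"
    by (rule continuous_on_compose2[OF that space_C1_continuous[OF f]]) (auto simp: pos)
  have "continuous_on {0<..} h"
    using h by (intro DERIV_continuous_on) (auto intro: has_field_derivative_at_within)
  from *[OF this] show "continuous_on ({0..T} \<times> UNIV) (\<lambda>(t, x). h (f t x))"
    by (simp add: case_prod_beta)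
  show "continuous_on ({0..T} \<times> UNIV) (\<lambda>(t, x). h' (f t x) * pd i (f t) x)" for i
    using continuous_on_mult[OF *[OF h'] space_C1_continuous_pd[OF f, of i]] by (simp add: case_prod_beta)
qed

section \<open>Classical time derivatives on a closed interval\<close>

lemma C1_space_timeI:
  assumes T: "T > 0" and f: "space_C1 T f"
    and der: "\<And>t x. t \<in> {0..T} \<Longrightarrow> ((\<lambda>s. f s x) has_vector_derivative f' t x) (at t within {0..T})"
    and cont: "continuous_on ({0..T} \<times> UNIV) (\<lambda>(t, x). f' t x)"
  shows "C1_space_time T f" and "\<And>t x. t \<in> {0..T} \<Longrightarrow> tderiv T f t x = f' t x"
proof -
  show *: "tderiv T f t x = f' t x" if "t \<in> {0..T}" for t x
    unfolding tderiv_def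
    \<comment> \<open>Since T > 0, every point of \<open>{0..T}\<close> is a limit point of it, so
      the derivative is unique, also at the end points.\<close>
    by (rule vector_derivative_within[OF _ der[OF that]])
      (use T that in \<open>simp add: trivial_limit_within\<close>)
  have "(\<lambda>s. f s x) differentiable_on {0..T}" for x
    unfolding differentiable_on_def using der differentiableI_vector by blast
  moreover have "continuous_on ({0..T} \<times> UNIV) (\<lambda>(t, x). tderiv T f t x)"
    using cont by (rule continuous_on_eq) (auto simp: *)
  ultimately show "C1_space_time T f"
    using f unfolding space_C1_def C1_space_time_def by blast
qed

lemma C1_space_time_space_C1: "C1_space_time T f \<Longrightarrow> space_C1 T f"
  unfolding space_C1_def C1_space_time_def by blast

lemma C1_space_time_tderiv:
  assumes "C1_space_time T f" "t \<in> {0..T}"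
  shows "((\<lambda>s. f s x) has_vector_derivative tderiv T f t x) (at t within {0..T})"
proof -
  have "(\<lambda>s. f s x) differentiable (at t within {0..T})"
    using assms unfolding C1_space_time_def differentiable_on_def by blast
  then show ?thesis unfolding tderiv_def by (rule iffD1[OF vector_derivative_works])
qed

lemma C1_space_time_continuous_tderiv:
  "C1_space_time T f \<Longrightarrow> continuous_on ({0..T} \<times> UNIV) (\<lambda>(t, x). tderiv T f t x)"
  by (simp add: C1_space_time_def)

lemma periodic_tderiv:
  assumes "\<And>t. t \<in> {0..T} \<Longrightarrow> periodic (f t)" "t \<in> {0..T}"
  shows "periodic (tderiv T f t)"
  unfolding periodic_def
proof (intro allI)
  fix x i
  have *: "((\<lambda>s. f s (x + axis i 1)) has_vector_derivative y) (at t within {0..T}) \<longleftrightarrow>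
      ((\<lambda>s. f s x) has_vector_derivative y) (at t within {0..T})" for y
    using assms by (intro has_vector_derivative_cong_ev) (auto simp: periodic_def intro!: always_eventually)
  show "tderiv T f t (x + axis i 1) = tderiv T f t x"
    unfolding tderiv_def vector_derivative_def * ..
qed

section \<open>Pointwise control by the C1 and C2 norms\<close>

lemma bdd_above_norm_periodic:
  fixes f :: "real^'d \<Rightarrow> 'a::real_normed_vector"
  assumes "periodic f" "continuous_on UNIV f"
  shows "bdd_above (range (\<lambda>x. norm (f x)))"
proof -
  obtain B where "\<And>x. norm (f x) \<le> B" using periodic_continuous_bounded[OF assms] by auto
  then show ?thesis by (auto intro!: bdd_aboveI)
qed

lemma C1_torus_continuous: "C1_torus f \<Longrightarrow> continuous_on UNIV f"
  by (auto simp: C1_torus_def intro: differentiable_imp_continuous_on)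

lemma C1_torus_differentiable: "C1_torus f \<Longrightarrow> f differentiable (at x)"
  by (auto simp: C1_torus_def differentiable_on_def)

lemma C1_torus_pd: "C1_torus f \<Longrightarrow> periodic (pd i f)" "C1_torus f \<Longrightarrow> continuous_on UNIV (pd i f)"
  by (auto simp: C1_torus_def periodic_pd)

lemma C1_torus_bdd:
  assumes "C1_torus f"
  shows "bdd_above (range (\<lambda>x. norm (f x)))" "bdd_above (range (\<lambda>x. norm (pd i f x)))"
  using assms by (auto intro!: bdd_above_norm_periodic C1_torus_continuous C1_torus_pd simp: C1_torus_def periodic_pd)

lemma SUP_norm_nonneg:
  assumes "bdd_above (range (\<lambda>x. norm (f x)))"
  shows "0 \<le> (SUP x. norm (f x))"
  using cSUP_upper[OF UNIV_I assms, of undefined] norm_ge_zero order_trans by blast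

text \<open>A real-valued \<open>SUP\<close> dominates its family only when that family is bounded
  above; periodicity and continuity provide this.\<close>

lemma C1_norm_ge:
  assumes "C1_torus f"
  shows "norm (f x) \<le> C1_norm f" "norm (pd i f x) \<le> C1_norm f"
proof -
  note b = C1_torus_bdd[OF assms]
  have 1: "norm (f x) \<le> (SUP x. norm (f x))" by (rule cSUP_upper[OF UNIV_I b(1)])
  have 2: "norm (pd i f x) \<le> (SUP x. norm (pd i f x))" by (rule cSUP_upper[OF UNIV_I b(2)])
  have 3: "0 \<le> (SUP x. norm (pd i f x))" for i by (rule SUP_norm_nonneg[OF b(2)])
  have 4: "(SUP x. norm (pd i f x)) \<le> (\<Sum>i\<in>UNIV. SUP x. norm (pd i f x))"
    by (rule member_le_sum) (auto simp: 3)
  have 5: "0 \<le> (\<Sum>i\<in>UNIV. SUP x. norm (pd i f x))" by (intro sum_nonneg 3)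
  have 6: "0 \<le> (SUP x. norm (f x))" by (rule SUP_norm_nonneg[OF b(1)])
  show "norm (f x) \<le> C1_norm f" "norm (pd i f x) \<le> C1_norm f"
    unfolding C1_norm_def using 1 2 4 5 6 by linarith+
qed

lemma C2_norm_ge:
  assumes "C2_torus f"
  shows "norm (f x) \<le> C2_norm f" "norm (pd i f x) \<le> C2_norm f" "norm (pd j (pd i f) x) \<le> C2_norm f"
proof -
  have f: "C1_torus f" and pf: "C1_torus (pd i f)" for i
    using assms by (auto simp: C2_torus_def)
  have 3: "0 \<le> (SUP x. norm (pd j (pd i f) x))" for i j
    by (rule SUP_norm_nonneg[OF C1_torus_bdd(2)[OF pf]])
  have 5: "0 \<le> (\<Sum>j\<in>UNIV. SUP x. norm (pd j (pd i f) x))" for i by (intro sum_nonneg 3)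
  have "norm (pd j (pd i f) x) \<le> (SUP x. norm (pd j (pd i f) x))"
    by (rule cSUP_upper[OF UNIV_I C1_torus_bdd(2)[OF pf]])
  also have "\<dots> \<le> (\<Sum>j\<in>UNIV. SUP x. norm (pd j (pd i f) x))"
    by (rule member_le_sum) (auto simp: 3)
  also have "\<dots> \<le> (\<Sum>i\<in>UNIV. \<Sum>j\<in>UNIV. SUP x. norm (pd j (pd i f) x))"
    by (rule member_le_sum) (auto simp: 5)
  finally have "norm (pd j (pd i f) x) \<le> (\<Sum>i\<in>UNIV. \<Sum>j\<in>UNIV. SUP x. norm (pd j (pd i f) x))" .
  moreover have "0 \<le> (\<Sum>i\<in>UNIV. \<Sum>j\<in>UNIV. SUP x. norm (pd j (pd i f) x))"
    by (intro sum_nonneg 3)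
  moreover have "0 \<le> C1_norm f" using C1_norm_ge(1)[OF f] norm_ge_zero order_trans by blast
  ultimately show "norm (f x) \<le> C2_norm f" "norm (pd i f x) \<le> C2_norm f" "norm (pd j (pd i f) x) \<le> C2_norm f"
    unfolding C2_norm_def using C1_norm_ge(1)[OF f, where x = x] C1_norm_ge(2)[OF f, where i = i and x = x] by linarith+
qed

lemma pd_scaleR: "f differentiable (at x) \<Longrightarrow> pd i (\<lambda>x. c *\<^sub>R f x) x = c *\<^sub>R pd i f x"
  by (rule pd_linear[OF bounded_linear_scaleR_right])

lemma C1_torus_diff:
  assumes "C1_torus f" "C1_torus g"
  shows "C1_torus (\<lambda>x. f x - g x)" "pd i (\<lambda>x. f x - g x) = (\<lambda>x. pd i f x - pd i g x)"
proof -
  show *: "pd i (\<lambda>x. f x - g x) = (\<lambda>x. pd i f x - pd i g x)" for i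
    using assms by (auto intro!: pd_diff C1_torus_differentiable)
  show "C1_torus (\<lambda>x. f x - g x)"
    using assms unfolding C1_torus_def * by (auto intro!: continuous_intros derivative_intros simp: periodic_def)
qed

lemma C1_torus_scaleR:
  assumes "C1_torus f"
  shows "C1_torus (\<lambda>x. c *\<^sub>R f x)" "pd i (\<lambda>x. c *\<^sub>R f x) = (\<lambda>x. c *\<^sub>R pd i f x)"
proof -
  show *: "pd i (\<lambda>x. c *\<^sub>R f x) = (\<lambda>x. c *\<^sub>R pd i f x)" for i
    using assms by (auto intro!: pd_scaleR C1_torus_differentiable)
  have "(\<lambda>x. c *\<^sub>R f x) differentiable_on UNIV"
    using C1_torus_differentiable[OF assms] has_derivative_scaleR_right[where g = f]
    unfolding differentiable_on_def differentiable_def by blast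
  then show "C1_torus (\<lambda>x. c *\<^sub>R f x)"
    using assms unfolding C1_torus_def * by (auto intro!: continuous_intros simp: periodic_def)
qed

lemma C2_torus_diff: "C2_torus f \<Longrightarrow> C2_torus g \<Longrightarrow> C2_torus (\<lambda>x. f x - g x)"
  by (simp add: C2_torus_def C1_torus_diff)

lemma C2_torus_scaleR: "C2_torus f \<Longrightarrow> C2_torus (\<lambda>x. c *\<^sub>R f x)"
  by (simp add: C2_torus_def C1_torus_scaleR)

text \<open>The increment from (t, x) to (s, y) is split at (t, y): the time increment is small
  uniformly in space, and the space increment uses continuity of the single function
  \<open>g t\<close>.\<close>

lemma continuous_on_uniform_in_time:
  fixes g :: "real \<Rightarrow> 'a::real_normed_vector \<Rightarrow> 'b::real_normed_vector"
  assumes cont: "\<And>t. t \<in> S \<Longrightarrow> continuous_on UNIV (g t)"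
    and bound: "\<And>t s x. t \<in> S \<Longrightarrow> s \<in> S \<Longrightarrow> norm (g s x - g t x) \<le> b t s"
    and lim: "\<And>t. t \<in> S \<Longrightarrow> (b t \<longlongrightarrow> 0) (at t within S)"
  shows "continuous_on (S \<times> UNIV) (\<lambda>(t, x). g t x)"
  unfolding continuous_on_iff
proof (intro ballI allI impI)
  fix q :: "real \<times> 'a" and e :: real assume "q \<in> S \<times> UNIV" "e > 0"
  then obtain t x where q: "q = (t, x)" "t \<in> S" by auto
  obtain d1 where d1: "d1 > 0" "\<And>s. s \<in> S \<Longrightarrow> s \<noteq> t \<Longrightarrow> dist s t < d1 \<Longrightarrow> b t s < e / 2"
    using order_tendstoD(2)[OF lim[OF \<open>t \<in> S\<close>], of "e / 2"] \<open>e > 0\<close>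
    by (auto simp: eventually_at)
  obtain d2 where d2: "d2 > 0" "\<And>y. dist y x < d2 \<Longrightarrow> dist (g t y) (g t x) < e / 2"
    using cont[OF \<open>t \<in> S\<close>] \<open>e > 0\<close> unfolding continuous_on_iff by (metis UNIV_I half_gt_zero)
  show "\<exists>d>0. \<forall>p\<in>S \<times> UNIV. dist p q < d \<longrightarrow>
      dist (case p of (t, x) \<Rightarrow> g t x) (case q of (t, x) \<Rightarrow> g t x) < e"
  proof (intro exI[of _ "min d1 d2"] conjI ballI impI)
    show "min d1 d2 > 0" using d1 d2 by simp
    fix p assume p: "p \<in> S \<times> UNIV" "dist p q < min d1 d2"
    obtain s y where sy: "p = (s, y)" "s \<in> S" using p by auto
    have "dist s t < d1" "dist y x < d2"
      using p(2) sy q dist_fst_le[of p q] dist_snd_le[of p q] by auto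
    have "norm (g s y - g t y) < e / 2"
    proof (cases "s = t")
      case False
      then show ?thesis using bound[OF \<open>t \<in> S\<close> sy(2), of y] d1(2)[OF sy(2) _ \<open>dist s t < d1\<close>] by simp
    qed (use \<open>e > 0\<close> in simp)
    moreover have "dist (g t y) (g t x) < e / 2" using d2(2) \<open>dist y x < d2\<close> by blast
    ultimately have "dist (g s y) (g t x) < e"
      using dist_triangle[of "g s y" "g t x" "g t y"] by (simp add: dist_norm)
    then show "dist (case p of (t, x) \<Rightarrow> g t x) (case q of (t, x) \<Rightarrow> g t x) < e"
      by (simp add: sy q)
  qed
qed

text \<open>Instances: \<open>L\<close> is the identity or a partial derivative of order one or two.\<close>

lemma C1_C2_operator:
  fixes L :: "(real^'d \<Rightarrow> 'a::real_normed_vector) \<Rightarrow> real^'d \<Rightarrow> 'a"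
    and f f' :: "real \<Rightarrow> real^'d \<Rightarrow> 'a"
  assumes bound: "\<And>u x. C2_torus u \<Longrightarrow> norm (L u x) \<le> C2_norm u"
    and diff: "\<And>u v x. C2_torus u \<Longrightarrow> C2_torus v \<Longrightarrow> L (\<lambda>x. u x - v x) x = L u x - L v x"
    and scale: "\<And>u c x. C2_torus u \<Longrightarrow> L (\<lambda>x. c *\<^sub>R u x) x = c *\<^sub>R L u x"
    and cont: "\<And>u. C2_torus u \<Longrightarrow> continuous_on UNIV (L u)"
    and C2: "\<And>t. t \<in> {0..T} \<Longrightarrow> C2_torus (f t)" "\<And>t. t \<in> {0..T} \<Longrightarrow> C2_torus (f' t)"
    and der: "\<And>t. t \<in> {0..T} \<Longrightarrow>
      ((\<lambda>s. C2_norm (\<lambda>x. (f s x - f t x) /\<^sub>R (s - t) - f' t x)) \<longlongrightarrow> 0) (at t within {0..T})"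
    and der_cont: "\<And>t. t \<in> {0..T} \<Longrightarrow>
      ((\<lambda>s. C2_norm (\<lambda>x. f' s x - f' t x)) \<longlongrightarrow> 0) (at t within {0..T})"
  shows "continuous_on ({0..T} \<times> UNIV) (\<lambda>(t, x). L (f t) x)" (is ?cf)
    and "continuous_on ({0..T} \<times> UNIV) (\<lambda>(t, x). L (f' t) x)" (is ?cf')
    and "\<And>t x. t \<in> {0..T} \<Longrightarrow>
      ((\<lambda>s. L (f s) x) has_vector_derivative L (f' t) x) (at t within {0..T})"
proof -
  \<comment> \<open>Remainder of the difference quotient; its C2 norm tends to 0, and f(s) - f(t) =
    (s - t)(q + f'(t)) holds also after applying \<open>L\<close>.\<close>
  define q where "q t s = (\<lambda>x. (f s x - f t x) /\<^sub>R (s - t) - f' t x)" for t s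
  have q: "C2_torus (q t s)" "L (q t s) x = (L (f s) x - L (f t) x) /\<^sub>R (s - t) - L (f' t) x"
    if "t \<in> {0..T}" "s \<in> {0..T}" for t s x
    using C2[OF that(1)] C2[OF that(2)] unfolding q_def
    by (auto intro!: C2_torus_diff C2_torus_scaleR simp: diff scale C2_torus_diff C2_torus_scaleR)
  show ?cf
  proof (rule continuous_on_uniform_in_time)
    fix t assume t: "t \<in> {0..T}"
    show "continuous_on UNIV (L (f t))" using cont C2 t by blast
    have "((\<lambda>s. \<bar>s - t\<bar>) \<longlongrightarrow> 0) (at t within {0..T})"
      by (auto intro!: tendsto_eq_intros)
    from tendsto_mult[OF this tendsto_add[OF der[OF t] tendsto_const[of "C2_norm (f' t)"]]]
    show "((\<lambda>s. \<bar>s - t\<bar> * (C2_norm (q t s) + C2_norm (f' t))) \<longlongrightarrow> 0) (at t within {0..T})"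
      by (simp add: q_def)
    fix s x assume s: "s \<in> {0..T}"
    show "norm (L (f s) x - L (f t) x) \<le> \<bar>s - t\<bar> * (C2_norm (q t s) + C2_norm (f' t))"
    proof (cases "s = t")
      case False
      then have "L (f s) x - L (f t) x = (s - t) *\<^sub>R (L (q t s) x + L (f' t) x)"
        using q(2)[OF t s, of x] by simp
      then have "norm (L (f s) x - L (f t) x) = \<bar>s - t\<bar> * norm (L (q t s) x + L (f' t) x)"
        by simp
      also have "\<dots> \<le> \<bar>s - t\<bar> * (C2_norm (q t s) + C2_norm (f' t))"
        by (intro mult_left_mono norm_triangle_mono bound q C2 t s) auto
      finally show ?thesis .
    qed simp
  qed
  show ?cf'
  proof (rule continuous_on_uniform_in_time)
    fix t assume t: "t \<in> {0..T}"
    show "continuous_on UNIV (L (f' t))" using cont C2 t by blast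
    show "((\<lambda>s. C2_norm (\<lambda>x. f' s x - f' t x)) \<longlongrightarrow> 0) (at t within {0..T})"
      by (rule der_cont[OF t])
    fix s x assume s: "s \<in> {0..T}"
    show "norm (L (f' s) x - L (f' t) x) \<le> C2_norm (\<lambda>x. f' s x - f' t x)"
      using bound[of "\<lambda>x. f' s x - f' t x" x] C2 s t by (simp add: diff C2_torus_diff)
  qed
  fix t x assume t: "t \<in> {0..T}"
  show "((\<lambda>s. L (f s) x) has_vector_derivative L (f' t) x) (at t within {0..T})"
    unfolding has_vector_derivative_def has_derivative_within
  proof (intro conjI bounded_linear_scaleR_left)
    \<comment> \<open>After division by |s - t| the first-order Taylor remainder of
      \<open>L (f s) x\<close> is, up to sign, \<open>L (q t s) x\<close>.\<close>
    have "\<forall>\<^sub>F s in at t within {0..T}.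
        norm ((1 / norm (s - t)) *\<^sub>R (L (f s) x - (L (f t) x + (s - t) *\<^sub>R L (f' t) x))) \<le> C2_norm (q t s)"
      unfolding eventually_at_topological
    proof (intro exI[of _ UNIV] conjI ballI impI)
      fix s assume s: "s \<noteq> t" "s \<in> {0..T}"
      have "L (f s) x - (L (f t) x + (s - t) *\<^sub>R L (f' t) x) = (s - t) *\<^sub>R L (q t s) x"
        using q(2)[OF t s(2), of x] s(1) by (simp add: scaleR_diff_right)
      then have "norm ((1 / norm (s - t)) *\<^sub>R (L (f s) x - (L (f t) x + (s - t) *\<^sub>R L (f' t) x)))
          = norm (L (q t s) x)"
        using s(1) by simp
      then show "norm ((1 / norm (s - t)) *\<^sub>R (L (f s) x - (L (f t) x + (s - t) *\<^sub>R L (f' t) x)))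
          \<le> C2_norm (q t s)"
        using bound[OF q(1)[OF t s(2)]] by simp
    qed auto
    then show "((\<lambda>s. (1 / norm (s - t)) *\<^sub>R (L (f s) x - (L (f t) x + (s - t) *\<^sub>R L (f' t) x))) \<longlongrightarrow> 0)
        (at t within {0..T})"
      using der[OF t] unfolding q_def by (rule Lim_null_comparison)
  qed
qed

text \<open>Converts Banach-space valued differentiability into joint continuity of classical
  derivatives, the form in which the later calculus uses the regularity assumptions.\<close>

lemma C1_C2_regularity:
  fixes f :: "real \<Rightarrow> real^'d \<Rightarrow> 'a::real_normed_vector"
  assumes "C1_C2 T f" "T > 0"
  shows "C1_space_time T f" "space_C1 T (\<lambda>t. pd i (f t))"
proof -
  obtain f' where C2: "\<And>t. t \<in> {0..T} \<Longrightarrow> C2_torus (f t)" "\<And>t. t \<in> {0..T} \<Longrightarrow> C2_torus (f' t)"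
    and der: "\<And>t. t \<in> {0..T} \<Longrightarrow>
      ((\<lambda>s. C2_norm (\<lambda>x. (f s x - f t x) /\<^sub>R (s - t) - f' t x)) \<longlongrightarrow> 0) (at t within {0..T})"
    and der_cont: "\<And>t. t \<in> {0..T} \<Longrightarrow>
      ((\<lambda>s. C2_norm (\<lambda>x. f' s x - f' t x)) \<longlongrightarrow> 0) (at t within {0..T})"
    using assms(1) unfolding C1_C2_def by blast
  note op = C1_C2_operator[OF _ _ _ _ C2 der der_cont]
  have c0: "continuous_on ({0..T} \<times> UNIV) (\<lambda>(t, x). f t x)"
    and c0': "continuous_on ({0..T} \<times> UNIV) (\<lambda>(t, x). f' t x)"
    and d0: "\<And>t x. t \<in> {0..T} \<Longrightarrow> ((\<lambda>s. f s x) has_vector_derivative f' t x) (at t within {0..T})"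
    using op[of "\<lambda>u. u"] C2_norm_ge(1) by (auto simp: C2_torus_def C1_torus_continuous)
  have c1: "continuous_on ({0..T} \<times> UNIV) (\<lambda>(t, x). pd i (f t) x)" for i
    by (rule op(1)[of "pd i"]) (auto simp: C2_norm_ge C1_torus_diff C1_torus_scaleR C2_torus_def C1_torus_pd)
  have c2: "continuous_on ({0..T} \<times> UNIV) (\<lambda>(t, x). pd j (pd i (f t)) x)" for i j
    by (rule op(1)[of "\<lambda>u. pd j (pd i u)"])
      (auto simp: C2_norm_ge C1_torus_diff C1_torus_scaleR C2_torus_def C1_torus_pd)
  have s: "space_C1 T f"
    using C2 c0 c1 unfolding space_C1_def C2_torus_def C1_torus_def by blast
  from C1_space_timeI(1)[OF assms(2) s d0 c0'] show "C1_space_time T f" .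
  show "space_C1 T (\<lambda>t. pd i (f t))"
    using C2 c1 c2 unfolding space_C1_def C2_torus_def C1_torus_def by blast
qed

section \<open>Product, linear and chain rules for space-time test functions\<close>

lemma C1_space_time_bilinear:
  assumes T: "T > 0" and h: "bounded_bilinear h" and f: "C1_space_time T f" and g: "C1_space_time T g"
  shows "C1_space_time T (\<lambda>t x. h (f t x) (g t x))"
    and "t \<in> {0..T} \<Longrightarrow> tderiv T (\<lambda>t x. h (f t x) (g t x)) t x
      = h (f t x) (tderiv T g t x) + h (tderiv T f t x) (g t x)"
proof -
  note sf = C1_space_time_space_C1[OF f] and sg = C1_space_time_space_C1[OF g]
  have d: "((\<lambda>s. h (f s x) (g s x)) has_vector_derivative
      h (f t x) (tderiv T g t x) + h (tderiv T f t x) (g t x)) (at t within {0..T})" if "t \<in> {0..T}" for t x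
    by (rule bounded_bilinear.has_vector_derivative[OF h]) (use f g that in \<open>auto intro: C1_space_time_tderiv\<close>)
  have c: "continuous_on ({0..T} \<times> UNIV) (\<lambda>(t, x). h (f t x) (tderiv T g t x) + h (tderiv T f t x) (g t x))"
    using continuous_on_add[OF
        bounded_bilinear.continuous_on[OF h space_C1_continuous[OF sf] C1_space_time_continuous_tderiv[OF g]]
        bounded_bilinear.continuous_on[OF h C1_space_time_continuous_tderiv[OF f] space_C1_continuous[OF sg]]]
    by (simp add: case_prod_unfold)
  from C1_space_timeI[OF T space_C1_bilinear[OF h sf sg] d c]
  show "C1_space_time T (\<lambda>t x. h (f t x) (g t x))"
    "t \<in> {0..T} \<Longrightarrow> tderiv T (\<lambda>t x. h (f t x) (g t x)) t x
      = h (f t x) (tderiv T g t x) + h (tderiv T f t x) (g t x)" by auto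
qed

lemma C1_space_time_linear:
  assumes T: "T > 0" and h: "bounded_linear h" and f: "C1_space_time T f"
  shows "C1_space_time T (\<lambda>t x. h (f t x))"
    and "t \<in> {0..T} \<Longrightarrow> tderiv T (\<lambda>t x. h (f t x)) t x = h (tderiv T f t x)"
proof -
  note sf = C1_space_time_space_C1[OF f]
  have d: "((\<lambda>s. h (f s x)) has_vector_derivative h (tderiv T f t x)) (at t within {0..T})"
    if "t \<in> {0..T}" for t x
    using bounded_linear.has_vector_derivative[OF h C1_space_time_tderiv[OF f that]] .
  have c: "continuous_on ({0..T} \<times> UNIV) (\<lambda>(t, x). h (tderiv T f t x))"
    using bounded_linear.continuous_on[OF h C1_space_time_continuous_tderiv[OF f]]
    by (simp add: case_prod_unfold)
  from C1_space_timeI[OF T space_C1_linear[OF h sf] d c]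
  show "C1_space_time T (\<lambda>t x. h (f t x))"
    "t \<in> {0..T} \<Longrightarrow> tderiv T (\<lambda>t x. h (f t x)) t x = h (tderiv T f t x)" by auto
qed

lemma C1_space_time_diff:
  assumes T: "T > 0" and f: "C1_space_time T f" and g: "C1_space_time T g"
  shows "C1_space_time T (\<lambda>t x. f t x - g t x)"
    and "t \<in> {0..T} \<Longrightarrow> tderiv T (\<lambda>t x. f t x - g t x) t x = tderiv T f t x - tderiv T g t x"
proof -
  note sf = C1_space_time_space_C1[OF f] and sg = C1_space_time_space_C1[OF g]
  have d: "((\<lambda>s. f s x - g s x) has_vector_derivative tderiv T f t x - tderiv T g t x) (at t within {0..T})"
    if "t \<in> {0..T}" for t x
    by (intro has_vector_derivative_diff C1_space_time_tderiv f g that)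
  have c: "continuous_on ({0..T} \<times> UNIV) (\<lambda>(t, x). tderiv T f t x - tderiv T g t x)"
    using continuous_on_diff[OF C1_space_time_continuous_tderiv[OF f] C1_space_time_continuous_tderiv[OF g]]
    by (simp add: case_prod_unfold)
  from C1_space_timeI[OF T space_C1_diff[OF sf sg] d c]
  show "C1_space_time T (\<lambda>t x. f t x - g t x)"
    "t \<in> {0..T} \<Longrightarrow> tderiv T (\<lambda>t x. f t x - g t x) t x = tderiv T f t x - tderiv T g t x" by auto
qed

lemma C1_space_time_compose:
  assumes T: "T > 0" and f: "C1_space_time T f" and pos: "\<And>t x. t \<in> {0..T} \<Longrightarrow> f t x > 0"
    and h: "\<And>y. y > 0 \<Longrightarrow> (h has_real_derivative h' y) (at y)"
    and h': "continuous_on {0<..} h'"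
  shows "C1_space_time T (\<lambda>t x. h (f t x))"
    and "t \<in> {0..T} \<Longrightarrow> tderiv T (\<lambda>t x. h (f t x)) t x = h' (f t x) * tderiv T f t x"
proof -
  note sf = C1_space_time_space_C1[OF f]
  have d: "((\<lambda>s. h (f s x)) has_vector_derivative h' (f t x) * tderiv T f t x) (at t within {0..T})"
    if "t \<in> {0..T}" for t x
    using DERIV_chain2[where f = h and g = "\<lambda>s. f s x" and x = t, OF h[OF pos[OF that]]] C1_space_time_tderiv[OF f that, of x]
    by (simp add: has_real_derivative_iff_has_vector_derivative[symmetric])
  have c: "continuous_on ({0..T} \<times> UNIV) (\<lambda>(t, x). h' (f t x) * tderiv T f t x)"
  proof -
    have "continuous_on ({0..T} \<times> UNIV) (\<lambda>p. h' (case p of (t, x) \<Rightarrow> f t x))"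
      by (rule continuous_on_compose2[OF h' space_C1_continuous[OF sf]]) (auto simp: pos)
    from continuous_on_mult[OF this C1_space_time_continuous_tderiv[OF f]]
    show ?thesis by (simp add: case_prod_unfold)
  qed
  from C1_space_timeI[OF T space_C1_compose[OF sf pos h h'] d c]
  show "C1_space_time T (\<lambda>t x. h (f t x))"
    "t \<in> {0..T} \<Longrightarrow> tderiv T (\<lambda>t x. h (f t x)) t x = h' (f t x) * tderiv T f t x" by auto
qed

section \<open>Lebesgue integration over the torus and space-time\<close>

lemma AE_lebesgue_on_pair:
  fixes A :: "'a::euclidean_space set" and B :: "'b::euclidean_space set"
  assumes "AE p in lebesgue_on (A \<times> B). P p" "A \<in> sets borel" "B \<in> sets borel"
  shows "AE t in lebesgue_on A. AE x in lebesgue_on B. P (t, x)"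
proof -
  have "AE p in lborel. p \<in> A \<times> B \<longrightarrow> P p"
    using assms by (simp add: AE_restrict_space_iff AE_completion_iff borel_Times)
  then have "AE p in lborel \<Otimes>\<^sub>M lborel. p \<in> A \<times> B \<longrightarrow> P p" unfolding lborel_prod .
  from lborel_pair.AE_pair[OF this]
  have "AE t in lborel. t \<in> A \<longrightarrow> (AE x in lborel. x \<in> B \<longrightarrow> P (t, x))"
    by eventually_elim auto
  then show ?thesis using assms by (simp add: AE_restrict_space_iff AE_completion_iff)
qed

text \<open>The completed measure on a product is not the product of the completed measures. A Borel
  representative \<open>g\<close> of \<open>h\<close> reduces everything to \<open>lborel\<close>;
  almost every section of the exceptional null set is again null.\<close>

lemma lebesgue_Fubini:
  fixes h :: "'a::euclidean_space \<times> 'b::euclidean_space \<Rightarrow> real"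
  assumes "integrable lebesgue h"
  shows "AE t in lebesgue. integrable lebesgue (\<lambda>x. h (t, x))"
    and "integrable lebesgue (\<lambda>t. \<integral>x. h (t, x) \<partial>lebesgue)"
    and "(\<integral>t. (\<integral>x. h (t, x) \<partial>lebesgue) \<partial>lebesgue) = (\<integral>p. h p \<partial>lebesgue)"
proof -
  obtain g where g: "g \<in> borel_measurable lborel" "AE p in lborel. h p = g p"
    using completion_ex_borel_measurable_real[of h lborel] assms by auto
  have "integrable lebesgue g"
    using assms g by (subst integrable_cong_AE[of g _ h]) (auto simp: AE_completion_iff measurable_completion)
  then have "integrable lborel g" using g by (simp add: integrable_completion)
  then have gi: "integrable (lborel \<Otimes>\<^sub>M lborel) g" by (simp add: lborel_prod)
  have "AE p in lborel \<Otimes>\<^sub>M lborel. h p = g p" using g(2) unfolding lborel_prod .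
  from lborel_pair.AE_pair[OF this] have ae: "AE t in lborel. AE x in lborel. h (t, x) = g (t, x)" .
  have ae2: "AE t in lborel. integrable lborel (\<lambda>x. g (t, x))"
    using lborel_pair.AE_integrable_fst'[OF gi] .
  have *: "AE t in lborel. integrable lebesgue (\<lambda>x. h (t, x)) \<and>
      (\<integral>x. h (t, x) \<partial>lebesgue) = (\<integral>x. g (t, x) \<partial>lborel)"
    using ae ae2
  proof eventually_elim
    case (elim t)
    have gm: "(\<lambda>x. g (t, x)) \<in> borel_measurable lborel" using elim(2) by (rule borel_measurable_integrable)
    then have gl: "(\<lambda>x. g (t, x)) \<in> borel_measurable lebesgue" by (rule measurable_completion)
    have hl: "(\<lambda>x. h (t, x)) \<in> borel_measurable lebesgue"
      by (rule borel_measurable_AE[OF gl]) (use elim in \<open>auto simp: AE_completion_iff\<close>)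
    have ae': "AE x in lebesgue. h (t, x) = g (t, x)" using elim by (simp add: AE_completion_iff)
    have "integrable lebesgue (\<lambda>x. h (t, x)) = integrable lebesgue (\<lambda>x. g (t, x))"
      by (rule integrable_cong_AE[OF hl gl ae'])
    moreover have "(\<integral>x. h (t, x) \<partial>lebesgue) = (\<integral>x. g (t, x) \<partial>lebesgue)"
      by (rule integral_cong_AE[OF hl gl ae'])
    ultimately show ?case using elim gm by (simp add: integrable_completion integral_completion)
  qed
  then show "AE t in lebesgue. integrable lebesgue (\<lambda>x. h (t, x))"
    by (auto simp: AE_completion_iff)
  have i1: "integrable lborel (\<lambda>t. \<integral>x. g (t, x) \<partial>lborel)"
    using lborel_pair.integrable_fst'[OF gi] .
  then have m1: "(\<lambda>t. \<integral>x. g (t, x) \<partial>lborel) \<in> borel_measurable lborel"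
    by (rule borel_measurable_integrable)
  then have m1': "(\<lambda>t. \<integral>x. g (t, x) \<partial>lborel) \<in> borel_measurable lebesgue"
    by (rule measurable_completion)
  have ae3: "AE t in lebesgue. (\<integral>x. h (t, x) \<partial>lebesgue) = (\<integral>x. g (t, x) \<partial>lborel)"
    using * by (auto simp: AE_completion_iff)
  have m2: "(\<lambda>t. \<integral>x. h (t, x) \<partial>lebesgue) \<in> borel_measurable lebesgue"
    by (rule borel_measurable_AE[OF m1']) (use ae3 in auto)
  show "integrable lebesgue (\<lambda>t. \<integral>x. h (t, x) \<partial>lebesgue)"
    using integrable_cong_AE[OF m2 m1' ae3] i1 m1 by (simp add: integrable_completion)
  have "(\<integral>t. (\<integral>x. h (t, x) \<partial>lebesgue) \<partial>lebesgue) = (\<integral>t. (\<integral>x. g (t, x) \<partial>lborel) \<partial>lebesgue)"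
    by (rule integral_cong_AE[OF m2 m1' ae3])
  also have "\<dots> = (\<integral>t. (\<integral>x. g (t, x) \<partial>lborel) \<partial>lborel)" using m1 by (simp add: integral_completion)
  also have "\<dots> = (\<integral>p. g p \<partial>(lborel \<Otimes>\<^sub>M lborel))" by (rule lborel_pair.integral_fst'[OF gi])
  also have "\<dots> = (\<integral>p. g p \<partial>lebesgue)" using g(1) by (simp add: lborel_prod integral_completion)
  also have "\<dots> = (\<integral>p. h p \<partial>lebesgue)"
    using g assms by (intro integral_cong_AE) (auto simp: AE_completion_iff measurable_completion)
  finally show "(\<integral>t. (\<integral>x. h (t, x) \<partial>lebesgue) \<partial>lebesgue) = (\<integral>p. h p \<partial>lebesgue)" .
qed

text \<open>Yields joint integrability from bounds at almost every fixed time, which is how the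
  energy density becomes integrable over space-time.\<close>

lemma lebesgue_Tonelli:
  fixes h :: "'a::euclidean_space \<times> 'b::euclidean_space \<Rightarrow> real"
  assumes meas: "h \<in> borel_measurable lebesgue" and nonneg: "AE p in lebesgue. 0 \<le> h p"
    and inner: "AE t in lebesgue. integrable lebesgue (\<lambda>x. h (t, x)) \<and> (\<integral>x. h (t, x) \<partial>lebesgue) \<le> k t"
    and k: "integrable lebesgue k"
  shows "integrable lebesgue h"
proof -
  obtain g where g: "g \<in> borel_measurable lborel" "AE p in lborel. h p = g p"
    using completion_ex_borel_measurable_real[OF meas] by auto
  have aeg: "AE p in lborel. h p = g p \<and> 0 \<le> h p"
    using g(2) nonneg by (auto simp: AE_completion_iff)
  then have "AE p in lborel \<Otimes>\<^sub>M lborel. h p = g p \<and> 0 \<le> h p" unfolding lborel_prod .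
  from lborel_pair.AE_pair[OF this] have ae: "AE t in lborel. AE x in lborel. h (t, x) = g (t, x) \<and> 0 \<le> h (t, x)" .
  have "(\<integral>\<^sup>+p. ennreal (norm (h p)) \<partial>lebesgue) = (\<integral>\<^sup>+p. ennreal (g p) \<partial>lebesgue)"
    using aeg by (intro nn_integral_cong_AE) (auto simp: AE_completion_iff)
  also have "\<dots> = (\<integral>\<^sup>+p. ennreal (g p) \<partial>(lborel \<Otimes>\<^sub>M lborel))"
    using g(1) by (simp add: nn_integral_completion lborel_prod)
  also have "\<dots> = (\<integral>\<^sup>+t. (\<integral>\<^sup>+x. ennreal (g (t, x)) \<partial>lborel) \<partial>lborel)"
    using g(1) by (subst lborel.nn_integral_fst[symmetric]) (auto simp: lborel_prod)
  also have "\<dots> \<le> (\<integral>\<^sup>+t. ennreal \<bar>k t\<bar> \<partial>lborel)"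
  proof (rule nn_integral_mono_AE)
    show "AE t in lborel. (\<integral>\<^sup>+x. ennreal (g (t, x)) \<partial>lborel) \<le> ennreal \<bar>k t\<bar>"
      using ae inner[unfolded AE_completion_iff]
    proof eventually_elim
      case (elim t)
      have "(\<integral>\<^sup>+x. ennreal (g (t, x)) \<partial>lborel) = (\<integral>\<^sup>+x. ennreal (h (t, x)) \<partial>lborel)"
        using elim by (intro nn_integral_cong_AE) auto
      also have "\<dots> = (\<integral>\<^sup>+x. ennreal (h (t, x)) \<partial>lebesgue)" by (simp add: nn_integral_completion)
      also have "\<dots> = ennreal (\<integral>x. h (t, x) \<partial>lebesgue)"
        using elim by (intro nn_integral_eq_integral) (auto simp: AE_completion_iff)
      also have "\<dots> \<le> ennreal \<bar>k t\<bar>" using elim by (intro ennreal_leI) auto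
      finally show ?case .
    qed
  qed
  also have "\<dots> = (\<integral>\<^sup>+t. ennreal (norm (k t)) \<partial>lebesgue)" by (simp add: nn_integral_completion)
  also have "\<dots> < \<infinity>" using k by (simp add: integrable_iff_bounded)
  finally show ?thesis using meas by (simp add: integrable_iff_bounded)
qed

lemma set_lebesgue_Fubini:
  fixes f :: "'a::euclidean_space \<times> 'b::euclidean_space \<Rightarrow> real"
  assumes "set_integrable lebesgue (A \<times> B) f" "A \<in> sets borel"
  shows "AE t in lebesgue_on A. set_integrable lebesgue B (\<lambda>x. f (t, x))"
    and "set_integrable lebesgue A (\<lambda>t. LINT x:B|lebesgue. f (t, x))"
    and "(LINT t:A|lebesgue. LINT x:B|lebesgue. f (t, x)) = (LINT p:A \<times> B|lebesgue. f p)"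
proof -
  let ?h = "\<lambda>p. indicator (A \<times> B) p *\<^sub>R f p"
  have h: "integrable lebesgue ?h" using assms by (simp add: set_integrable_def)
  have eq: "(\<integral>x. ?h (t, x) \<partial>lebesgue) = indicator A t *\<^sub>R (LINT x:B|lebesgue. f (t, x))" for t
    by (cases "t \<in> A") (simp_all add: set_lebesgue_integral_def indicator_def if_distrib)
  have "AE t in lebesgue. t \<in> A \<longrightarrow> set_integrable lebesgue B (\<lambda>x. f (t, x))"
    using lebesgue_Fubini(1)[OF h]
  proof eventually_elim
    case (elim t)
    show ?case
    proof
      assume "t \<in> A"
      then show "set_integrable lebesgue B (\<lambda>x. f (t, x))"
        using elim by (simp add: set_integrable_def indicator_def if_distrib)
    qed
  qed
  then show "AE t in lebesgue_on A. set_integrable lebesgue B (\<lambda>x. f (t, x))"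
    using assms(2) by (simp add: AE_restrict_space_iff)
  show "set_integrable lebesgue A (\<lambda>t. LINT x:B|lebesgue. f (t, x))"
    using lebesgue_Fubini(2)[OF h] unfolding eq by (simp add: set_integrable_def)
  show "(LINT t:A|lebesgue. LINT x:B|lebesgue. f (t, x)) = (LINT p:A \<times> B|lebesgue. f p)"
    using lebesgue_Fubini(3)[OF h] unfolding eq by (simp add: set_lebesgue_integral_def)
qed

section \<open>Integration of periodic functions over the unit cell\<close>

lemma torus_borel[measurable]: "torus \<in> sets borel"
proof -
  have "torus = (\<Inter>i. {x :: real^'d. 0 \<le> x $ i} \<inter> {x. x $ i < 1})"
    by (auto simp: torus_def)
  also have "\<dots> \<in> sets borel"
    by (intro sets.countable_INT'' sets.Int borel_closed borel_open closed_Collect_le open_Collect_less continuous_intros) auto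
  finally show ?thesis .
qed

lemma torus_bounded: "bounded (torus :: (real^'d) set)"
  by (rule bounded_subset[of "cbox 0 1"]) (auto simp: torus_def mem_box_cart less_imp_le)

lemma set_integrable_bounded:
  fixes f :: "'a::euclidean_space \<Rightarrow> real"
  assumes "S \<in> sets borel" "bounded S" "set_borel_measurable lebesgue S f" "AE p in lebesgue_on S. \<bar>f p\<bar> \<le> B"
  shows "set_integrable lebesgue S f"
  unfolding set_integrable_def
proof (rule Bochner_Integration.integrable_bound)
  show "integrable lebesgue (\<lambda>p. B * indicator S p)"
    using assms(1,2) emeasure_bounded_finite[of S] by simp
  show "(\<lambda>p. indicator S p *\<^sub>R f p) \<in> borel_measurable lebesgue"
    using assms(3) by (simp add: set_borel_measurable_def)
  have "AE p in lebesgue. p \<in> S \<longrightarrow> \<bar>f p\<bar> \<le> B"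
    using assms(1,4) by (simp add: AE_restrict_space_iff)
  then show "AE p in lebesgue. norm (indicator S p *\<^sub>R f p) \<le> norm (B * indicator S p)"
    by eventually_elim (auto simp: indicator_def)
qed

lemma set_borel_measurable_continuous_subset:
  fixes f :: "'a::euclidean_space \<Rightarrow> 'b::real_normed_vector"
  assumes "continuous_on X f" "S \<subseteq> X" "S \<in> sets borel"
  shows "set_borel_measurable lebesgue S f"
  unfolding set_borel_measurable_def
  using borel_measurable_continuous_on_indicator[OF assms(3) continuous_on_subset[OF assms(1,2)]]
  by (simp add: measurable_completion)

lemma space_time_box_borel: "{0<..<\<tau>::real} \<times> torus \<in> sets borel"
  by (intro borel_Times) auto

lemma space_time_box_bounded: "bounded ({0<..<\<tau>::real} \<times> (torus :: (real^'d) set))"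
  by (intro bounded_Times torus_bounded) auto

lemma set_integrable_space_time_continuous:
  fixes f :: "real \<Rightarrow> real^'d \<Rightarrow> real"
  assumes "continuous_on ({0..T} \<times> UNIV) (\<lambda>(t, x). f t x)" "\<And>t. t \<in> {0..T} \<Longrightarrow> periodic (f t)" "\<tau> \<le> T"
  shows "set_integrable lebesgue ({0<..<\<tau>} \<times> torus) (\<lambda>(t, x). f t x)"
proof -
  obtain B where B: "\<And>t x. t \<in> {0..T} \<Longrightarrow> norm (f t x) \<le> B"
    using periodic_bounded[OF assms(2,1)] by blast
  show ?thesis
  proof (rule set_integrable_bounded[OF space_time_box_borel space_time_box_bounded])
    show "set_borel_measurable lebesgue ({0<..<\<tau>} \<times> torus) (\<lambda>(t, x). f t x)"
      by (rule set_borel_measurable_continuous_subset[OF assms(1) _ space_time_box_borel])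
        (use assms(3) in auto)
    show "AE p in lebesgue_on ({0<..<\<tau>} \<times> torus). \<bar>case p of (t, x) \<Rightarrow> f t x\<bar> \<le> B"
    proof (rule AE_I2)
      fix p :: "real \<times> (real^'d)" assume "p \<in> space (lebesgue_on ({0<..<\<tau>} \<times> torus))"
      then show "\<bar>case p of (t, x) \<Rightarrow> f t x\<bar> \<le> B"
        using B[of "fst p" "snd p"] assms(3) by (auto simp: space_restrict_space)
    qed
  qed
qed

lemma set_integrable_torus_continuous:
  fixes f :: "real^'d \<Rightarrow> real"
  assumes "continuous_on UNIV f" "periodic f"
  shows "set_integrable lebesgue torus f"
proof -
  obtain B where B: "\<And>x. norm (f x) \<le> B"
    using periodic_continuous_bounded[OF assms(2,1)] by auto
  show ?thesis
    by (rule set_integrable_bounded[OF torus_borel torus_bounded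
          set_borel_measurable_continuous_subset[OF assms(1) _ torus_borel]])
      (use B in auto)
qed

lemma integral_lborel_translate:
  fixes f :: "'a::euclidean_space \<Rightarrow> real"
  assumes "f \<in> borel_measurable borel"
  shows "(\<integral>x. f (x + c) \<partial>lborel) = (\<integral>x. f x \<partial>lborel)"
proof -
  have "(\<integral>x. f x \<partial>lborel) = (\<integral>x. f x \<partial>distr lborel borel ((+) c))" by (simp add: lborel_distr_plus)
  also have "\<dots> = (\<integral>x. f (c + x) \<partial>lborel)" using assms by (intro integral_distr) auto
  finally show ?thesis by (simp add: add.commute)
qed

text \<open>The translated cell sticks out of the unit cell; shifting the protruding slab back by
  one period refills the gap and leaves the periodic integrand unchanged.\<close>

lemma integral_torus_translate:
  fixes f :: "real^'d \<Rightarrow> real"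
  assumes cont: "continuous_on UNIV f" and per: "periodic f" and h: "0 \<le> h" "h \<le> 1"
  shows "(\<integral>x. indicator torus x * f (x + h *\<^sub>R axis i 1) \<partial>lborel) = (\<integral>x. indicator torus x * f x \<partial>lborel)"
proof -
  let ?e = "axis i 1 :: real^'d"
  define L where "L = torus \<inter> {x :: real^'d. x $ i < h}"
  define R where "R = torus \<inter> {x :: real^'d. h \<le> x $ i}"
  have f: "f \<in> borel_measurable borel" using cont by (rule borel_measurable_continuous_onI)
  have [measurable]: "L \<in> sets borel" "R \<in> sets borel" unfolding L_def R_def
    by (intro sets.Int torus_borel borel_open open_Collect_less continuous_intros,
        intro sets.Int torus_borel borel_closed closed_Collect_le continuous_intros)
  have fi: "integrable lborel (\<lambda>x. indicator torus x * f x)"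
    using set_integrable_torus_continuous[OF cont per] f
    by (simp add: set_integrable_def integrable_completion)
  have int: "integrable lborel (\<lambda>x. indicator S x * f x)" if "S \<subseteq> torus" "S \<in> sets borel" for S
    by (rule Bochner_Integration.integrable_bound[OF fi]) (use that f in \<open>auto simp: indicator_def\<close>)
  have LR: "L \<subseteq> torus" "R \<subseteq> torus" by (auto simp: L_def R_def)
  \<comment> \<open>Points of the translated cell lie either in the slab \<open>R\<close> of the old
    cell or in the slab \<open>L\<close> shifted by one period, and never in both.\<close>
  have shift: "indicator torus (y - h *\<^sub>R ?e) = (indicator R y + indicator L (y - ?e) :: real)" for y
  proof -
    have eq: "z \<in> torus \<longleftrightarrow> (\<forall>j. j \<noteq> i \<longrightarrow> 0 \<le> z $ j \<and> z $ j < 1) \<and> 0 \<le> z $ i \<and> z $ i < 1" for z :: "real^'d"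
      by (auto simp: torus_def)
    have "y - h *\<^sub>R ?e \<in> torus \<longleftrightarrow> y \<in> R \<or> y - ?e \<in> L" and "\<not> (y \<in> R \<and> y - ?e \<in> L)"
      using h unfolding L_def R_def Int_iff mem_Collect_eq eq by (auto simp: axis_def)
    then show ?thesis by (auto simp: indicator_def)
  qed
  have m2: "(\<lambda>y. indicator L (y - ?e) * f y) \<in> borel_measurable borel"
    using f by measurable
  have per': "f (x + ?e) = f x" for x using per by (simp add: periodic_def)
  have L: "(\<integral>y. indicator L (y - ?e) * f y \<partial>lborel) = (\<integral>x. indicator L x * f x \<partial>lborel)"
    using integral_lborel_translate[OF m2, of ?e] by (simp add: per')
  have "integrable lborel (\<lambda>y. indicator L (y - ?e) * f y)"
  proof -
    have "integrable (distr lborel borel ((+) ?e)) (\<lambda>y. indicator L (y - ?e) * f y)"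
      using int[OF LR(1)] m2 by (subst integrable_distr_eq) (auto simp: add.commute[of ?e] per')
    then show ?thesis by (simp add: lborel_distr_plus)
  qed
  then have "(\<integral>y. indicator torus (y - h *\<^sub>R ?e) * f y \<partial>lborel)
      = (\<integral>x. indicator R x * f x \<partial>lborel) + (\<integral>x. indicator L x * f x \<partial>lborel)"
    unfolding shift distrib_right L[symmetric] using int[OF LR(2)] by simp
  also have "\<dots> = (\<integral>x. indicator R x * f x + indicator L x * f x \<partial>lborel)"
    using int[OF LR(1)] int[OF LR(2)] by simp
  also have "\<dots> = (\<integral>x. indicator torus x * f x \<partial>lborel)"
    by (rule Bochner_Integration.integral_cong) (auto simp: indicator_def L_def R_def)
  finally have *: "(\<integral>y. indicator torus (y - h *\<^sub>R ?e) * f y \<partial>lborel) = (\<integral>x. indicator torus x * f x \<partial>lborel)" .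
  have "(\<lambda>y. indicator torus (y - h *\<^sub>R ?e) * f y) \<in> borel_measurable borel" using f by measurable
  from integral_lborel_translate[OF this, of "h *\<^sub>R ?e"] * show ?thesis by simp
qed

text \<open>Translation invariance gives every difference quotient integral zero; dominated
  convergence passes this to the derivative. This is the divergence theorem on the torus.\<close>

lemma integral_torus_pd:
  fixes f :: "real^'d \<Rightarrow> real"
  assumes "C1_torus f"
  shows "(LINT x:torus|lebesgue. pd i f x) = 0"
proof -
  let ?e = "axis i 1 :: real^'d"
  have per: "periodic f" and diff: "f differentiable (at x)" and contp: "continuous_on UNIV (pd i f)" for x
    using assms by (auto simp: C1_torus_def differentiable_on_def)
  have cont: "continuous_on UNIV f"
    using assms by (auto simp: C1_torus_def intro: differentiable_imp_continuous_on)
  have line: "((\<lambda>s. f (x + s *\<^sub>R ?e)) has_real_derivative pd i f (x + s *\<^sub>R ?e)) (at s)" for x s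
  proof -
    obtain D where D: "(f has_derivative D) (at (x + s *\<^sub>R ?e))" "pd i f (x + s *\<^sub>R ?e) = D ?e"
      using has_derivative_pd[OF diff] by blast
    have "((\<lambda>s. x + s *\<^sub>R ?e) has_derivative (\<lambda>s. s *\<^sub>R ?e)) (at s)"
      by (auto intro!: derivative_eq_intros)
    from has_derivative_compose[OF this D(1)]
    have "((\<lambda>s. f (x + s *\<^sub>R ?e)) has_derivative (\<lambda>s. D (s *\<^sub>R ?e))) (at s)" .
    moreover have "D (s *\<^sub>R ?e) = pd i f (x + s' *\<^sub>R ?e) * s" if "s' = s0" "pd i f (x + s0 *\<^sub>R ?e) = D ?e" for s s' s0
      using linear_scale[OF has_derivative_linear[OF D(1)]] that by simp
    ultimately show ?thesis using D(2) by (auto simp: has_field_derivative_def)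
  qed
  obtain B where B: "\<And>x. norm (pd i f x) \<le> B"
    using periodic_continuous_bounded[OF periodic_pd[OF per] contp] by auto
  define h where "h n = inverse (real (Suc n))" for n
  have h: "0 < h n" "h n \<le> 1" for n by (auto simp: h_def field_simps)
  define q where "q n x = (f (x + h n *\<^sub>R ?e) - f x) / h n" for n x
  have f: "f \<in> borel_measurable borel" using cont by (rule borel_measurable_continuous_onI)
  have cont_shift: "continuous_on UNIV (\<lambda>x. f (x + c))" for c
    by (rule continuous_on_compose2[OF cont]) (auto intro!: continuous_intros)
  have int: "integrable lborel (\<lambda>x. indicator torus x * f (x + c))" for c
  proof -
    have "periodic (\<lambda>x. f (x + c))"
      unfolding periodic_def
    proof (intro allI)
      fix x j
      have "f (x + axis j 1 + c) = f ((x + c) + axis j 1)" by (simp add: add_ac)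
      then show "f (x + axis j 1 + c) = f (x + c)" using per by (simp add: periodic_def)
    qed
    from set_integrable_torus_continuous[OF cont_shift this]
    show ?thesis using borel_measurable_continuous_onI[OF cont_shift, of c]
      by (simp add: set_integrable_def integrable_completion)
  qed
  have zero: "(\<integral>x. indicator torus x * q n x \<partial>lborel) = 0" for n
  proof -
    have "(\<integral>x. indicator torus x * q n x \<partial>lborel)
        = (\<integral>x. (indicator torus x * f (x + h n *\<^sub>R ?e) - indicator torus x * f (x + 0)) / h n \<partial>lborel)"
      by (simp add: q_def algebra_simps diff_divide_distrib)
    also have "\<dots> = 0"
      using integral_torus_translate[OF cont per, of "h n" i] h[of n] int[of "h n *\<^sub>R ?e"] int[of 0]
      by (simp add: Bochner_Integration.integral_diff less_imp_le)
    finally show ?thesis .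
  qed
  have "(\<lambda>n. \<integral>x. indicator torus x * q n x \<partial>lborel) \<longlonglongrightarrow> (\<integral>x. indicator torus x * pd i f x \<partial>lborel)"
  proof (rule integral_dominated_convergence[where w = "\<lambda>x. B * indicator torus x"])
    show "(\<lambda>x. indicator torus x * pd i f x) \<in> borel_measurable lborel"
      using borel_measurable_continuous_onI[OF contp] by simp
    show "(\<lambda>x. indicator torus x * q n x) \<in> borel_measurable lborel" for n
      unfolding q_def using f borel_measurable_continuous_onI[OF cont_shift] by simp
    show "integrable lborel (\<lambda>x. B * indicator torus x)"
      using emeasure_bounded_finite[OF torus_bounded] by (intro integrable_mult_right integrable_real_indicator) auto
    show "AE x in lborel. (\<lambda>n. indicator torus x * q n x) \<longlonglongrightarrow> indicator torus x * pd i f x"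
    proof (rule AE_I2, rule tendsto_mult_left)
      fix x
      have "((\<lambda>s. (f (x + s *\<^sub>R ?e) - f x) / s) \<longlongrightarrow> pd i f x) (at 0)"
        using line[of x 0] by (simp add: DERIV_def)
      moreover have "filterlim h (at 0) sequentially"
        unfolding h_def using LIMSEQ_inverse_real_of_nat by (auto simp: filterlim_at)
      ultimately show "(\<lambda>n. q n x) \<longlonglongrightarrow> pd i f x"
        unfolding q_def by (rule filterlim_compose)
    qed
    show "AE x in lborel. norm (indicator torus x * q n x) \<le> B * indicator torus x" for n
    proof (rule AE_I2)
      fix x
      \<comment> \<open>The mean value theorem makes the bound of the derivative a uniform bound of
        the quotients.\<close>
      obtain z where "f (x + h n *\<^sub>R ?e) - f (x + 0 *\<^sub>R ?e) = (h n - 0) * pd i f (x + z *\<^sub>R ?e)"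
        using MVT2[of 0 "h n" "\<lambda>s. f (x + s *\<^sub>R ?e)" "\<lambda>s. pd i f (x + s *\<^sub>R ?e)"] line h(1) by blast
      then have "q n x = pd i f (x + z *\<^sub>R ?e)" using h(1)[of n] by (simp add: q_def field_simps)
      then show "norm (indicator torus x * q n x) \<le> B * indicator torus x"
        using B by (simp add: indicator_def)
    qed
  qed
  then have "(\<integral>x. indicator torus x * pd i f x \<partial>lborel) = 0"
    unfolding zero by (simp add: LIMSEQ_const_iff)
  then show ?thesis
    using borel_measurable_continuous_onI[OF contp]
    by (simp add: set_lebesgue_integral_def integral_completion)
qed

text \<open>Fundamental theorem of calculus at each x, followed by exchange of the integrals. It
  serves the part of the relative energy that involves only the strong solution.\<close>

lemma integral_torus_time_difference:
  fixes f :: "real \<Rightarrow> real^'d \<Rightarrow> real"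
  assumes f: "C1_space_time T f" and \<tau>: "0 \<le> \<tau>" "\<tau> \<le> T"
  shows "(LINT x:torus|lebesgue. f \<tau> x) - (LINT x:torus|lebesgue. f 0 x)
    = (LINT p:{0<..<\<tau>} \<times> torus|lebesgue. (\<lambda>(t, x). tderiv T f t x) p)"
proof -
  let ?S = "{0<..<\<tau>} \<times> (torus :: (real^'d) set)"
  let ?h = "\<lambda>p. indicator ?S p *\<^sub>R (\<lambda>(t, x). tderiv T f t x) p"
  have per: "\<And>t. t \<in> {0..T} \<Longrightarrow> periodic (f t)" using f by (simp add: C1_space_time_def)
  have cont: "continuous_on ({0..T} \<times> UNIV) (\<lambda>(t, x). f t x)" using f by (simp add: C1_space_time_def)
  note contd = C1_space_time_continuous_tderiv[OF f]
  have hm: "?h \<in> borel_measurable borel"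
    by (rule borel_measurable_continuous_on_indicator[OF space_time_box_borel continuous_on_subset[OF contd]])
      (use \<tau> in auto)
  have hi: "integrable lborel ?h"
    using set_integrable_space_time_continuous[OF contd periodic_tderiv[OF per] \<tau>(2)] hm
    by (simp add: set_integrable_def integrable_completion)
  have inner: "(\<integral>t. ?h (t, x) \<partial>lborel) = indicator torus x * (f \<tau> x - f 0 x)" for x
  proof -
    have "((\<lambda>t. tderiv T f t x) has_integral (f \<tau> x - f 0 x)) {0..\<tau>}"
      using \<tau> by (intro fundamental_theorem_of_calculus
          has_vector_derivative_within_subset[OF C1_space_time_tderiv[OF f]]) auto
    moreover have c: "continuous_on {0..\<tau>} (\<lambda>t. tderiv T f t x)"
    proof -
      have "continuous_on {0..\<tau>} (\<lambda>t. (\<lambda>(t, x). tderiv T f t x) (t, x))"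
        by (rule continuous_on_compose2[OF contd]) (use \<tau> in \<open>auto intro!: continuous_intros\<close>)
      then show ?thesis by simp
    qed
    ultimately have "(LINT t:{0..\<tau>}|lborel. tderiv T f t x) = f \<tau> x - f 0 x"
      using set_borel_integral_eq_integral(2)[OF borel_integrable_atLeastAtMost'[OF c]]
      by (simp add: integral_unique)
    moreover have "(LINT t:{0..\<tau>}|lborel. tderiv T f t x) = (LINT t:{0<..<\<tau>}|lborel. tderiv T f t x)"
      unfolding set_lebesgue_integral_def
    proof (rule integral_cong_AE)
      show "(\<lambda>t. indicator {0..\<tau>} t *\<^sub>R tderiv T f t x) \<in> borel_measurable lborel"
        using borel_measurable_continuous_on_indicator[OF _ c] by simp
      show "(\<lambda>t. indicator {0<..<\<tau>} t *\<^sub>R tderiv T f t x) \<in> borel_measurable lborel"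
        using borel_measurable_continuous_on_indicator[OF _ continuous_on_subset[OF c], of "{0<..<\<tau>}"]
        by (simp add: subset_iff)
      show "AE t in lborel. indicator {0..\<tau>} t *\<^sub>R tderiv T f t x = indicator {0<..<\<tau>} t *\<^sub>R tderiv T f t x"
        using AE_lborel_singleton[of 0] AE_lborel_singleton[of \<tau>]
        by eventually_elim (auto simp: indicator_def)
    qed
    ultimately show ?thesis
      by (simp add: set_lebesgue_integral_def indicator_times mult.commute mult.left_commute)
  qed
  have sec: "continuous_on UNIV (f t)" if "t \<in> {0..T}" for t by (rule continuous_on_section[OF cont that])
  have "(LINT p:?S|lebesgue. (\<lambda>(t, x). tderiv T f t x) p) = (\<integral>p. ?h p \<partial>lborel)"
    using hm by (simp add: set_lebesgue_integral_def integral_completion)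
  also have "\<dots> = (\<integral>p. ?h p \<partial>(lborel \<Otimes>\<^sub>M lborel))" by (simp add: lborel_prod)
  also have "\<dots> = (\<integral>x. (\<integral>t. ?h (t, x) \<partial>lborel) \<partial>lborel)"
    using lborel_pair.integral_snd[of "\<lambda>t x. ?h (t, x)"] hi by (simp add: lborel_prod case_prod_unfold)
  also have "\<dots> = (\<integral>x. indicator torus x * f \<tau> x - indicator torus x * f 0 x \<partial>lborel)"
    unfolding inner by (simp add: right_diff_distrib)
  also have "\<dots> = (LINT x:torus|lebesgue. f \<tau> x) - (LINT x:torus|lebesgue. f 0 x)"
  proof -
    have "integrable lborel (\<lambda>x. indicator torus x * f t x)"
      "(LINT x:torus|lebesgue. f t x) = (\<integral>x. indicator torus x * f t x \<partial>lborel)" if "t \<in> {0..T}" for t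
      using set_integrable_torus_continuous[OF sec per, OF that that] borel_measurable_continuous_onI[OF sec[OF that]]
      by (auto simp: set_integrable_def set_lebesgue_integral_def integrable_completion integral_completion)
    then show ?thesis using \<tau> by simp
  qed
  finally show ?thesis ..
qed

section \<open>Restriction to smaller sets and time intervals\<close>

lemma set_integrable_lebesgue_on:
  fixes f :: "'a::euclidean_space \<Rightarrow> 'b::{banach, second_countable_topology}"
  shows "A \<in> sets lebesgue \<Longrightarrow> set_integrable lebesgue A f \<longleftrightarrow> integrable (lebesgue_on A) f"
  using integrable_restrict_space[of A lebesgue f] by (simp add: set_integrable_def)

lemma set_lebesgue_integral_lebesgue_on:
  fixes f :: "'a::euclidean_space \<Rightarrow> 'b::{banach, second_countable_topology}"
  shows "A \<in> sets lebesgue \<Longrightarrow> set_lebesgue_integral lebesgue A f = integral\<^sup>L (lebesgue_on A) f"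
  using integral_restrict_space[of A lebesgue f] by (simp add: set_lebesgue_integral_def)

lemma set_borel_measurable_lebesgue_on:
  fixes f :: "'a::euclidean_space \<Rightarrow> 'b::{banach, second_countable_topology}"
  shows "A \<in> sets lebesgue \<Longrightarrow> set_borel_measurable lebesgue A f \<longleftrightarrow> f \<in> borel_measurable (lebesgue_on A)"
  using borel_measurable_restrict_space_iff[of A lebesgue f] by (simp add: set_borel_measurable_def)

lemma AE_lebesgue_on_subset:
  assumes "AE p in lebesgue_on A. Q p" "A \<in> sets lebesgue" "B \<in> sets lebesgue" "B \<subseteq> A"
  shows "AE p in lebesgue_on B. Q p"
proof -
  have "AE p in lebesgue. p \<in> A \<longrightarrow> Q p" using assms by (simp add: AE_restrict_space_iff)
  then have "AE p in lebesgue. p \<in> B \<longrightarrow> Q p" by eventually_elim (use assms(4) in auto)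
  then show ?thesis using assms by (simp add: AE_restrict_space_iff)
qed

lemma integrable_lebesgue_on_subset:
  fixes f :: "'a::euclidean_space \<Rightarrow> real"
  assumes "integrable (lebesgue_on A) f" "A \<in> sets lebesgue" "B \<in> sets lebesgue" "B \<subseteq> A"
  shows "integrable (lebesgue_on B) f"
  using set_integrable_subset[of lebesgue A f B] assms by (simp add: set_integrable_lebesgue_on)

lemma measurable_lebesgue_on_subset:
  fixes f :: "'a::euclidean_space \<Rightarrow> real"
  assumes "f \<in> borel_measurable (lebesgue_on A)" "B \<subseteq> A"
  shows "f \<in> borel_measurable (lebesgue_on B)"
  using measurable_restrict_mono[OF assms] .

lemma continuous_measurable_lebesgue_on:
  fixes f :: "'a::euclidean_space \<Rightarrow> real"
  assumes "continuous_on Y f" "S \<subseteq> Y" "S \<in> sets borel"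
  shows "f \<in> borel_measurable (lebesgue_on S)"
  using set_borel_measurable_continuous_subset[OF assms] assms(3)
  by (subst set_borel_measurable_lebesgue_on[symmetric]) auto

text \<open>An interval of positive length ending at T cannot consist of exceptional times, so
  admissible times accumulate at T. This lifts conclusions on (0, \<sigma>) to (0, T).\<close>

lemma AE_interval_exhaust:
  fixes T :: real
  assumes T: "T > 0" and Q: "AE \<tau> in lebesgue_on {0<..<T}. Q \<tau>"
  shows "\<exists>\<tau> :: nat \<Rightarrow> real. (\<forall>n. Q (\<tau> n)) \<and> {0<..<T} = (\<Union>n. {0<..<\<tau> n})"
proof -
  have "\<exists>\<tau>. T - T / real (n + 2) < \<tau> \<and> \<tau> < T \<and> Q \<tau>" for n
  proof (rule ccontr)
    assume no: "\<nexists>\<tau>. T - T / real (n + 2) < \<tau> \<and> \<tau> < T \<and> Q \<tau>"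
    let ?J = "{T - T / real (n + 2)<..<T}"
    have "0 \<le> T - T / real (n + 2)" using T by (simp add: field_simps)
    then have J: "?J \<subseteq> {0<..<T}" by auto
    have "AE \<tau> in lebesgue. \<tau> \<in> {0<..<T} \<longrightarrow> Q \<tau>" using Q by (simp add: AE_restrict_space_iff)
    then have "AE \<tau> in lebesgue. \<tau> \<notin> ?J" by eventually_elim (use no J in auto)
    then have "?J \<in> null_sets lebesgue" by (subst (asm) AE_iff_null_sets[symmetric]) auto
    then have "emeasure lebesgue ?J = 0" by auto
    then show False using T by (simp add: ennreal_eq_0_iff divide_le_0_iff)
  qed
  then obtain \<tau> where \<tau>: "\<And>n. T - T / real (n + 2) < \<tau> n" "\<And>n. \<tau> n < T" "\<And>n. Q (\<tau> n)" by metis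
  have "{0<..<T} = (\<Union>n. {0<..<\<tau> n})"
  proof (intro equalityI subsetI)
    fix t assume t: "t \<in> {0<..<T}"
    obtain n where "T / (T - t) < real n" using reals_Archimedean2 by blast
    then have "T / real (n + 2) < T - t" using t by (auto simp: field_simps)
    then show "t \<in> (\<Union>n. {0<..<\<tau> n})" using \<tau>(1)[of n] t by (auto intro!: exI[of _ n])
  qed (use \<tau>(2) in \<open>auto intro: less_trans\<close>)
  then show ?thesis using \<tau>(3) by blast
qed

lemma integral_lebesgue_on_mono:
  fixes f :: "'a::euclidean_space \<Rightarrow> real"
  assumes f: "integrable (lebesgue_on A) f" and nonneg: "AE p in lebesgue_on A. 0 \<le> f p"
    and A: "A \<in> sets lebesgue" and B: "B \<in> sets lebesgue" "B \<subseteq> A"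
  shows "integral\<^sup>L (lebesgue_on B) f \<le> integral\<^sup>L (lebesgue_on A) f"
proof -
  have "(\<integral>p. indicator B p *\<^sub>R f p \<partial>lebesgue) \<le> (\<integral>p. indicator A p *\<^sub>R f p \<partial>lebesgue)"
  proof (rule integral_mono_AE)
    show "integrable lebesgue (\<lambda>p. indicator B p *\<^sub>R f p)" "integrable lebesgue (\<lambda>p. indicator A p *\<^sub>R f p)"
      using integrable_lebesgue_on_subset[OF f A B] f A B(1)
      by (simp_all add: set_integrable_lebesgue_on[symmetric] set_integrable_def)
    have "AE p in lebesgue. p \<in> A \<longrightarrow> 0 \<le> f p" using nonneg A by (simp add: AE_restrict_space_iff)
    then show "AE p in lebesgue. indicator B p *\<^sub>R f p \<le> indicator A p *\<^sub>R f p"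
      by eventually_elim (use B(2) in \<open>auto simp: indicator_def\<close>)
  qed
  then show ?thesis using A B(1) by (simp add: set_lebesgue_integral_lebesgue_on[symmetric] set_lebesgue_integral_def)
qed



section \<open>Parametrized measures and Gronwall's lemma\<close>

text \<open>Completeness of Lebesgue measure is what makes a merely almost everywhere limit
  measurable.\<close>

lemma borel_measurable_AE_LIMSEQ:
  fixes u :: "nat \<Rightarrow> 'a::euclidean_space \<Rightarrow> real"
  assumes "\<And>n. u n \<in> borel_measurable lebesgue" "AE p in lebesgue. (\<lambda>n. u n p) \<longlonglongrightarrow> v p"
  shows "v \<in> borel_measurable lebesgue"
proof (rule borel_measurable_AE)
  show "(\<lambda>p. lim (\<lambda>n. u n p)) \<in> borel_measurable lebesgue"
    using assms(1) by (rule borel_measurable_lim_metric)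
  show "AE p in lebesgue. lim (\<lambda>n. u n p) = v p"
    using assms(2) by eventually_elim (rule limI)
qed

text \<open>Weak-star measurability speaks only of observables vanishing at infinity. Unbounded
  ones, such as the energy, are reached by cut-off and dominated convergence under each
  \<open>\<V> t x\<close>.\<close>

lemma set_borel_measurable_expect:
  fixes \<V> :: "'d::finite young" and b :: "'d phase \<Rightarrow> real"
  assumes V: "parametrized_measure T \<V>" and b: "continuous_on phase_space b"
    and int: "AE (t, x) in lebesgue_on ({0<..<T} \<times> torus). integrable (\<V> t x) b"
  shows "set_borel_measurable lebesgue ({0<..<T} \<times> torus) (\<lambda>(t, x). expect \<V> b t x)"
  unfolding set_borel_measurable_def
proof (rule borel_measurable_AE_LIMSEQ)
  let ?S = "{0<..<T} \<times> (torus :: (real^'d) set)"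
  have S: "?S \<in> sets borel" by (rule space_time_box_borel)
  \<comment> \<open>Equals 1 on the ball of radius n and 0 outside the ball of radius n + 1.\<close>
  define cut where "cut n y = max 0 (min 1 (real n + 1 - norm y))" for n and y :: "'d phase"
  define c where "c n y = b y * cut n y" for n y
  have cut: "continuous_on UNIV (cut n)" "0 \<le> cut n y" "cut n y \<le> 1" for n y
    by (auto simp: cut_def[abs_def] intro!: continuous_intros)
  have "C0_phase (c n)" for n
    unfolding C0_phase_def
  proof (intro conjI allI impI)
    show "continuous_on phase_space (c n)"
      unfolding c_def by (intro continuous_intros b continuous_on_subset[OF cut(1)]) auto
    fix e :: real assume "e > 0"
    have "c n y = 0" if "norm y > real n + 1" for y
      using that by (simp add: c_def cut_def)
    then show "\<exists>R. \<forall>y\<in>phase_space. norm y > R \<longrightarrow> \<bar>c n y\<bar> < e"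
      using \<open>e > 0\<close> by (intro exI[of _ "real n + 1"]) simp
  qed
  then show "(\<lambda>p. indicator ?S p *\<^sub>R (case p of (t, x) \<Rightarrow> expect \<V> (c n) t x)) \<in> borel_measurable lebesgue" for n
    using V by (simp add: parametrized_measure_def set_borel_measurable_def)
  have "AE p in lebesgue. p \<in> ?S \<longrightarrow> prob_space (\<V> (fst p) (snd p)) \<and>
      sets (\<V> (fst p) (snd p)) = sets phase_borel \<and> integrable (\<V> (fst p) (snd p)) b"
    using V int S by (auto simp: parametrized_measure_def AE_restrict_space_iff case_prod_unfold)
  then show "AE p in lebesgue. (\<lambda>n. indicator ?S p *\<^sub>R (case p of (t, x) \<Rightarrow> expect \<V> (c n) t x))
      \<longlonglongrightarrow> indicator ?S p *\<^sub>R (case p of (t, x) \<Rightarrow> expect \<V> b t x)"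
  proof eventually_elim
    case (elim p)
    obtain t x where p: "p = (t, x)" by (cases p)
    show ?case
    proof (cases "p \<in> ?S")
      case True
      then have sets: "sets (\<V> t x) = sets phase_borel" and i: "integrable (\<V> t x) b"
        using elim by (auto simp: p)
      have "(\<lambda>n. expect \<V> (c n) t x) \<longlonglongrightarrow> expect \<V> b t x"
        unfolding expect_def
      proof (rule integral_dominated_convergence[where w = "\<lambda>y. \<bar>b y\<bar>"])
        show "b \<in> borel_measurable (\<V> t x)" using i by (rule borel_measurable_integrable)
        have "cut n \<in> borel_measurable (\<V> t x)" for n
          using measurable_restrict_space1[OF borel_measurable_continuous_onI[OF cut(1)]]
            measurable_cong_sets[OF sets refl] by blast
        then show "c n \<in> borel_measurable (\<V> t x)" for n
          unfolding c_def[abs_def] using i by (intro borel_measurable_times) auto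
        show "integrable (\<V> t x) (\<lambda>y. \<bar>b y\<bar>)" using i by simp
        show "AE y in \<V> t x. norm (c n y) \<le> \<bar>b y\<bar>" for n
          using cut by (intro AE_I2) (simp add: c_def abs_mult mult_left_le)
        show "AE y in \<V> t x. (\<lambda>n. c n y) \<longlonglongrightarrow> b y"
        proof (rule AE_I2)
          fix y
          have "\<forall>\<^sub>F n in sequentially. c n y = b y"
            using eventually_ge_at_top[of "nat \<lceil>norm y\<rceil>"]
          proof eventually_elim
            case (elim n)
            then have "real n \<ge> norm y" by linarith
            then show ?case by (simp add: c_def cut_def)
          qed
          then show "(\<lambda>n. c n y) \<longlonglongrightarrow> b y" by (rule tendsto_eventually)
        qed
      qed
      then show ?thesis using True by (simp add: p)
    qed simp
  qed
qed

text \<open>Here \<open>y\<close> is only essentially bounded, the inequality holds almost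
  everywhere and the kernel is merely integrable, so nothing is differentiated. On a window where
  the kernel has mass below 1/2, each application of the inequality halves the bound on
  \<open>y\<close>; finitely many windows cover (0, T).\<close>

lemma gronwall_zero:
  fixes y k :: "real \<Rightarrow> real"
  assumes T: "T > 0" and y0: "AE t in lebesgue_on {0<..<T}. 0 \<le> y t"
    and yM: "AE t in lebesgue_on {0<..<T}. y t \<le> M"
    and k0: "AE t in lebesgue_on {0<..<T}. 0 \<le> k t"
    and ki: "set_integrable lebesgue {0<..<T} k"
    and kyi: "set_integrable lebesgue {0<..<T} (\<lambda>t. k t * y t)"
    and ineq: "AE \<tau> in lebesgue_on {0<..<T}. y \<tau> \<le> (LINT t:{0<..<\<tau>}|lebesgue. k t * y t)"
  shows "AE t in lebesgue_on {0<..<T}. y t = 0"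
proof -
  define K where "K \<tau> = (\<integral>t. indicator {0<..<\<tau>} t * k t \<partial>lebesgue)" for \<tau>
  have sub: "set_integrable lebesgue {0<..<\<tau>} k" "set_integrable lebesgue {0<..<\<tau>} (\<lambda>t. k t * y t)"
    if "\<tau> \<le> T" for \<tau>
    using that by (auto intro: set_integrable_subset[OF ki] set_integrable_subset[OF kyi])
  have ki': "integrable lebesgue (\<lambda>t. indicator {0<..<\<tau>} t * k t)"
    and kyi': "integrable lebesgue (\<lambda>t. indicator {0<..<\<tau>} t * (k t * y t))" if "\<tau> \<le> T" for \<tau>
    using sub[OF that] by (auto simp: set_integrable_def)
  have "k integrable_on {0..T}"
    using set_lebesgue_integral_eq_integral(1)[OF ki] integrable_on_open_interval_real[of k 0 T] by simp
  from indefinite_integral_continuous_1[OF this]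
  have "continuous_on {0..T} K"
  proof (rule continuous_on_eq)
    fix \<tau> assume "\<tau> \<in> {0..T}"
    then have "(LINT t:{0<..<\<tau>}|lebesgue. k t) = integral {0<..<\<tau>} k"
      by (intro set_lebesgue_integral_eq_integral(2) sub) auto
    then show "integral {0..\<tau>} k = K \<tau>"
      by (simp add: K_def set_lebesgue_integral_def integral_open_interval_real)
  qed
  then have "uniformly_continuous_on {0..T} K" by (rule compact_uniformly_continuous) auto
  \<comment> \<open>Uniform continuity of the indefinite integral fixes one window length for all
    starting points.\<close>
  then obtain d where d: "d > 0" "\<And>s s'. s \<in> {0..T} \<Longrightarrow> s' \<in> {0..T} \<Longrightarrow> dist s' s < d \<Longrightarrow> dist (K s') (K s) < 1/2"
    unfolding uniformly_continuous_on_def by (metis half_gt_zero zero_less_one)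
  define Z where "Z s \<longleftrightarrow> (AE t in lebesgue. t \<in> {0<..<s} \<longrightarrow> y t \<le> 0)" for s
  define M' where "M' = max M 0"
  have ae: "AE t in lebesgue. t \<in> {0<..<T} \<longrightarrow> 0 \<le> k t \<and> y t \<le> M' \<and> y t \<le> (LINT u:{0<..<t}|lebesgue. k u * y u)"
    using k0 yM ineq by (auto simp: AE_restrict_space_iff M'_def)
  have step: "Z s'" if Z: "Z s" and s: "0 \<le> s" "s \<le> s'" "s' \<le> T" "s' - s < d" for s s'
  proof -
    \<comment> \<open>Iterated halving; \<open>M'\<close> is nonnegative so that the bound also
      covers the earlier window, where \<open>y \<le> 0\<close> almost everywhere.\<close>
    have "AE t in lebesgue. t \<in> {0<..<s'} \<longrightarrow> y t \<le> M' / 2 ^ n" for n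
    proof (induction n)
      case 0
      show ?case using ae by eventually_elim (use s in auto)
    next
      case (Suc n)
      have M0: "0 \<le> M' / 2 ^ n" by (simp add: M'_def)
      show ?case using ae Z[unfolded Z_def]
      proof eventually_elim
        case (elim \<tau>)
        show ?case
        proof
          assume \<tau>: "\<tau> \<in> {0<..<s'}"
          show "y \<tau> \<le> M' / 2 ^ Suc n"
          proof (cases "\<tau> < s")
            case True
            then have "y \<tau> \<le> 0" using elim \<tau> by auto
            also have "0 \<le> M' / 2 ^ Suc n" by (simp add: M'_def)
            finally show ?thesis .
          next
            case False
            then have s\<tau>: "s \<le> \<tau>" "\<tau> \<le> T" "\<tau> \<in> {0<..<T}" using \<tau> s by auto
            have "y \<tau> \<le> (\<integral>u. indicator {0<..<\<tau>} u * (k u * y u) \<partial>lebesgue)"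
              using elim(1) s\<tau> by (auto simp: set_lebesgue_integral_def)
            \<comment> \<open>On (0, s) the integrand is nonpositive, and on the rest of (0, \<tau>)
              the previous bound applies; only the kernel mass between s and \<tau> remains.\<close>
            also have "\<dots> \<le> (\<integral>u. (M' / 2 ^ n) * (indicator {0<..<\<tau>} u * k u - indicator {0<..<s} u * k u) \<partial>lebesgue)"
            proof (rule integral_mono_AE)
              show "integrable lebesgue (\<lambda>u. (M' / 2 ^ n) * (indicator {0<..<\<tau>} u * k u - indicator {0<..<s} u * k u))"
                using ki'[of \<tau>] ki'[of s] s\<tau> by (intro integrable_mult_right Bochner_Integration.integrable_diff) auto
              show "integrable lebesgue (\<lambda>u. indicator {0<..<\<tau>} u * (k u * y u))" by (rule kyi') (use s\<tau> in auto)
              show "AE u in lebesgue. indicator {0<..<\<tau>} u * (k u * y u)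
                  \<le> (M' / 2 ^ n) * (indicator {0<..<\<tau>} u * k u - indicator {0<..<s} u * k u)"
                using ae Z[unfolded Z_def] Suc.IH
              proof eventually_elim
                case (elim u)
                consider "u \<notin> {0<..<\<tau>}" | "u \<in> {0<..<\<tau>}" "u < s" | "u \<in> {0<..<\<tau>}" "\<not> u < s" by blast
                then show ?case
                proof cases
                  case 1
                  then have "u \<notin> {0<..<s}" using s\<tau> by auto
                  with 1 show ?thesis by simp
                next
                  case 2
                  then have "k u * y u \<le> 0" using elim s\<tau> by (intro mult_nonneg_nonpos) auto
                  with 2 show ?thesis by simp
                next
                  case 3
                  then have "u \<in> {0<..<s'}" "u \<in> {0<..<T}" using \<tau> s by auto
                  then have "k u * y u \<le> k u * (M' / 2 ^ n)" using elim by (intro mult_left_mono) auto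
                  with 3 show ?thesis by (simp add: mult.commute)
                qed
              qed
            qed
            also have "\<dots> = (M' / 2 ^ n) * (K \<tau> - K s)"
              using ki'[of \<tau>] ki'[of s] s\<tau> unfolding K_def by simp
            also have "\<dots> \<le> (M' / 2 ^ n) * (1/2)"
            proof (rule mult_left_mono[OF _ M0])
              have "\<bar>K \<tau> - K s\<bar> < 1/2"
                using d(2)[of s \<tau>] s \<tau> s\<tau> by (auto simp: dist_real_def)
              then show "K \<tau> - K s \<le> 1/2" by linarith
            qed
            finally show ?thesis by simp
          qed
        qed
      qed
    qed
    then have "AE t in lebesgue. \<forall>n. t \<in> {0<..<s'} \<longrightarrow> y t \<le> M' / 2 ^ n"
      unfolding AE_all_countable by blast
    then show "Z s'"
      unfolding Z_def
    proof eventually_elim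
      case (elim t)
      have "(\<lambda>n. M' / 2 ^ n) \<longlonglongrightarrow> 0" by real_asymp
      then show ?case using elim by (auto intro: LIMSEQ_le_const)
    qed
  qed
  obtain N where N: "N > 0" "T / real N < d"
  proof -
    obtain N where "T / d < real N" using reals_Archimedean2 by blast
    moreover then have "N > 0" using T d(1) by (metis divide_pos_pos of_nat_0_less_iff order_less_trans)
    ultimately show thesis using d(1) that by (simp add: field_simps)
  qed
  have "Z (real j * (T / real N))" if "j \<le> N" for j
    using that
  proof (induction j)
    case 0
    show ?case by (simp add: Z_def)
  next
    case (Suc j)
    show ?case
    proof (rule step)
      show "Z (real j * (T / real N))" using Suc by simp
      have "real (Suc j) * T \<le> real N * T" using Suc.prems T by (intro mult_right_mono) auto
      then show "real (Suc j) * (T / real N) \<le> T" using N by (simp add: field_simps)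
      show "real (Suc j) * (T / real N) - real j * (T / real N) < d" using N by (simp add: field_simps)
      show "real j * (T / real N) \<le> real (Suc j) * (T / real N)" using T by (intro mult_right_mono) auto
      show "0 \<le> real j * (T / real N)" using T by simp
    qed
  qed
  from this[of N] have "Z T" using N by simp
  then show ?thesis using y0 unfolding Z_def by (auto simp: AE_restrict_space_iff)
qed

section \<open>The relative energy at a point\<close>

lemma return_eq_imp_eq:
  assumes "return N a = return N b" "a \<in> space N" "{a} \<in> sets N"
  shows "a = b"
proof -
  have "emeasure (return N a) {a} = 1" using assms(2,3) by simp
  then have "emeasure (return N b) {a} = 1" unfolding assms(1) .
  then have "indicator {a} b = (1 :: ennreal)" using assms(3) by simp
  then show ?thesis by (auto simp: indicator_def split: if_splits)
qed

lemma prob_space_eq_return: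
  assumes "prob_space M" "y0 \<in> space N" "sets M = sets N" "AE y in M. y = y0"
  shows "M = return N y0"
proof (rule measure_eqI)
  show "sets M = sets (return N y0)" using assms by simp
  fix A assume A: "A \<in> sets M"
  interpret prob_space M by fact
  have "emeasure M A = emeasure (return N y0) A"
  proof (cases "y0 \<in> A")
    case True
    then have "AE y in M. y \<in> A" using assms(4) by auto
    then have "emeasure M A = 1" using A emeasure_eq_1_AE by blast
    then show ?thesis using True A assms by simp
  next
    case False
    then have "AE y in M. y \<notin> A" using assms(4) by auto
    then have "emeasure M A = 0" using A by (subst AE_iff_measurable[symmetric]) (auto dest: sets.sets_into_space)
    then show ?thesis using False A assms by simp
  qed
  then show "emeasure M A = emeasure (return N y0) A" .
qed

text \<open>The integrand of the relative energy balance in terms of the deviations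
  \<open>z - q W\<close> and \<open>F - q h\<close>, where \<open>q\<close> is the square root of the density and \<open>b\<close> stands for
  the gradient of \<open>W\<close>.\<close>

lemma relative_energy_identity:
  fixes z F W h U :: "'a::real_inner"
  assumes b: "linear b" and U: "U = W - h"
  shows "- (F \<bullet> F) + z \<bullet> F - (q * (z \<bullet> (- b U)) + z \<bullet> b z - z \<bullet> b F)
      + q\<^sup>2 * (W \<bullet> (- b U) - a) + q * (W \<bullet> b (z - F) - (z - F) \<bullet> h) + r * a
    = - ((z - q *\<^sub>R W) \<bullet> b ((z - q *\<^sub>R W) - (F - q *\<^sub>R h))) + (z - F) \<bullet> (F - q *\<^sub>R h) - (q\<^sup>2 - r) * a"
  unfolding U linear_diff[OF b] linear_cmul[OF b]
  by (simp add: inner_diff_left inner_diff_right algebra_simps power2_eq_square inner_commute[of F z])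

text \<open>Young's inequality for the two quadratic couplings of the deviations. The terms linear
  in F are deliberately left with the factor \<open>s\<close>, to be instantiated by sqrt r: they
  are integrated by the weak gradient of Q(\<rho>) instead of being estimated.\<close>

lemma relative_energy_pointwise:
  fixes z F W h U :: "'a::real_inner"
  assumes b: "linear b" "\<And>v. norm (b v) \<le> \<beta> * norm v" and \<beta>: "\<beta> \<ge> 0" and U: "U = W - h"
    and u: "norm U \<le> u"
  shows "- (F \<bullet> F) + z \<bullet> F - (q * (z \<bullet> (- b U)) + z \<bullet> b z - z \<bullet> b F)
      + q\<^sup>2 * (W \<bullet> (- b U) - a) + q * (W \<bullet> b (z - F) - (z - F) \<bullet> h) + r * a
    \<le> (\<beta> + (1 + \<beta>)\<^sup>2) * (norm (z - q *\<^sub>R W))\<^sup>2 - 1/2 * (norm (F - q *\<^sub>R h))\<^sup>2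
      + u\<^sup>2 * (q - s)\<^sup>2 + s * (F \<bullet> U) - s * q * (h \<bullet> U) - (q\<^sup>2 - r) * a"
proof -
  define \<zeta> \<eta> where "\<zeta> = z - q *\<^sub>R W" and "\<eta> = F - q *\<^sub>R h"
  \<comment> \<open>Because U = W - h, the difference of the two reference points is q U; this is
    the origin of the linear term.\<close>
  have zF: "z - F = \<zeta> - \<eta> + q *\<^sub>R U"
    by (simp add: \<zeta>_def \<eta>_def U algebra_simps)
  have F: "F = \<eta> + q *\<^sub>R h" by (simp add: \<eta>_def)
  have 1: "- (\<zeta> \<bullet> b \<zeta>) \<le> \<beta> * (norm \<zeta>)\<^sup>2"
  proof -
    have "- (\<zeta> \<bullet> b \<zeta>) \<le> norm \<zeta> * norm (b \<zeta>)"
      using Cauchy_Schwarz_ineq2[of \<zeta> "b \<zeta>"] by linarith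
    also have "\<dots> \<le> norm \<zeta> * (\<beta> * norm \<zeta>)" by (intro mult_left_mono b) auto
    finally show ?thesis by (simp add: power2_eq_square mult_ac)
  qed
  have 2: "\<zeta> \<bullet> b \<eta> + \<zeta> \<bullet> \<eta> \<le> (1 + \<beta>)\<^sup>2 * (norm \<zeta>)\<^sup>2 + 1/4 * (norm \<eta>)\<^sup>2"
  proof -
    have "\<zeta> \<bullet> b \<eta> + \<zeta> \<bullet> \<eta> \<le> norm \<zeta> * norm (b \<eta>) + norm \<zeta> * norm \<eta>"
      using norm_cauchy_schwarz[of \<zeta> "b \<eta>"] norm_cauchy_schwarz[of \<zeta> \<eta>] by linarith
    also have "\<dots> \<le> norm \<zeta> * (\<beta> * norm \<eta>) + norm \<zeta> * norm \<eta>" by (intro add_right_mono mult_left_mono b) auto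
    also have "\<dots> = 2 * ((1 + \<beta>) * norm \<zeta>) * (norm \<eta> / 2)" by (simp add: algebra_simps)
    also have "\<dots> \<le> ((1 + \<beta>) * norm \<zeta>)\<^sup>2 + (norm \<eta> / 2)\<^sup>2" by (rule sum_squares_bound)
    finally show ?thesis by (simp add: power_mult_distrib power_divide)
  qed
  \<comment> \<open>Cost of exchanging q with s. Together with step 2 it consumes half of
    -|\<eta>|^2.\<close>
  have 3: "(q - s) * (\<eta> \<bullet> U) \<le> 1/4 * (norm \<eta>)\<^sup>2 + u\<^sup>2 * (q - s)\<^sup>2"
  proof -
    have "(q - s) * (\<eta> \<bullet> U) \<le> \<bar>q - s\<bar> * \<bar>\<eta> \<bullet> U\<bar>"
      by (metis abs_ge_self abs_mult)
    also have "\<dots> \<le> \<bar>q - s\<bar> * (norm \<eta> * u)"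
      using Cauchy_Schwarz_ineq2[of \<eta> U] u mult_left_mono[OF u norm_ge_zero[of \<eta>]]
      by (intro mult_left_mono) auto
    also have "\<dots> = 2 * (norm \<eta> / 2) * (u * \<bar>q - s\<bar>)" by simp
    also have "\<dots> \<le> (norm \<eta> / 2)\<^sup>2 + (u * \<bar>q - s\<bar>)\<^sup>2" by (rule sum_squares_bound)
    finally show ?thesis by (simp add: power_mult_distrib power_divide)
  qed
  have "- (\<zeta> \<bullet> b (\<zeta> - \<eta>)) + (z - F) \<bullet> \<eta> - (q\<^sup>2 - r) * a
      = - (\<zeta> \<bullet> b \<zeta>) + (\<zeta> \<bullet> b \<eta> + \<zeta> \<bullet> \<eta>) - (norm \<eta>)\<^sup>2 + (q - s) * (\<eta> \<bullet> U)
        + s * (F \<bullet> U) - s * q * (h \<bullet> U) - (q\<^sup>2 - r) * a"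
    unfolding zF unfolding F
    by (simp add: linear_diff[OF b(1)] inner_diff_left inner_diff_right inner_add_left inner_add_right
        algebra_simps power2_norm_eq_inner inner_commute[of U \<eta>])
  also have "\<dots> \<le> (\<beta> + (1 + \<beta>)\<^sup>2) * (norm \<zeta>)\<^sup>2 - 1/2 * (norm \<eta>)\<^sup>2
      + u\<^sup>2 * (q - s)\<^sup>2 + s * (F \<bullet> U) - s * q * (h \<bullet> U) - (q\<^sup>2 - r) * a"
    using 1 2 3 by (simp add: algebra_simps)
  finally show ?thesis
    unfolding relative_energy_identity[OF b(1) U] \<zeta>_def \<eta>_def .
qed

text \<open>Bregman gap of the convex power 3/2, factored as a polynomial in the two square roots.
  Nonnegativity and the zero set can be read off, also at vacuum.\<close>

lemma cube_sqrt_gap: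
  assumes "s \<ge> 0" "\<rho> \<ge> 0"
  shows "s powr (3/2) - \<rho> powr (3/2) - 3/2 * sqrt \<rho> * (s - \<rho>)
    = (sqrt s - sqrt \<rho>)\<^sup>2 * (sqrt s + sqrt \<rho> / 2)"
proof -
  have *: "x powr (3/2) = sqrt x ^ 3" if "x \<ge> 0" for x
    using that by (simp add: powr_half_sqrt_powr[symmetric] powr_powr flip: powr_half_sqrt powr_numeral)
  have alg: "a ^ 3 - b ^ 3 - 3/2 * b * (a\<^sup>2 - b\<^sup>2) = (a - b)\<^sup>2 * (a + b / 2)" for a b :: real
    by (simp add: power2_eq_square power3_eq_cube field_simps)
  show ?thesis unfolding *[OF assms(1)] *[OF assms(2)]
    using alg[of "sqrt s" "sqrt \<rho>"] assms by simp
qed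

text \<open>Collects what is known about \<open>\<V> t x\<close> at almost every point, so that
  phase-space integrals can be treated for one measure at a time. The exponent 3/2 lies strictly
  between 1 and \<gamma> + 1 for every \<gamma> \<ge> 1.\<close>

locale young_measure = prob_space M for M :: "'d::finite phase measure" and \<gamma> :: real +
  assumes gamma: "\<gamma> \<ge> 1" and sets_M: "sets M = sets phase_borel"
    and int_Epot: "integrable M (\<lambda>(s, z, F). Epot \<gamma> s)"
    and int_z2: "integrable M (\<lambda>(s, z, F). (norm z)\<^sup>2)"
    and int_F2: "integrable M (\<lambda>(s, z, F). (norm F)\<^sup>2)"
    and moment: "(\<integral>(s, z, F). s \<partial>M) powr (3/2) = (\<integral>(s, z, F). s powr (3/2) \<partial>M)"
begin

section \<open>Moments of a single measure\<close>

definition \<rho> :: real where "\<rho> = (\<integral>(s, z, F). s \<partial>M)"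
definition Z :: "real^'d" where "Z = (\<integral>(s, z, F). z \<partial>M)"
definition G :: "real^'d" where "G = (\<integral>(s, z, F). F \<partial>M)"

lemma space_M: "space M = phase_space"
  using sets_eq_imp_space_eq[OF sets_M] by (simp add: space_restrict_space)

lemma measurable_M: "f \<in> borel_measurable borel \<Longrightarrow> f \<in> borel_measurable M"
  using measurable_restrict_space1 measurable_cong_sets[OF sets_M refl] by blast

lemma measurable_s:
  assumes "f \<in> borel_measurable borel"
  shows "(\<lambda>(s, z, F). f s) \<in> borel_measurable M"
proof -
  have "fst \<in> borel_measurable M"
    by (intro measurable_M borel_measurable_continuous_onI continuous_intros)
  from measurable_compose[OF this assms] show ?thesis by (simp add: case_prod_unfold)
qed

lemma AE_nonneg: "AE (s, z, F) in M. s \<ge> 0"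
  by (rule AE_I2) (auto simp: space_M phase_space_def)

lemma int_powr: "integrable M (\<lambda>(s, z, F). s powr (\<gamma> + 1))"
proof -
  have "integrable M (\<lambda>y. (\<gamma> + 1) * (case y of (s, z, F) \<Rightarrow> Epot \<gamma> s))"
    using int_Epot by (simp add: case_prod_unfold)
  moreover have "(\<lambda>(s, z, F). s powr (\<gamma> + 1)) \<in> borel_measurable M"
    by (rule measurable_s) measurable
  moreover have "AE y in M. (\<gamma> + 1) * (case y of (s, z, F) \<Rightarrow> Epot \<gamma> s) = (case y of (s, z, F) \<Rightarrow> s powr (\<gamma> + 1))"
    using AE_nonneg by eventually_elim (use gamma Epot_eq in auto)
  ultimately show ?thesis by (rule integrable_cong_AE_imp)
qed

lemma int_powr_le:
  assumes "0 < a" "a \<le> \<gamma> + 1"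
  shows "integrable M (\<lambda>(s, z, F). s powr a)"
proof (rule Bochner_Integration.integrable_bound)
  show "integrable M (\<lambda>y. 1 + (case y of (s, z, F) \<Rightarrow> s powr (\<gamma> + 1)))"
    using int_powr by (simp add: case_prod_unfold)
  show "(\<lambda>(s, z, F). s powr a) \<in> borel_measurable M"
    by (rule measurable_s) measurable
  show "AE y in M. norm (case y of (s, z, F) \<Rightarrow> s powr a) \<le> norm (1 + (case y of (s, z, F) \<Rightarrow> s powr (\<gamma> + 1)))"
    using AE_nonneg
  proof eventually_elim
    case (elim y)
    obtain s z F where y: "y = (s, z, F)" by (cases y)
    have "s powr a \<le> 1 + s powr (\<gamma> + 1)"
    proof (cases "s \<le> 1")
      case True
      then have "s powr a \<le> 1" using elim y assms by (intro powr_le1) auto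
      then show ?thesis by (simp add: add_increasing2)
    next
      case False
      then have "s powr a \<le> s powr (\<gamma> + 1)" using assms by (intro powr_mono) auto
      then show ?thesis by simp
    qed
    then show ?case by (simp add: y)
  qed
qed

lemma int_s: "integrable M (\<lambda>(s, z, F). s)"
proof (rule integrable_cong_AE_imp)
  show "integrable M (\<lambda>(s, z, F). s powr 1)" using int_powr_le[of 1] gamma by simp
  show "(\<lambda>(s, z, F). s) \<in> borel_measurable M" by (rule measurable_s) measurable
  show "AE y in M. (case y of (s, z, F) \<Rightarrow> s powr 1) = (case y of (s, z, F) \<Rightarrow> s)"
    using AE_nonneg by eventually_elim auto
qed

lemma rho_nonneg: "\<rho> \<ge> 0"
  unfolding \<rho>_def using AE_nonneg by (intro integral_nonneg_AE) auto

text \<open>Equality case of Jensen's inequality for the power 3/2: a nonnegative gap with mean zero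
  vanishes almost surely.\<close>

lemma AE_s_eq: "AE (s, z, F) in M. s = \<rho>"
proof -
  define gap :: "'d phase \<Rightarrow> real" where "gap = (\<lambda>(s, z, F). s powr (3/2) - \<rho> powr (3/2) - 3/2 * sqrt \<rho> * (s - \<rho>))"
  have i: "integrable M (\<lambda>(s, z, F). s powr (3/2))" using int_powr_le[of "3/2"] gamma by simp
  have "integrable M gap"
    unfolding gap_def case_prod_unfold using int_s i by (simp add: case_prod_unfold)
  moreover have "AE y in M. 0 \<le> gap y"
    using AE_nonneg
  proof eventually_elim
    case (elim y)
    obtain s z F where y: "y = (s, z, F)" by (cases y)
    have "0 \<le> (sqrt s - sqrt \<rho>)\<^sup>2 * (sqrt s + sqrt \<rho> / 2)"
      using elim rho_nonneg by (simp add: y)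
    then show ?case
      using elim rho_nonneg cube_sqrt_gap[of s \<rho>] by (simp add: gap_def y)
  qed
  \<comment> \<open>The affine part has mean zero because \<rho> is the mean of s; the powers cancel
    by \<open>moment\<close>.\<close>
  moreover have "integral\<^sup>L M gap = 0"
    unfolding gap_def using int_s i moment
    by (simp add: case_prod_unfold \<rho>_def prob_space)
  ultimately have "AE y in M. gap y = 0"
    using integral_nonneg_eq_0_iff_AE by blast
  with AE_nonneg show ?thesis
  proof eventually_elim
    case (elim y)
    obtain s z F where y: "y = (s, z, F)" by (cases y)
    have s: "s \<ge> 0" using elim y by simp
    have "(sqrt s - sqrt \<rho>)\<^sup>2 * (sqrt s + sqrt \<rho> / 2) = 0"
      using elim(2) unfolding y gap_def prod.case cube_sqrt_gap[OF s rho_nonneg] .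
    then have "sqrt s = sqrt \<rho>"
    proof -
      assume "(sqrt s - sqrt \<rho>)\<^sup>2 * (sqrt s + sqrt \<rho> / 2) = 0"
      then consider "sqrt s - sqrt \<rho> = 0" | "sqrt s + sqrt \<rho> / 2 = 0" by auto
      then show ?thesis
      proof cases
        case 2
        have "sqrt s \<ge> 0" "sqrt \<rho> \<ge> 0" using s rho_nonneg by auto
        with 2 have "sqrt s = 0" "sqrt \<rho> = 0" by linarith+
        then show ?thesis by simp
      qed simp
    qed
    then show ?case by (simp add: y)
  qed
qed

lemma int_bounded_by_squares:
  fixes f :: "real^'d \<Rightarrow> real^'d \<Rightarrow> 'b::{banach, second_countable_topology}"
  assumes "(\<lambda>(s :: real, z, F). f z F) \<in> borel_measurable borel"
    and "\<And>z F. norm (f z F) \<le> k * (1 + (norm z)\<^sup>2 + (norm F)\<^sup>2)"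
  shows "integrable M (\<lambda>(s, z, F). f z F)"
proof (rule Bochner_Integration.integrable_bound)
  show "integrable M (\<lambda>(s, z, F). k * (1 + (norm z)\<^sup>2 + (norm F)\<^sup>2))"
    using int_z2 int_F2 by (simp add: case_prod_unfold)
  show "(\<lambda>(s, z, F). f z F) \<in> borel_measurable M" by (rule measurable_M) fact
  show "AE y in M. norm (case y of (s, z, F) \<Rightarrow> f z F)
      \<le> norm (case y of (s, z, F) \<Rightarrow> k * (1 + (norm z)\<^sup>2 + (norm F)\<^sup>2))"
    using assms(2) order_trans[OF _ abs_ge_self] by (intro AE_I2) auto
qed


text \<open>This relation carries integrability together with the value, so long linear combinations
  are integrated by introduction rules alone.\<close>

abbreviation hbi :: "('d phase \<Rightarrow> 'b::{banach, second_countable_topology}) \<Rightarrow> 'b \<Rightarrow> bool" where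
  "hbi \<equiv> has_bochner_integral M"

lemma hbi_const: "hbi (\<lambda>y. c) c"
  using has_bochner_integral_integrable[of M "\<lambda>y. c"] by (simp add: prob_space)

lemma hbi_z: "hbi (\<lambda>y. fst (snd y)) Z"
  and hbi_F: "hbi (\<lambda>y. snd (snd y)) G"
proof -
  have 1: "norm v \<le> 1 * (1 + (norm v)\<^sup>2 + (norm w)\<^sup>2)" for v w :: "real^'d"
    using sum_squares_bound[of "norm v" 1] zero_le_power2[of "norm w"] norm_ge_zero[of v]
    unfolding mult_1 mult_1_right power_one by linarith
  have "integrable M (\<lambda>(s, z, F). z)"
    using 1 by (intro int_bounded_by_squares[where k = 1])
      (auto simp: case_prod_unfold intro!: borel_measurable_continuous_onI continuous_intros)
  then show "hbi (\<lambda>y. fst (snd y)) Z"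
    unfolding Z_def case_prod_unfold by (rule has_bochner_integral_integrable)
  have "norm w \<le> 1 * (1 + (norm v)\<^sup>2 + (norm w)\<^sup>2)" for v w :: "real^'d"
    using 1[of w v] by (simp add: add.commute add.left_commute)
  then have "integrable M (\<lambda>(s, z, F). F)"
    by (intro int_bounded_by_squares[where k = 1])
      (auto simp: case_prod_unfold intro!: borel_measurable_continuous_onI continuous_intros)
  then show "hbi (\<lambda>y. snd (snd y)) G"
    unfolding G_def case_prod_unfold by (rule has_bochner_integral_integrable)
qed

lemma norm_mult_le_squares:
  fixes v w :: "real^'d" and a b :: real
  assumes "\<bar>a\<bar> \<le> norm v" "\<bar>b\<bar> \<le> norm w"
  shows "\<bar>a * b\<bar> \<le> (norm v)\<^sup>2 + (norm w)\<^sup>2"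
proof -
  have "\<bar>a * b\<bar> \<le> norm v * norm w" unfolding abs_mult using assms by (intro mult_mono) auto
  also have "\<dots> \<le> (norm v)\<^sup>2 + (norm w)\<^sup>2"
    using sum_squares_bound[of "norm v" "norm w"] mult_nonneg_nonneg[OF norm_ge_zero norm_ge_zero, of v w]
    by linarith
  finally show ?thesis .
qed

lemma int_zz: "integrable M (\<lambda>(s, z, F). z $ j * z $ i)"
proof (rule int_bounded_by_squares[where k = 2])
  show "(\<lambda>(s :: real, z :: real^'d, F :: real^'d). z $ j * z $ i) \<in> borel_measurable borel"
    unfolding case_prod_unfold by (intro borel_measurable_continuous_onI continuous_intros)
  fix z F :: "real^'d"
  have "\<bar>z $ j * z $ i\<bar> \<le> (norm z)\<^sup>2 + (norm z)\<^sup>2"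
    by (intro norm_mult_le_squares component_le_norm_cart)
  then show "norm (z $ j * z $ i) \<le> 2 * (1 + (norm z)\<^sup>2 + (norm F)\<^sup>2)"
    using zero_le_power2[of "norm F"] unfolding real_norm_def distrib_left by linarith
qed

lemma int_zF: "integrable M (\<lambda>(s, z, F). z $ j * F $ i)"
proof (rule int_bounded_by_squares[where k = 1])
  show "(\<lambda>(s :: real, z :: real^'d, F :: real^'d). z $ j * F $ i) \<in> borel_measurable borel"
    unfolding case_prod_unfold by (intro borel_measurable_continuous_onI continuous_intros)
  fix z F :: "real^'d"
  have "\<bar>z $ j * F $ i\<bar> \<le> (norm z)\<^sup>2 + (norm F)\<^sup>2"
    by (intro norm_mult_le_squares component_le_norm_cart)
  then show "norm (z $ j * F $ i) \<le> 1 * (1 + (norm z)\<^sup>2 + (norm F)\<^sup>2)" by simp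
qed

lemma int_z_inner_F: "integrable M (\<lambda>(s, z, F). z \<bullet> F)"
proof -
  have "integrable M (\<lambda>y. \<Sum>i\<in>UNIV. (\<lambda>(s, z, F). z $ i * F $ i) y)"
    by (intro Bochner_Integration.integrable_sum int_zF)
  then show ?thesis by (simp add: case_prod_unfold inner_vec_def)
qed

lemma int_sq_dev_z: "integrable M (\<lambda>(s, z, F). (norm (z - w))\<^sup>2)"
  and int_sq_dev_F: "integrable M (\<lambda>(s, z, F). (norm (F - w))\<^sup>2)"
proof -
  have 1: "(norm (v - w))\<^sup>2 \<le> (2 + 2 * (norm w)\<^sup>2) * (1 + (norm v)\<^sup>2 + (norm v')\<^sup>2)" for v v' :: "real^'d"
  proof -
    have "(norm (v - w))\<^sup>2 \<le> (norm v + norm w)\<^sup>2"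
      by (intro power_mono norm_triangle_ineq4) auto
    also have "\<dots> \<le> 2 * (norm v)\<^sup>2 + 2 * (norm w)\<^sup>2"
      using sum_squares_bound[of "norm v" "norm w"] by (simp add: power2_sum)
    also have "\<dots> \<le> (2 + 2 * (norm w)\<^sup>2) * (1 + (norm v)\<^sup>2 + (norm v')\<^sup>2)"
      by (simp add: algebra_simps)
    finally show ?thesis .
  qed
  have 2: "(norm (v - w))\<^sup>2 \<le> (2 + 2 * (norm w)\<^sup>2) * (1 + (norm v')\<^sup>2 + (norm v)\<^sup>2)" for v v' :: "real^'d"
    using 1[of v v'] by (simp add: add.commute add.left_commute)
  show "integrable M (\<lambda>(s, z, F). (norm (z - w))\<^sup>2)"
    by (rule int_bounded_by_squares[where k = "2 + 2 * (norm w)\<^sup>2"])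
      (use 1 in \<open>auto simp: case_prod_unfold intro!: borel_measurable_continuous_onI continuous_intros\<close>)
  show "integrable M (\<lambda>(s, z, F). (norm (F - w))\<^sup>2)"
    by (rule int_bounded_by_squares[where k = "2 + 2 * (norm w)\<^sup>2"])
      (use 2 in \<open>auto simp: case_prod_unfold intro!: borel_measurable_continuous_onI continuous_intros\<close>)
qed

lemmas hbi_intros = has_bochner_integral_add has_bochner_integral_diff has_bochner_integral_minus
  has_bochner_integral_sum has_bochner_integral_mult_right has_bochner_integral_mult_left
  has_bochner_integral_inner_left hbi_const hbi_z hbi_F

lemma integral_sq_dev_z:
  "(\<integral>(s, z, F). (norm (z - w))\<^sup>2 \<partial>M) = (\<integral>(s, z, F). (norm z)\<^sup>2 \<partial>M) - 2 * (Z \<bullet> w) + (norm w)\<^sup>2"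
proof -
  have "hbi (\<lambda>y. (case y of (s, z, F) \<Rightarrow> (norm z)\<^sup>2) - 2 * (fst (snd y) \<bullet> w) + (norm w)\<^sup>2)
      ((\<integral>(s, z, F). (norm z)\<^sup>2 \<partial>M) - 2 * (Z \<bullet> w) + (norm w)\<^sup>2)"
    by (intro hbi_intros has_bochner_integral_integrable int_z2)
  from has_bochner_integral_integral_eq[OF this] show ?thesis
    by (simp add: case_prod_unfold power2_norm_eq_inner inner_diff_left inner_diff_right inner_commute algebra_simps)
qed

section \<open>Relative energy of a single measure\<close>

definition rel_energy :: "real^'d \<Rightarrow> real \<Rightarrow> real" where
  "rel_energy W r = 1/2 * (\<integral>(s, z, F). (norm (z - sqrt \<rho> *\<^sub>R W))\<^sup>2 \<partial>M) + Epot_rel \<gamma> \<rho> r"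

lemma integral_energy:
  "(\<integral>(s, z, F). 1/2 * (norm z)\<^sup>2 + Epot \<gamma> s \<partial>M) = 1/2 * (\<integral>(s, z, F). (norm z)\<^sup>2 \<partial>M) + Epot \<gamma> \<rho>"
proof -
  have "hbi (\<lambda>y. 1/2 * (case y of (s, z, F) \<Rightarrow> (norm z)\<^sup>2) + (case y of (s, z, F) \<Rightarrow> Epot \<gamma> s))
      (1/2 * (\<integral>(s, z, F). (norm z)\<^sup>2 \<partial>M) + (\<integral>(s, z, F). Epot \<gamma> s \<partial>M))"
    by (intro hbi_intros has_bochner_integral_integrable int_z2 int_Epot)
  then have "(\<integral>y. 1/2 * (case y of (s, z, F) \<Rightarrow> (norm z)\<^sup>2) + (case y of (s, z, F) \<Rightarrow> Epot \<gamma> s) \<partial>M)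
      = 1/2 * (\<integral>(s, z, F). (norm z)\<^sup>2 \<partial>M) + (\<integral>(s, z, F). Epot \<gamma> s \<partial>M)"
    by (rule has_bochner_integral_integral_eq)
  moreover have "(\<integral>(s, z, F). Epot \<gamma> s \<partial>M) = Epot \<gamma> \<rho>"
  proof -
    have "(\<integral>(s, z, F). Epot \<gamma> s \<partial>M) = (\<integral>y. Epot \<gamma> \<rho> \<partial>M)"
    proof (rule integral_cong_AE)
      show "(\<lambda>(s, z, F). Epot \<gamma> s) \<in> borel_measurable M"
        using int_Epot by (rule borel_measurable_integrable)
      show "AE y in M. (case y of (s, z, F) \<Rightarrow> Epot \<gamma> s) = Epot \<gamma> \<rho>"
        using AE_s_eq by eventually_elim auto
    qed simp
    then show ?thesis by (simp add: prob_space)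
  qed
  ultimately show ?thesis by (simp add: case_prod_unfold)
qed

lemma int_energy: "integrable M (\<lambda>(s, z, F). 1/2 * (norm z)\<^sup>2 + Epot \<gamma> s)"
  using int_z2 int_Epot by (simp add: case_prod_unfold)

text \<open>Each summand matches one balance: the energy inequality, the momentum equation tested
  with W, the continuity equation tested with |W|^2/2 - p(r), and a function of the strong solution
  alone.\<close>

lemma rel_energy_expand:
  "rel_energy W r = (\<integral>(s, z, F). 1/2 * (norm z)\<^sup>2 + Epot \<gamma> s \<partial>M)
    - sqrt \<rho> * (Z \<bullet> W) + \<rho> * (1/2 * (W \<bullet> W) - r powr \<gamma>) + (r * r powr \<gamma> - Epot \<gamma> r)"
  unfolding integral_energy rel_energy_def Epot_rel_def integral_sq_dev_z using rho_nonneg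
  by (simp add: power_mult_distrib power2_norm_eq_inner algebra_simps)

lemma rel_energy_parts:
  assumes "r > 0"
  shows "0 \<le> (\<integral>(s, z, F). (norm (z - sqrt \<rho> *\<^sub>R W))\<^sup>2 \<partial>M)" "0 \<le> Epot_rel \<gamma> \<rho> r" "0 \<le> rel_energy W r"
proof -
  show 1: "0 \<le> (\<integral>(s, z, F). (norm (z - sqrt \<rho> *\<^sub>R W))\<^sup>2 \<partial>M)"
    by (rule integral_nonneg_AE) auto
  show 2: "0 \<le> Epot_rel \<gamma> \<rho> r" using Epot_rel_nonneg gamma assms rho_nonneg by blast
  show "0 \<le> rel_energy W r" unfolding rel_energy_def using 1 2 by simp
qed

text \<open>Domination by the energy, needed for integrability of the relative energy and for the
  essential bound in Gronwall's lemma.\<close>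

lemma rel_energy_le:
  assumes r: "r > 0" and w: "norm W \<le> w" and c: "r powr \<gamma> * r \<le> c"
  shows "rel_energy W r \<le> (2 + w\<^sup>2 * (\<gamma> + 1)) * (\<integral>(s, z, F). 1/2 * (norm z)\<^sup>2 + Epot \<gamma> s \<partial>M) + w\<^sup>2 + c"
proof -
  define N where "N = (\<integral>(s, z, F). (norm z)\<^sup>2 \<partial>M)"
  have N0: "0 \<le> N" unfolding N_def by (rule integral_nonneg_AE) auto
  have E0: "0 \<le> Epot \<gamma> \<rho>" "0 \<le> Epot \<gamma> r" using Epot_eq gamma rho_nonneg r by auto
  have dev: "(\<integral>(s, z, F). (norm (z - c *\<^sub>R W))\<^sup>2 \<partial>M) = N - 2 * c * (Z \<bullet> W) + c\<^sup>2 * (W \<bullet> W)" for c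
    unfolding integral_sq_dev_z N_def by (simp add: power_mult_distrib power2_norm_eq_inner)
  \<comment> \<open>Parallelogram argument: nonnegativity of the deviation from the opposite vector
    bounds the mixed term.\<close>
  have "0 \<le> (\<integral>(s, z, F). (norm (z - (- sqrt \<rho>) *\<^sub>R W))\<^sup>2 \<partial>M)" by (rule integral_nonneg_AE) auto
  then have "1/2 * (\<integral>(s, z, F). (norm (z - sqrt \<rho> *\<^sub>R W))\<^sup>2 \<partial>M) \<le> N + \<rho> * (W \<bullet> W)"
    unfolding dev using rho_nonneg by (simp add: algebra_simps)
  moreover have "\<rho> * (W \<bullet> W) \<le> (1 + (\<gamma> + 1) * Epot \<gamma> \<rho>) * w\<^sup>2"
  proof (rule mult_mono)
    have "\<rho> \<le> 1 + \<rho> powr (\<gamma> + 1)"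
    proof (cases "\<rho> \<le> 1")
      case False
      then have "\<rho> powr 1 \<le> \<rho> powr (\<gamma> + 1)" using gamma by (intro powr_mono) auto
      then show ?thesis using rho_nonneg False by simp
    qed (simp add: add_increasing2)
    also have "\<rho> powr (\<gamma> + 1) = (\<gamma> + 1) * Epot \<gamma> \<rho>" using Epot_eq gamma rho_nonneg by simp
    finally show "\<rho> \<le> 1 + (\<gamma> + 1) * Epot \<gamma> \<rho>" .
    show "W \<bullet> W \<le> w\<^sup>2" using power_mono[OF w, of 2] by (simp add: power2_norm_eq_inner)
  qed (use gamma E0 in auto)
  moreover have "Epot_rel \<gamma> \<rho> r \<le> Epot \<gamma> \<rho> + c"
  proof -
    have "0 \<le> r powr \<gamma> * \<rho>" using rho_nonneg by simp
    then show ?thesis using E0 c unfolding Epot_rel_def by (simp add: algebra_simps)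
  qed
  ultimately have "rel_energy W r \<le> N + (1 + (\<gamma> + 1) * Epot \<gamma> \<rho>) * w\<^sup>2 + (Epot \<gamma> \<rho> + c)"
    unfolding rel_energy_def by linarith
  also have "\<dots> \<le> (2 + w\<^sup>2 * (\<gamma> + 1)) * (1/2 * N + Epot \<gamma> \<rho>) + w\<^sup>2 + c"
  proof -
    have "0 \<le> w\<^sup>2 * (\<gamma> + 1) * (1/2 * N)" using gamma N0 by simp
    then show ?thesis using E0 by (simp add: algebra_simps)
  qed
  finally show ?thesis unfolding integral_energy N_def .
qed

text \<open>Here \<open>A\<close> and \<open>a\<close> stand for the time derivatives of W and p(r),
  \<open>g\<close> for the gradient of \<psi>, \<open>B i j\<close> for the i-th derivative of W's
  j-th component and \<open>d\<close> for the divergence of sqrt r U. The bracket subtracted at the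
  end of the left side integrates to zero over the torus; it removes the parts linear in F and in
  the density, so that everything left is controlled by the relative energy.\<close>

lemma relative_energy_balance:
  fixes W h U A g :: "real^'d" and B :: "'d \<Rightarrow> 'd \<Rightarrow> real"
  assumes U: "U = W - h" and u: "norm U \<le> u"
    and B: "\<And>v. norm (\<chi> j. \<Sum>i\<in>UNIV. v $ i * B i j) \<le> \<beta> * norm v" and \<beta>: "\<beta> \<ge> 0"
    and A: "\<And>j. A $ j = - (\<Sum>i\<in>UNIV. U $ i * B i j)"
    and g: "\<And>i. g $ i = (\<Sum>j\<in>UNIV. W $ j * B i j) - h $ i"
    and r: "r > 0"
    and a: "a = - (\<gamma> * r powr (\<gamma> - 1/2)) * d - 1/2 * (h \<bullet> U)"
    and k: "\<bar>h \<bullet> U\<bar> \<le> k" and \<delta>: "\<bar>d\<bar> \<le> \<delta>"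
    and m: "r powr (- \<gamma>) \<le> m1" "\<gamma> / sqrt r \<le> m2"
  shows "- (\<integral>(s, z, F). (norm F)\<^sup>2 \<partial>M) + (\<integral>(s, z, F). z \<bullet> F \<partial>M)
      - (sqrt \<rho> * (Z \<bullet> A)
         + (\<Sum>i\<in>UNIV. \<Sum>j\<in>UNIV. (\<integral>(s, z, F). z $ j * z $ i \<partial>M) * B i j)
         - (\<Sum>i\<in>UNIV. \<Sum>j\<in>UNIV. (\<integral>(s, z, F). z $ j * F $ i \<partial>M) * B i j))
      + (\<rho> * (W \<bullet> A - a) + sqrt \<rho> * (Z \<bullet> g) - sqrt \<rho> * (G \<bullet> g)) + r * a
      - ((sqrt r * (G \<bullet> U) + Qfun \<gamma> \<rho> * d) - (r * (h \<bullet> U) + Qfun \<gamma> r * d))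
    \<le> (2 * (\<beta> + (1 + \<beta>)\<^sup>2) + (2 * u\<^sup>2 + k) * m1 + \<delta> * m2) * rel_energy W r
      - 1/2 * (\<integral>(s, z, F). (norm (F - sqrt \<rho> *\<^sub>R h))\<^sup>2 \<partial>M)"
    (is "?I - ?J \<le> ?C * _ - _")
proof -
  define b where "b v = (\<chi> j. \<Sum>i\<in>UNIV. v $ i * B i j)" for v :: "real^'d"
  define q where "q = sqrt \<rho>"
  have q2: "q\<^sup>2 = \<rho>" using rho_nonneg by (simp add: q_def)
  have lin: "linear b"
    by (rule linearI) (auto simp: b_def vec_eq_iff algebra_simps sum.distrib sum_distrib_left)
  have A': "A = - b U" by (simp add: vec_eq_iff b_def A)
  have inner_b: "v \<bullet> b w = (\<Sum>i\<in>UNIV. \<Sum>j\<in>UNIV. (v $ j * w $ i) * B i j)" for v w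
    unfolding b_def inner_vec_def
    by (simp add: sum_distrib_left mult.assoc) (rule sum.swap)
  have g': "v \<bullet> g = W \<bullet> b v - v \<bullet> h" for v
    unfolding inner_b by (simp add: inner_vec_def g algebra_simps sum_subtractf sum_distrib_left)
  let ?i = "\<lambda>y. - (case y of (s, z, F) \<Rightarrow> (norm F)\<^sup>2) + (case y of (s, z, F) \<Rightarrow> z \<bullet> F)
      - (q * (fst (snd y) \<bullet> A)
         + (\<Sum>i\<in>UNIV. \<Sum>j\<in>UNIV. (case y of (s, z, F) \<Rightarrow> z $ j * z $ i) * B i j)
         - (\<Sum>i\<in>UNIV. \<Sum>j\<in>UNIV. (case y of (s, z, F) \<Rightarrow> z $ j * F $ i) * B i j))
      + (\<rho> * (W \<bullet> A - a) + q * (fst (snd y) \<bullet> g) - q * (snd (snd y) \<bullet> g)) + r * a"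
  have lhs: "hbi ?i ?I"
    unfolding q_def
    by (intro hbi_intros has_bochner_integral_integrable int_F2 int_z_inner_F int_zz int_zF)
  let ?k = "\<lambda>y. (\<beta> + (1 + \<beta>)\<^sup>2) * (case y of (s, z, F) \<Rightarrow> (norm (z - sqrt \<rho> *\<^sub>R W))\<^sup>2)
      - 1/2 * (case y of (s, z, F) \<Rightarrow> (norm (F - sqrt \<rho> *\<^sub>R h))\<^sup>2)
      + u\<^sup>2 * (q - sqrt r)\<^sup>2 + sqrt r * (snd (snd y) \<bullet> U) - sqrt r * q * (h \<bullet> U) - (\<rho> - r) * a"
  let ?K = "(\<beta> + (1 + \<beta>)\<^sup>2) * (\<integral>(s, z, F). (norm (z - sqrt \<rho> *\<^sub>R W))\<^sup>2 \<partial>M)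
      - 1/2 * (\<integral>(s, z, F). (norm (F - sqrt \<rho> *\<^sub>R h))\<^sup>2 \<partial>M)
      + u\<^sup>2 * (q - sqrt r)\<^sup>2 + sqrt r * (G \<bullet> U) - sqrt r * q * (h \<bullet> U) - (\<rho> - r) * a"
  have rhs: "hbi ?k ?K"
    by (intro hbi_intros has_bochner_integral_integrable int_sq_dev_z int_sq_dev_F)
  have "?i y \<le> ?k y" for y
  proof -
    obtain s z F where y: "y = (s, z, F)" by (cases y)
    have "?i y = - (F \<bullet> F) + z \<bullet> F - (q * (z \<bullet> (- b U)) + z \<bullet> b z - z \<bullet> b F)
        + q\<^sup>2 * (W \<bullet> (- b U) - a) + q * (W \<bullet> b (z - F) - (z - F) \<bullet> h) + r * a"
      unfolding y A'[symmetric] q2 g' inner_b[of z z, symmetric] inner_b[of z F, symmetric] prod.case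
        linear_diff[OF lin] fst_conv snd_conv
      by (simp add: power2_norm_eq_inner inner_diff_left inner_diff_right algebra_simps)
    also have "\<dots> \<le> ?k y"
      using relative_energy_pointwise[OF lin _ \<beta> U u, of F z q a r "sqrt r"] B
      unfolding y b_def[symmetric] by (simp add: q2 q_def[symmetric])
    finally show ?thesis .
  qed
  then have "?I \<le> ?K"
    using integral_mono[of M ?i ?k] lhs rhs unfolding has_bochner_integral_iff by metis
  \<comment> \<open>With s = sqrt r, the multiples of h \<bullet> U complete the square: -s q + (q^2
    - s^2)/2 + s^2 = (q - s)^2/2. The multiples of d combine to the Bregman distance of Q.\<close>
  moreover have "?K - ?J = (\<beta> + (1 + \<beta>)\<^sup>2) * (\<integral>(s, z, F). (norm (z - sqrt \<rho> *\<^sub>R W))\<^sup>2 \<partial>M)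
      - 1/2 * (\<integral>(s, z, F). (norm (F - sqrt \<rho> *\<^sub>R h))\<^sup>2 \<partial>M)
      + (u\<^sup>2 + 1/2 * (h \<bullet> U)) * (q - sqrt r)\<^sup>2 - d * Qfun_rel \<gamma> \<rho> r"
  proof -
    have r2: "r = (sqrt r)\<^sup>2" using r by simp
    have alg: "- (s * q * x) - (q\<^sup>2 - s\<^sup>2) * (- Q' * d - 1/2 * x) - (Qr * d - (s\<^sup>2 * x + Qb * d))
      = 1/2 * x * (q - s)\<^sup>2 - d * (Qr - Qb - Q' * (q\<^sup>2 - s\<^sup>2))" for s x Q' Qr Qb :: real
      by (simp add: power2_eq_square field_simps)
    show ?thesis
      using alg[of "sqrt r" "h \<bullet> U" "\<gamma> * r powr (\<gamma> - 1/2)" "Qfun \<gamma> \<rho>" "Qfun \<gamma> r"] r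
      unfolding a Qfun_rel_def q2 by (simp add: algebra_simps)
  qed
  moreover have "(u\<^sup>2 + 1/2 * (h \<bullet> U)) * (q - sqrt r)\<^sup>2 \<le> (2 * u\<^sup>2 + k) * m1 * Epot_rel \<gamma> \<rho> r"
  proof -
    have k0: "k \<ge> 0" using k by linarith
    have "(u\<^sup>2 + 1/2 * (h \<bullet> U)) * (q - sqrt r)\<^sup>2 \<le> (u\<^sup>2 + 1/2 * k) * (q - sqrt r)\<^sup>2"
      using k by (intro mult_right_mono) auto
    also have "\<dots> \<le> (u\<^sup>2 + 1/2 * k) * (2 * r powr (- \<gamma>) * Epot_rel \<gamma> \<rho> r)"
      unfolding q_def using k0 sqrt_diff_sq_le_Epot_rel[OF gamma r rho_nonneg]
      by (intro mult_left_mono) auto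
    also have "\<dots> = (2 * u\<^sup>2 + k) * r powr (- \<gamma>) * Epot_rel \<gamma> \<rho> r" by (simp add: algebra_simps)
    also have "\<dots> \<le> (2 * u\<^sup>2 + k) * m1 * Epot_rel \<gamma> \<rho> r"
      using k0 m rel_energy_parts[OF r] by (intro mult_right_mono mult_left_mono) auto
    finally show ?thesis .
  qed
  moreover have "- (d * Qfun_rel \<gamma> \<rho> r) \<le> \<delta> * m2 * Epot_rel \<gamma> \<rho> r"
  proof -
    note Q = Qfun_rel_nonneg[OF gamma r rho_nonneg] Qfun_rel_le[OF gamma r rho_nonneg]
    have "- (d * Qfun_rel \<gamma> \<rho> r) \<le> \<delta> * Qfun_rel \<gamma> \<rho> r"
      using mult_right_mono[of "- d" \<delta>, OF _ Q(1)] \<delta> by auto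
    also have "\<dots> \<le> \<delta> * (\<gamma> / sqrt r * Epot_rel \<gamma> \<rho> r)" using \<delta> Q by (intro mult_left_mono) auto
    also have "\<dots> \<le> \<delta> * (m2 * Epot_rel \<gamma> \<rho> r)"
      using \<delta> m rel_energy_parts[OF r] by (intro mult_left_mono mult_right_mono) auto
    finally show ?thesis by simp
  qed
  \<comment> \<open>The coefficient of the velocity deviation is doubled because
    \<open>rel_energy\<close> weights that deviation by 1/2.\<close>
  moreover have "?C * rel_energy W r \<ge> (\<beta> + (1 + \<beta>)\<^sup>2) * (\<integral>(s, z, F). (norm (z - sqrt \<rho> *\<^sub>R W))\<^sup>2 \<partial>M)
      + (2 * u\<^sup>2 + k) * m1 * Epot_rel \<gamma> \<rho> r + \<delta> * m2 * Epot_rel \<gamma> \<rho> r"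
  proof -
    have "0 \<le> m1" using m(1) powr_ge_zero[of r "- \<gamma>"] by linarith
    have "0 \<le> m2" using m(2) gamma r order_trans[of 0 "\<gamma> / sqrt r" m2] by simp
    have "k \<ge> 0" "\<delta> \<ge> 0" using k \<delta> by auto
    define X where "X = (\<integral>(s, z, F). (norm (z - sqrt \<rho> *\<^sub>R W))\<^sup>2 \<partial>M)"
    define Y where "Y = Epot_rel \<gamma> \<rho> r"
    define c1 where "c1 = \<beta> + (1 + \<beta>)\<^sup>2"
    define c2 where "c2 = (2 * u\<^sup>2 + k) * m1"
    define c3 where "c3 = \<delta> * m2"
    have "0 \<le> X" "0 \<le> Y" using rel_energy_parts[OF r] by (auto simp: X_def Y_def)
    moreover have "0 \<le> c1" "0 \<le> c2" "0 \<le> c3"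
      using \<beta> \<open>0 \<le> m1\<close> \<open>0 \<le> m2\<close> \<open>k \<ge> 0\<close> \<open>\<delta> \<ge> 0\<close> by (auto simp: c1_def c2_def c3_def)
    ultimately have "0 \<le> c1 * Y" "0 \<le> c2 * X" "0 \<le> c3 * X" by auto
    then have "c1 * X + c2 * Y + c3 * Y \<le> (2 * c1 + c2 + c3) * (1/2 * X + Y)"
      by (simp add: algebra_simps)
    then show ?thesis
      unfolding rel_energy_def X_def Y_def c1_def c2_def c3_def .
  qed
  ultimately show ?thesis by linarith
qed

text \<open>Zero Bregman distance gives \<rho> = r, and s = \<rho> almost surely; the other two
  coordinates have vanishing mean square deviation from the stated vectors.\<close>

lemma eq_return:
  assumes "r > 0" "rel_energy W r = 0" "(\<integral>(s, z, F). (norm (F - sqrt \<rho> *\<^sub>R h))\<^sup>2 \<partial>M) = 0"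
  shows "M = return phase_borel (r, sqrt r *\<^sub>R W, sqrt r *\<^sub>R h)"
proof -
  note p = rel_energy_parts[OF assms(1)]
  have "Epot_rel \<gamma> \<rho> r = 0" and Z0: "(\<integral>(s, z, F). (norm (z - sqrt \<rho> *\<^sub>R W))\<^sup>2 \<partial>M) = 0"
    using assms(2) p(1)[of W] p(2) unfolding rel_energy_def by linarith+
  then have \<rho>r: "\<rho> = r" using Epot_rel_eq_0D gamma assms(1) rho_nonneg by blast
  have "AE (s, z, F) in M. (norm (z - sqrt \<rho> *\<^sub>R W))\<^sup>2 = 0"
    using integral_nonneg_eq_0_iff_AE[OF int_sq_dev_z] Z0 by (simp add: case_prod_unfold)
  moreover have "AE (s, z, F) in M. (norm (F - sqrt \<rho> *\<^sub>R h))\<^sup>2 = 0"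
    using integral_nonneg_eq_0_iff_AE[OF int_sq_dev_F] assms(3) by (simp add: case_prod_unfold)
  ultimately have "AE y in M. y = (r, sqrt r *\<^sub>R W, sqrt r *\<^sub>R h)"
    using AE_s_eq by eventually_elim (auto simp: \<rho>r)
  then show ?thesis
    using prob_space_axioms sets_M assms(1)
    by (intro prob_space_eq_return) (auto simp: space_restrict_space phase_space_def)
qed

end

section \<open>The strong solution\<close>

lemma pres_has_derivative: "y > 0 \<Longrightarrow> (pres \<gamma> has_real_derivative \<gamma> * y powr (\<gamma> - 1)) (at y)"
  unfolding pres_def[abs_def] by (rule has_real_derivative_powr)

locale strong_flow =
  fixes \<gamma> T :: real and r :: "real \<Rightarrow> real^'d \<Rightarrow> real" and W :: "real \<Rightarrow> real^'d \<Rightarrow> real^'d"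
  assumes gamma: "\<gamma> \<ge> 1" and T: "T > 0" and strong: "strong_solution \<gamma> T r W"
    and regular: "C1_C2 T r" "C1_C2 T W"
    and positive: "\<And>t x. t \<in> {0..T} \<Longrightarrow> r t x > 0"
begin

definition h :: "real \<Rightarrow> real^'d \<Rightarrow> real^'d" where "h t x = (\<chi> i. pd i (\<lambda>y. pres \<gamma> (r t y)) x)"
definition U :: "real \<Rightarrow> real^'d \<Rightarrow> real^'d" where "U t x = W t x - h t x"
text \<open>Components of the field sqrt r U, against which the weak gradient of Q(\<rho>) is
  tested; \<open>dv\<close> is its divergence.\<close>

definition \<phi> :: "'d \<Rightarrow> real \<Rightarrow> real^'d \<Rightarrow> real" where "\<phi> i t x = sqrt (r t x) * U t x $ i"
definition dv :: "real \<Rightarrow> real^'d \<Rightarrow> real" where "dv t x = (\<Sum>i\<in>UNIV. pd i (\<phi> i t) x)"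
definition \<psi> :: "real \<Rightarrow> real^'d \<Rightarrow> real" where "\<psi> t x = 1/2 * (W t x \<bullet> W t x) - pres \<gamma> (r t x)"
text \<open>The density-free term in the expansion of the relative energy.\<close>

definition P :: "real \<Rightarrow> real^'d \<Rightarrow> real" where "P t x = r t x * pres \<gamma> (r t x) - Epot \<gamma> (r t x)"
definition Qr :: "real \<Rightarrow> real^'d \<Rightarrow> real" where "Qr t x = Qfun \<gamma> (r t x)"
definition pt :: "real \<Rightarrow> real^'d \<Rightarrow> real" where "pt t x = tderiv T (\<lambda>t x. pres \<gamma> (r t x)) t x"

section \<open>Regularity of the derived fields\<close>

lemma rC: "C1_space_time T r" and rC': "space_C1 T (\<lambda>t. pd i (r t))"
  and WC: "C1_space_time T W"
  using C1_C2_regularity[OF regular(1) T] C1_C2_regularity[OF regular(2) T] by auto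

lemmas rS = C1_space_time_space_C1[OF rC] and WS = C1_space_time_space_C1[OF WC]

lemma cont_powr: "continuous_on {0<..} (\<lambda>y::real. c * y powr b)"
  by (intro continuous_intros) auto

lemma pC: "C1_space_time T (\<lambda>t x. pres \<gamma> (r t x))"
  and pt_eq: "t \<in> {0..T} \<Longrightarrow> pt t x = \<gamma> * r t x powr (\<gamma> - 1) * tderiv T r t x"
  using C1_space_time_compose[OF T rC positive pres_has_derivative cont_powr] unfolding pt_def by auto

lemmas pS = C1_space_time_space_C1[OF pC]

lemma h_eq: "t \<in> {0..T} \<Longrightarrow> h t x $ i = \<gamma> * r t x powr (\<gamma> - 1) * pd i (r t) x"
  unfolding h_def by (simp add: pd_compose[OF space_C1_differentiable[OF rS] pres_has_derivative[OF positive]])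

text \<open>The second spatial derivatives of r are needed here: by the chain rule h is a smooth
  function of r times the gradient of r, hence C1 in space.\<close>

lemma hS: "space_C1 T (\<lambda>t x. h t x $ i)"
proof (rule space_C1_cong)
  have "((\<lambda>y. \<gamma> * y powr (\<gamma> - 1)) has_real_derivative \<gamma> * ((\<gamma> - 1) * y powr (\<gamma> - 1 - 1))) (at y)"
    if "y > 0" for y
    using that by (intro DERIV_cmult has_real_derivative_powr)
  from space_C1_compose[OF rS positive this]
  have "space_C1 T (\<lambda>t x. \<gamma> * r t x powr (\<gamma> - 1))"
    using cont_powr[of "\<gamma> * (\<gamma> - 1)"] by (simp add: mult.assoc)
  from space_C1_mult[OF this rC']
  show "space_C1 T (\<lambda>t x. \<gamma> * r t x powr (\<gamma> - 1) * pd i (r t) x)" .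
qed (simp add: h_eq)

lemma WSi: "space_C1 T (\<lambda>t x. W t x $ i)"
  by (rule space_C1_linear[OF bounded_linear_vec_nth WS])

lemma US: "space_C1 T (\<lambda>t x. U t x $ i)"
  using space_C1_diff[OF WSi hS] by (simp add: U_def)

lemma sqrt_deriv: "y > 0 \<Longrightarrow> (sqrt has_real_derivative inverse (sqrt y) / 2) (at y)"
  by (rule DERIV_real_sqrt)

lemma sqrtS: "space_C1 T (\<lambda>t x. sqrt (r t x))"
  by (rule space_C1_compose[OF rS positive sqrt_deriv]) (auto intro!: continuous_intros)

lemma phiS: "space_C1 T (\<phi> i)"
  unfolding \<phi>_def[abs_def] by (rule space_C1_mult[OF sqrtS US])

lemma QrS: "space_C1 T Qr"
  unfolding Qr_def[abs_def]
  by (rule space_C1_compose[OF rS positive Qfun_has_derivative'[OF gamma] cont_powr])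

lemma psiC: "C1_space_time T \<psi>"
  and psi_t: "t \<in> {0..T} \<Longrightarrow> tderiv T \<psi> t x = W t x \<bullet> tderiv T W t x - pt t x"
proof -
  note w = C1_space_time_bilinear[OF T bounded_bilinear_inner WC WC]
  note w2 = C1_space_time_linear[OF T bounded_linear_mult_right[of "1/2"] w(1)]
  note p = C1_space_time_diff[OF T w2(1) pC]
  show "C1_space_time T \<psi>" unfolding \<psi>_def[abs_def] by (rule p(1))
  assume t: "t \<in> {0..T}"
  show "tderiv T \<psi> t x = W t x \<bullet> tderiv T W t x - pt t x"
    unfolding \<psi>_def[abs_def] p(2)[OF t] w2(2)[OF t] w(2)[OF t] pt_def by (simp add: inner_commute)
qed

lemma psi_grad: "t \<in> {0..T} \<Longrightarrow> grad (\<psi> t) x $ i = (\<Sum>j\<in>UNIV. W t x $ j * pd i (W t) x $ j) - h t x $ i"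
proof -
  assume t: "t \<in> {0..T}"
  note dW = space_C1_differentiable[OF WS t]
  have ww: "space_C1 T (\<lambda>t x. W t x \<bullet> W t x)" by (rule space_C1_bilinear[OF bounded_bilinear_inner WS WS])
  have ww2: "space_C1 T (\<lambda>t x. 1/2 * (W t x \<bullet> W t x))"
    by (rule space_C1_linear[OF bounded_linear_mult_right ww])
  have "pd i (\<psi> t) x = pd i (\<lambda>x. 1/2 * (W t x \<bullet> W t x)) x - pd i (\<lambda>x. pres \<gamma> (r t x)) x"
    unfolding \<psi>_def[abs_def]
    by (rule pd_diff[OF space_C1_differentiable[OF ww2 t] space_C1_differentiable[OF pS t]])
  also have "pd i (\<lambda>x. 1/2 * (W t x \<bullet> W t x)) x = 1/2 * pd i (\<lambda>x. W t x \<bullet> W t x) x"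
    by (rule pd_linear[OF bounded_linear_mult_right space_C1_differentiable[OF ww t]])
  also have "pd i (\<lambda>x. W t x \<bullet> W t x) x = W t x \<bullet> pd i (W t) x + pd i (W t) x \<bullet> W t x"
    by (rule pd_bilinear[OF bounded_bilinear_inner dW dW])
  finally show ?thesis by (simp add: grad_def h_def inner_commute inner_vec_def)
qed

text \<open>As E' = p, the two multiples of the time derivative of r cancel. This is the summand
  \<open>r * a\<close> of \<open>relative_energy_balance\<close>.\<close>

lemma PC: "C1_space_time T P"
  and P_t: "t \<in> {0..T} \<Longrightarrow> tderiv T P t x = r t x * pt t x"
proof -
  have *: "continuous_on {0<..} (\<lambda>y::real. y powr \<gamma>)" using cont_powr[of 1 \<gamma>] by simp
  have e: "C1_space_time T (\<lambda>t x. Epot \<gamma> (r t x))"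
    by (rule C1_space_time_compose(1)[OF T rC _ _ *]) (auto intro: positive Epot_has_derivative gamma)
  have e': "tderiv T (\<lambda>t x. Epot \<gamma> (r t x)) t x = r t x powr \<gamma> * tderiv T r t x" if "t \<in> {0..T}"
    by (rule C1_space_time_compose(2)[OF T rC _ _ * that]) (auto intro: positive Epot_has_derivative gamma)
  note w = C1_space_time_bilinear[OF T bounded_bilinear_mult rC pC]
  note p = C1_space_time_diff[OF T w(1) e]
  show "C1_space_time T P" unfolding P_def[abs_def] by (rule p(1))
  assume t: "t \<in> {0..T}"
  show "tderiv T P t x = r t x * pt t x"
    unfolding P_def[abs_def] p(2)[OF t] w(2)[OF t] e'[OF t] pt_def by (simp add: pres_def)
qed

text \<open>Since Q'(r) = sqrt r p'(r), the gradient of Q(r) is sqrt r h, the point to which the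
  third coordinate collapses.\<close>

lemma Qr_grad: "t \<in> {0..T} \<Longrightarrow> pd i (Qr t) x = sqrt (r t x) * h t x $ i"
proof -
  assume t: "t \<in> {0..T}"
  have s: "r t x powr (\<gamma> - 1/2) = sqrt (r t x) * r t x powr (\<gamma> - 1)"
    by (rule sqrt_mult_powr[symmetric, OF positive[OF t]])
  show ?thesis
    unfolding Qr_def[abs_def] h_eq[OF t]
      pd_compose[OF space_C1_differentiable[OF rS t] Qfun_has_derivative'[OF gamma positive[OF t]]] s
    by simp
qed

section \<open>The strong equations in terms of the effective velocity \<open>U\<close>\<close>

lemma continuity_eq:
  assumes t: "t \<in> {0<..<T}"
  shows "tderiv T r t x = - (\<Sum>i\<in>UNIV. r t x * pd i (\<lambda>x. U t x $ i) x + pd i (r t) x * U t x $ i)"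
proof -
  have t': "t \<in> {0..T}" using t by auto
  note d = space_C1_differentiable[OF _ t', where x = x]
  have 1: "pd i (\<lambda>x. r t x * W t x $ i) x = r t x * pd i (\<lambda>x. W t x $ i) x + pd i (r t) x * W t x $ i" for i
    by (rule pd_mult[OF d[OF rS] d[OF WSi]])
  have 2: "pd i (\<lambda>x. r t x * pd i (\<lambda>x. pres \<gamma> (r t x)) x) x
      = r t x * pd i (\<lambda>x. h t x $ i) x + pd i (r t) x * h t x $ i" for i
    using pd_mult[OF d[OF rS] d[OF hS], of i i] by (simp add: h_def)
  have 3: "pd i (\<lambda>x. U t x $ i) x = pd i (\<lambda>x. W t x $ i) x - pd i (\<lambda>x. h t x $ i) x" for i
    using pd_diff[OF d[OF WSi] d[OF hS], of i i i] by (simp add: U_def)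
  have "tderiv T r t x + (\<Sum>i\<in>UNIV. pd i (\<lambda>x. r t x * W t x $ i) x)
      - (\<Sum>i\<in>UNIV. pd i (\<lambda>x. r t x * pd i (\<lambda>x. pres \<gamma> (r t x)) x) x) = 0"
    using strong t unfolding strong_solution_def by blast
  then show ?thesis
    unfolding 1 2 3 unfolding U_def by (simp add: sum.distrib sum_subtractf sum_negf algebra_simps)
qed

text \<open>Subtracting the continuity equation times the component of W from the momentum equation
  leaves r times a pure transport equation along U; positivity of r allows division.\<close>

lemma transport_eq:
  assumes t: "t \<in> {0<..<T}"
  shows "tderiv T W t x $ j = - (\<Sum>i\<in>UNIV. U t x $ i * pd i (W t) x $ j)"
proof -
  have t': "t \<in> {0..T}" using t by auto
  note d = space_C1_differentiable[OF _ t', where x = x]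
  note wj = C1_space_time_linear[OF T bounded_linear_vec_nth[of j] WC]
  have rW: "space_C1 T (\<lambda>t x. r t x * W t x $ i)" for i by (rule space_C1_mult[OF rS WSi])
  have rh: "space_C1 T (\<lambda>t x. r t x * h t x $ i)" for i by (rule space_C1_mult[OF rS hS])
  have Wj: "pd i (\<lambda>x. W t x $ j) x = pd i (W t) x $ j" for i
    by (rule pd_linear[OF bounded_linear_vec_nth d[OF WS]])
  have 0: "tderiv T (\<lambda>t x. r t x * W t x $ j) t x
      = r t x * tderiv T W t x $ j + tderiv T r t x * W t x $ j"
    using C1_space_time_bilinear(2)[OF T bounded_bilinear_mult rC wj(1) t'] wj(2)[OF t'] by simp
  have 1: "pd i (\<lambda>x. r t x * W t x $ i * W t x $ j) x
      = r t x * W t x $ i * pd i (W t) x $ j + (r t x * pd i (\<lambda>x. W t x $ i) x + pd i (r t) x * W t x $ i) * W t x $ j" for i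
    using pd_mult[OF d[OF rW] d[OF WSi], of i i j] pd_mult[OF d[OF rS] d[OF WSi], of i i] by (simp add: Wj)
  have 2: "pd i (\<lambda>x. r t x * pd i (\<lambda>x. pres \<gamma> (r t x)) x * W t x $ j) x
      = r t x * h t x $ i * pd i (W t) x $ j + (r t x * pd i (\<lambda>x. h t x $ i) x + pd i (r t) x * h t x $ i) * W t x $ j" for i
    using pd_mult[OF d[OF rh] d[OF WSi], of i i j] pd_mult[OF d[OF rS] d[OF hS], of i i] by (simp add: Wj h_def)
  have 3: "pd i (\<lambda>x. U t x $ i) x = pd i (\<lambda>x. W t x $ i) x - pd i (\<lambda>x. h t x $ i) x" for i
    using pd_diff[OF d[OF WSi] d[OF hS], of i i i] by (simp add: U_def)
  have "tderiv T (\<lambda>t x. r t x * W t x $ j) t x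
        + (\<Sum>i\<in>UNIV. pd i (\<lambda>x. r t x * W t x $ i * W t x $ j) x)
      = (\<Sum>i\<in>UNIV. pd i (\<lambda>x. r t x * pd i (\<lambda>x. pres \<gamma> (r t x)) x * W t x $ j) x)"
    using strong t unfolding strong_solution_def by blast
  then have "r t x * tderiv T W t x $ j + tderiv T r t x * W t x $ j
      + (\<Sum>i\<in>UNIV. r t x * (U t x $ i * pd i (W t) x $ j)
          + (r t x * pd i (\<lambda>x. U t x $ i) x + pd i (r t) x * U t x $ i) * W t x $ j) = 0"
    unfolding 0 1 2 3 unfolding U_def by (simp add: sum.distrib sum_subtractf algebra_simps)
  then have "r t x * (tderiv T W t x $ j + (\<Sum>i\<in>UNIV. U t x $ i * pd i (W t) x $ j)) = 0"
    unfolding continuity_eq[OF t] by (simp add: sum.distrib sum_distrib_left sum_distrib_right algebra_simps)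
  then show ?thesis using positive[OF t', of x] by simp
qed

text \<open>The continuity equation is multiplied by p'(r). Expressed through the divergence of sqrt
  r U, only half of the drift h \<bullet> U is accounted for, because the derivative of the square
  root carries a factor 1/2; the other half stays as a separate term.\<close>

lemma pressure_eq:
  assumes t: "t \<in> {0<..<T}"
  shows "pt t x = - (\<gamma> * r t x powr (\<gamma> - 1/2)) * dv t x - 1/2 * (h t x \<bullet> U t x)"
proof -
  have t': "t \<in> {0..T}" using t by auto
  note d = space_C1_differentiable[OF _ t', where x = x]
  define s where "s = sqrt (r t x)"
  have s: "s > 0" "r t x = s * s" using positive[OF t', of x] by (auto simp: s_def)
  define c where "c = \<gamma> * r t x powr (\<gamma> - 1)"
  have q: "sqrt (r t x) * r t x powr (\<gamma> - 1) = r t x powr (\<gamma> - 1/2)"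
    by (rule sqrt_mult_powr[OF positive[OF t']])
  have c': "\<gamma> * r t x powr (\<gamma> - 1/2) = c * s" unfolding c_def s_def q[symmetric] by simp
  have 1: "pd i (\<phi> i t) x = s * pd i (\<lambda>x. U t x $ i) x + (inverse s / 2 * pd i (r t) x) * U t x $ i" for i
    using pd_mult[OF d[OF sqrtS] d[OF US], of i i] pd_compose[OF d[OF rS] sqrt_deriv[OF positive[OF t']], of i]
    unfolding \<phi>_def[abs_def] s_def by simp
  have "c * s * dv t x = (\<Sum>i\<in>UNIV. c * (r t x * pd i (\<lambda>x. U t x $ i) x) + 1/2 * (c * pd i (r t) x * U t x $ i))"
    unfolding dv_def 1 sum_distrib_left s(2) using s(1) by (intro sum.cong refl) (simp add: field_simps)
  moreover have "h t x \<bullet> U t x = (\<Sum>i\<in>UNIV. c * pd i (r t) x * U t x $ i)"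
    by (simp add: inner_vec_def h_eq[OF t'] c_def)
  ultimately have "- (c * s) * dv t x - 1/2 * (h t x \<bullet> U t x)
      = - (c * (\<Sum>i\<in>UNIV. r t x * pd i (\<lambda>x. U t x $ i) x + pd i (r t) x * U t x $ i))"
    by (simp add: sum.distrib sum_distrib_left algebra_simps sum_divide_distrib[symmetric])
  then show ?thesis
    unfolding c' pt_eq[OF t'] continuity_eq[OF t] c_def[symmetric] by simp
qed

text \<open>Compactness of \<open>{0..T}\<close> times the unit cube. That r stays away from zero
  enters through the upper bounds for its negative powers.\<close>

lemma bounds:
  obtains K where "K > 0"
    "\<And>t x. t \<in> {0..T} \<Longrightarrow> norm (W t x) \<le> K" "\<And>t x. t \<in> {0..T} \<Longrightarrow> norm (tderiv T W t x) \<le> K"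
    "\<And>t x i. t \<in> {0..T} \<Longrightarrow> norm (pd i (W t) x) \<le> K"
    "\<And>t x. t \<in> {0..T} \<Longrightarrow> norm (U t x) \<le> K" "\<And>t x. t \<in> {0..T} \<Longrightarrow> \<bar>h t x \<bullet> U t x\<bar> \<le> K"
    "\<And>t x. t \<in> {0..T} \<Longrightarrow> \<bar>dv t x\<bar> \<le> K" "\<And>t x i. t \<in> {0..T} \<Longrightarrow> \<bar>\<phi> i t x\<bar> \<le> K"
    "\<And>t x i. t \<in> {0..T} \<Longrightarrow> \<bar>pd i (\<phi> i t) x\<bar> \<le> K"
    "\<And>t x. t \<in> {0..T} \<Longrightarrow> r t x powr (- \<gamma>) \<le> K" "\<And>t x. t \<in> {0..T} \<Longrightarrow> \<gamma> / sqrt (r t x) \<le> K"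
    "\<And>t x. t \<in> {0..T} \<Longrightarrow> r t x powr \<gamma> * r t x \<le> K"
    "\<And>t x v. t \<in> {0..T} \<Longrightarrow> norm (\<chi> j. \<Sum>i\<in>UNIV. v $ i * pd i (W t) x $ j) \<le> K * norm v"
proof -
  have ex: "\<exists>B>0. \<forall>t\<in>{0..T}. \<forall>x. norm (f t x) \<le> B" if "space_C1 T f" for f :: "real \<Rightarrow> real^'d \<Rightarrow> 'c::real_normed_vector"
    using space_C1_bounded[OF that] by blast
  have exi: "\<exists>B>0. \<forall>t\<in>{0..T}. \<forall>x i. norm (f i t x) \<le> B" if f: "\<And>i. space_C1 T (f i)" for f :: "'d \<Rightarrow> real \<Rightarrow> real^'d \<Rightarrow> real"
  proof -
    obtain B where B: "\<And>i. B i > 0" "\<And>i t x. t \<in> {0..T} \<Longrightarrow> norm (f i t x) \<le> B i"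
      using ex[OF f] by metis
    have "norm (f i t x) \<le> (\<Sum>i\<in>UNIV. B i)" if "t \<in> {0..T}" for i t x
      using B(2)[OF that, of i x] member_le_sum[of i UNIV B] B(1) by (auto simp: less_imp_le intro: order_trans)
    moreover have "(\<Sum>i\<in>UNIV. B i) > 0" using B(1) by (intro sum_pos) auto
    ultimately show ?thesis by blast
  qed
  obtain K1 where K1: "K1 > 0" "\<And>t x. t \<in> {0..T} \<Longrightarrow> norm (W t x) \<le> K1" using ex[OF WS] by blast
  have perW: "\<And>t. t \<in> {0..T} \<Longrightarrow> periodic (W t)" using WS by (simp add: space_C1_def)
  obtain K2 where K2: "K2 > 0" "\<And>t x. t \<in> {0..T} \<Longrightarrow> norm (tderiv T W t x) \<le> K2"
    using periodic_bounded[OF periodic_tderiv[OF perW] C1_space_time_continuous_tderiv[OF WC]] by blast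
  obtain K3 where K3: "K3 > 0" "\<And>t x i. t \<in> {0..T} \<Longrightarrow> norm (pd i (W t) x) \<le> K3"
    using space_C1_bounded_pd[OF WS] by blast
  obtain K4 where K4: "K4 > 0" "\<And>t x i. t \<in> {0..T} \<Longrightarrow> norm (U t x $ i) \<le> K4" using exi[of "\<lambda>i t x. U t x $ i", OF US] by blast
  obtain K5 where K5: "K5 > 0" "\<And>t x i. t \<in> {0..T} \<Longrightarrow> norm (h t x $ i) \<le> K5" using exi[of "\<lambda>i t x. h t x $ i", OF hS] by blast
  obtain K6 where K6: "K6 > 0" "\<And>t x i. t \<in> {0..T} \<Longrightarrow> norm (\<phi> i t x) \<le> K6" using exi[of \<phi>, OF phiS] by blast
  have "\<exists>B>0. \<forall>t\<in>{0..T}. \<forall>x j. norm (pd j (\<phi> i t) x) \<le> B" for i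
    using space_C1_bounded_pd[OF phiS, of i] by metis
  then obtain B where B: "\<And>i. B i > 0" "\<And>i j t x. t \<in> {0..T} \<Longrightarrow> norm (pd j (\<phi> i t) x) \<le> B i" by metis
  define K7 where "K7 = (\<Sum>i\<in>UNIV. B i)"
  have K7: "norm (pd i (\<phi> i t) x) \<le> K7" "norm (dv t x) \<le> K7" if "t \<in> {0..T}" for i t x
  proof -
    show "norm (pd i (\<phi> i t) x) \<le> K7"
      using B(2)[OF that, of i i x] member_le_sum[of i UNIV B] B(1)
      by (auto simp: K7_def less_imp_le intro: order_trans)
    show "norm (dv t x) \<le> K7"
      unfolding dv_def K7_def using B(2)[OF that] by (intro sum_norm_le)
  qed
  have compose: "\<exists>B>0. \<forall>t\<in>{0..T}. \<forall>x. norm (c * r t x powr b) \<le> B" for b c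
  proof -
    have "((\<lambda>y. c * y powr b) has_real_derivative c * (b * y powr (b - 1))) (at y)" if "y > 0" for y
      using that by (intro DERIV_cmult has_real_derivative_powr)
    from space_C1_compose[OF rS positive this]
    have "space_C1 T (\<lambda>t x. c * r t x powr b)"
      using cont_powr[of "c * b" "b - 1"] by (simp add: mult.assoc)
    from ex[OF this] show ?thesis .
  qed
  obtain K8 where K8: "K8 > 0" "\<And>t x. t \<in> {0..T} \<Longrightarrow> norm (1 * r t x powr (- \<gamma>)) \<le> K8" using compose by blast
  obtain K9 where K9: "K9 > 0" "\<And>t x. t \<in> {0..T} \<Longrightarrow> norm (\<gamma> * r t x powr (- (1/2))) \<le> K9" using compose by blast
  obtain K10 where K10: "K10 > 0" "\<And>t x. t \<in> {0..T} \<Longrightarrow> norm (1 * r t x powr (\<gamma> + 1)) \<le> K10" using compose by blast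
  define n where "n = real CARD('d)"
  have n: "n \<ge> 1" by (simp add: n_def Suc_leI)
  define K where "K = K1 + K2 + K3 + n * K4 + (n * K5) * (n * K4) + K6 + K7 + K8 + K9 + K10 + n * K3"
  have K7pos: "K7 > 0" unfolding K7_def using B(1) by (intro sum_pos) auto
  have pos: "0 < n * K4" "0 < (n * K5) * (n * K4)" "0 < n * K3" using n K3 K4 K5 by auto
  note all = K1(1) K2(1) K3(1) K6(1) K7pos K8(1) K9(1) K10(1) pos
  have vec: "norm v \<le> n * c" if "\<And>i. norm (v $ i) \<le> c" for v :: "real^'d" and c
  proof -
    have "norm v \<le> (\<Sum>i\<in>UNIV. norm (v $ i))" by (simp add: norm_le_l1_cart)
    also have "\<dots> \<le> (\<Sum>i\<in>(UNIV :: 'd set). c)" by (intro sum_mono that)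
    finally show ?thesis by (simp add: n_def)
  qed
  show thesis
  proof (rule that[of K])
    show "K > 0" unfolding K_def using all by linarith
    fix t x assume t: "t \<in> {0..T}"
    show "norm (W t x) \<le> K" using K1(2)[OF t, of x] all unfolding K_def by linarith
    show "norm (tderiv T W t x) \<le> K" using K2(2)[OF t, of x] all unfolding K_def by linarith
    show "norm (pd i (W t) x) \<le> K" for i using K3(2)[OF t, of i x] all unfolding K_def by linarith
    have Ub: "norm (U t x) \<le> n * K4" by (rule vec) (rule K4(2)[OF t])
    have hb: "norm (h t x) \<le> n * K5" by (rule vec) (rule K5(2)[OF t])
    show "norm (U t x) \<le> K" using Ub all unfolding K_def by linarith
    have "\<bar>h t x \<bullet> U t x\<bar> \<le> norm (h t x) * norm (U t x)" by (rule Cauchy_Schwarz_ineq2)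
    also have "\<dots> \<le> (n * K5) * (n * K4)" using Ub hb n K5(1) by (intro mult_mono) auto
    finally show "\<bar>h t x \<bullet> U t x\<bar> \<le> K" using all unfolding K_def by linarith
    show "\<bar>dv t x\<bar> \<le> K" using K7(2)[OF t, of x] all unfolding K_def real_norm_def by linarith
    show "\<bar>\<phi> i t x\<bar> \<le> K" for i using K6(2)[OF t, of i x] all unfolding K_def real_norm_def by linarith
    show "\<bar>pd i (\<phi> i t) x\<bar> \<le> K" for i using K7(1)[OF t, of i x] all unfolding K_def real_norm_def by linarith
    show "r t x powr (- \<gamma>) \<le> K" using K8(2)[OF t, of x] all unfolding K_def real_norm_def by linarith
    have "\<gamma> / sqrt (r t x) = \<gamma> * r t x powr (- (1/2))"
      by (simp only: powr_minus powr_half_sqrt[OF less_imp_le[OF positive[OF t]]] divide_inverse[of \<gamma>])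
    then show "\<gamma> / sqrt (r t x) \<le> K" using K9(2)[OF t, of x] all unfolding K_def real_norm_def by linarith
    have "r t x powr \<gamma> * r t x = 1 * r t x powr (\<gamma> + 1)"
      using positive[OF t, of x] by (simp add: powr_add)
    then show "r t x powr \<gamma> * r t x \<le> K" using K10(2)[OF t, of x] all unfolding K_def real_norm_def by linarith
    fix v :: "real^'d"
    have "(\<chi> j. \<Sum>i\<in>UNIV. v $ i * pd i (W t) x $ j) = (\<Sum>i\<in>UNIV. v $ i *\<^sub>R pd i (W t) x)"
      by (simp add: vec_eq_iff)
    also have "norm \<dots> \<le> (\<Sum>i\<in>(UNIV :: 'd set). norm v * K3)"
    proof (rule sum_norm_le)
      fix i
      have "norm (v $ i *\<^sub>R pd i (W t) x) = \<bar>v $ i\<bar> * norm (pd i (W t) x)" by simp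
      also have "\<dots> \<le> norm v * K3"
        using K3(2)[OF t] component_le_norm_cart[of v i] by (intro mult_mono) auto
      finally show "norm (v $ i *\<^sub>R pd i (W t) x) \<le> norm v * K3" .
    qed
    also have "\<dots> = (n * K3) * norm v" by (simp add: n_def)
    also have "\<dots> \<le> K * norm v" using all unfolding K_def by (intro mult_right_mono) auto
    finally show "norm (\<chi> j. \<Sum>i\<in>UNIV. v $ i * pd i (W t) x $ j) \<le> K * norm v" .
  qed
qed

end

section \<open>The relative energy inequality\<close>

locale weak_strong = strong_flow \<gamma> T r W
  for \<gamma> T and r :: "real \<Rightarrow> real^'d \<Rightarrow> real" and W +
  fixes \<rho>0 :: "real^'d \<Rightarrow> real" and w0 and \<V> :: "'d young" and \<D>
  assumes mv: "mv_solution \<gamma> T \<rho>0 w0 \<V> \<D>"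
    and same_init: "AE x in lebesgue_on torus. initial_measure \<rho>0 w0 x = initial_measure (r 0) (W 0) x"
begin

section \<open>Restricted measures on the time interval, the torus and their product\<close>

abbreviation L :: "real \<Rightarrow> (real \<times> (real^'d)) measure" where "L \<tau> \<equiv> lebesgue_on ({0<..<\<tau>} \<times> torus)"
abbreviation X :: "(real^'d) measure" where "X \<equiv> lebesgue_on torus"
abbreviation I :: "real \<Rightarrow> real measure" where "I \<tau> \<equiv> lebesgue_on {0<..<\<tau>}"

lemma sets_lebesgue [simp]:
  "{0<..<\<tau>::real} \<times> (torus :: (real^'d) set) \<in> sets lebesgue" "(torus :: (real^'d) set) \<in> sets lebesgue"
  by (auto intro!: sets_completionI_sets space_time_box_borel)

lemma box_mono: "\<sigma> \<le> \<tau> \<Longrightarrow> {0<..<\<sigma>::real} \<times> (torus :: (real^'d) set) \<subseteq> {0<..<\<tau>} \<times> torus"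
  by auto

text \<open>Translates the set integrals of the definitions into integrals over restricted
  measures.\<close>

lemmas to_on = set_integrable_lebesgue_on set_lebesgue_integral_lebesgue_on set_borel_measurable_lebesgue_on

lemma L_Fubini:
  fixes f :: "real \<times> (real^'d) \<Rightarrow> real"
  assumes "integrable (L \<tau>) f"
  shows "AE t in I \<tau>. integrable X (\<lambda>x. f (t, x))"
    and "integrable (I \<tau>) (\<lambda>t. \<integral>x. f (t, x) \<partial>X)"
    and "(\<integral>t. (\<integral>x. f (t, x) \<partial>X) \<partial>I \<tau>) = (\<integral>p. f p \<partial>L \<tau>)"
  using set_lebesgue_Fubini[of "{0<..<\<tau>}" torus f] assms by (simp_all add: to_on)

lemma AE_L: "AE p in L \<tau>. Q p \<Longrightarrow> AE t in I \<tau>. AE x in X. Q (t, x)"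
  by (rule AE_lebesgue_on_pair) auto

lemma AE_L_in: "AE p in L \<tau>. p \<in> {0<..<\<tau>} \<times> torus"
  by (rule AE_I2) (simp add: space_restrict_space)

lemma AE_I_in: "AE t in I \<tau>. t \<in> {0<..<\<tau>}"
  by (rule AE_I2) (simp add: space_restrict_space)

lemma AE_L_sub: "AE p in L \<tau>. Q p \<Longrightarrow> \<sigma> \<le> \<tau> \<Longrightarrow> AE p in L \<sigma>. Q p"
  by (rule AE_lebesgue_on_subset[OF _ _ _ box_mono]) auto

lemma AE_I_sub: "AE p in I \<tau>. Q p \<Longrightarrow> \<sigma> \<le> \<tau> \<Longrightarrow> AE p in I \<sigma>. Q p"
  by (rule AE_lebesgue_on_subset) auto

lemma integrable_L_sub: "integrable (L \<tau>) (f :: _ \<Rightarrow> real) \<Longrightarrow> \<sigma> \<le> \<tau> \<Longrightarrow> integrable (L \<sigma>) f"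
  by (rule integrable_lebesgue_on_subset[OF _ _ _ box_mono]) auto

lemma integrable_I_sub: "integrable (I \<tau>) (f :: _ \<Rightarrow> real) \<Longrightarrow> \<sigma> \<le> \<tau> \<Longrightarrow> integrable (I \<sigma>) f"
  by (rule integrable_lebesgue_on_subset) auto

lemma mv_parts:
  shows param: "parametrized_measure T \<V>" and defect: "dissipation_defect T \<D>"
    and moments: "finite_moments \<gamma> T \<V>" and reg: "mv_regularity \<gamma> T \<V>"
    and cont: "mv_continuity T \<rho>0 \<V>" and mom: "mv_momentum T (initial_measure \<rho>0 w0) \<V> \<D>"
    and ener: "mv_energy \<gamma> T (initial_measure \<rho>0 w0) \<V> \<D>" and init: "initial_data \<gamma> \<rho>0 w0"
  using mv by (auto simp: mv_solution_def)

abbreviation dn where "dn \<equiv> dens \<V>"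

lemma young: "AE p in L T. young_measure (\<V> (fst p) (snd p)) \<gamma>"
proof -
  have 1: "AE p in L T. prob_space (\<V> (fst p) (snd p)) \<and> sets (\<V> (fst p) (snd p)) = sets phase_borel"
    using param by (simp add: parametrized_measure_def case_prod_unfold)
  have 2: "AE p in L T. integrable (\<V> (fst p) (snd p)) (\<lambda>(s, z, F). Epot \<gamma> s) \<and>
     integrable (\<V> (fst p) (snd p)) (\<lambda>(s, z, F). (norm z)\<^sup>2) \<and>
     integrable (\<V> (fst p) (snd p)) (\<lambda>(s, z, F). (norm F)\<^sup>2)"
    using moments by (simp add: finite_moments_def case_prod_unfold)
  \<comment> \<open>The order 3/2 is admissible for every \<gamma> \<ge> 1, since \<gamma> + 1 \<ge>
    2.\<close>
  have "0 < (3/2 :: real) \<and> 3/2 < \<gamma> + 1" using gamma by simp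
  then have 3: "AE p in L T. dn (fst p) (snd p) powr (3/2) = expect \<V> (\<lambda>(s, z, F). s powr (3/2)) (fst p) (snd p)"
    using reg unfolding mv_regularity_def by (simp add: case_prod_unfold)
  show ?thesis using 1 2 3
    by eventually_elim (auto simp: young_measure_def young_measure_axioms_def gamma expect_def)
qed

lemma young_expect:
  assumes "young_measure (\<V> t x) \<gamma>"
  shows "young_measure.\<rho> (\<V> t x) = dn t x" "young_measure.Z (\<V> t x) = zmean \<V> t x"
    "young_measure.G (\<V> t x) = Fmean \<V> t x"
  using assms by (simp_all add: young_measure.\<rho>_def young_measure.Z_def young_measure.G_def expect_def)

section \<open>Integrands of the balances\<close>

definition en :: "real \<Rightarrow> real^'d \<Rightarrow> real" where
  "en = expect \<V> (\<lambda>(s, z, F). 1/2 * (norm z)\<^sup>2 + Epot \<gamma> s)"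

text \<open>Given in expanded form, so that its space integral splits into exactly the integrals
  occurring in the balances; \<open>rel_eq\<close> identifies it with the relative energy.\<close>

definition rel :: "real \<times> (real^'d) \<Rightarrow> real" where
  "rel = (\<lambda>(t, x). en t x - sqrt (dn t x) * (zmean \<V> t x \<bullet> W t x) + dn t x * \<psi> t x + P t x)"

definition FF :: "real \<times> (real^'d) \<Rightarrow> real" where
  "FF = (\<lambda>(t, x). expect \<V> (\<lambda>(s, z, F). (norm F)\<^sup>2) t x)"

definition zF :: "real \<times> (real^'d) \<Rightarrow> real" where
  "zF = (\<lambda>(t, x). expect \<V> (\<lambda>(s, z, F). z \<bullet> F) t x)"

definition fc :: "real \<times> (real^'d) \<Rightarrow> real" where
  "fc = (\<lambda>(t, x). dn t x * tderiv T \<psi> t x + sqrt (dn t x) * (zmean \<V> t x \<bullet> grad (\<psi> t) x)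
     - sqrt (dn t x) * (Fmean \<V> t x \<bullet> grad (\<psi> t) x))"

definition fm :: "real \<times> (real^'d) \<Rightarrow> real" where
  "fm = (\<lambda>(t, x). sqrt (dn t x) * (zmean \<V> t x \<bullet> tderiv T W t x)
     + (\<Sum>i\<in>UNIV. \<Sum>j\<in>UNIV. expect \<V> (\<lambda>(s, z, F). z $ j * z $ i) t x * pd i (W t) x $ j)
     - (\<Sum>i\<in>UNIV. \<Sum>j\<in>UNIV. expect \<V> (\<lambda>(s, z, F). z $ j * F $ i) t x * pd i (W t) x $ j))"

text \<open>Combined right-hand sides of the energy, momentum, continuity and \<open>P\<close>
  balances, with the signs of the expansion of the relative energy.\<close>

definition integrand :: "real \<times> (real^'d) \<Rightarrow> real" where
  "integrand p = - FF p + zF p - fm p + fc p + (\<lambda>(t, x). tderiv T P t x) p"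

text \<open>The weak gradient identity of Q(\<rho>) tested with \<open>\<phi>\<close>, minus the
  same expression for Q(r) written as a divergence. Both parts have mean zero at almost every
  time.\<close>

definition J :: "real \<times> (real^'d) \<Rightarrow> real" where
  "J = (\<lambda>(t, x). (\<Sum>i\<in>UNIV. Fmean \<V> t x $ i * \<phi> i t x + Qfun \<gamma> (dn t x) * pd i (\<phi> i t) x)
     - (\<Sum>i\<in>UNIV. pd i (\<lambda>x. \<phi> i t x * Qr t x) x))"

definition Fdev :: "real \<times> (real^'d) \<Rightarrow> real" where
  "Fdev = (\<lambda>(t, x). \<integral>(s, z, F). (norm (F - sqrt (dn t x) *\<^sub>R h t x))\<^sup>2 \<partial>\<V> t x)"

lemma rel_eq:
  assumes "young_measure (\<V> t x) \<gamma>"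
  shows "rel (t, x) = young_measure.rel_energy (\<V> t x) \<gamma> (W t x) (r t x)"
  unfolding young_measure.rel_energy_expand[OF assms] young_expect[OF assms]
  by (simp add: rel_def en_def \<psi>_def P_def pres_def expect_def)

lemma J_eq:
  assumes t: "t \<in> {0..T}"
  shows "J (t, x) = (sqrt (r t x) * (Fmean \<V> t x \<bullet> U t x) + Qfun \<gamma> (dn t x) * dv t x)
      - (r t x * (h t x \<bullet> U t x) + Qfun \<gamma> (r t x) * dv t x)"
proof -
  have "sqrt (r t x) * sqrt (r t x) = r t x" using positive[OF t, of x] by simp
  then have e: "\<phi> i t x * (sqrt (r t x) * h t x $ i) = r t x * (h t x $ i * U t x $ i)" for i
    unfolding \<phi>_def by (metis mult.assoc mult.commute)
  have e': "Fmean \<V> t x $ i * \<phi> i t x = sqrt (r t x) * (Fmean \<V> t x $ i * U t x $ i)" for i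
    by (simp add: \<phi>_def)
  have e'': "pd i (\<lambda>x. \<phi> i t x * Qr t x) x = \<phi> i t x * (sqrt (r t x) * h t x $ i) + pd i (\<phi> i t) x * Qr t x" for i
    unfolding Qr_grad[OF t, symmetric]
    by (rule pd_mult[OF space_C1_differentiable[OF phiS t] space_C1_differentiable[OF QrS t]])
  show ?thesis
    unfolding J_def prod.case e'' dv_def inner_vec_def e e'
    by (simp add: sum.distrib sum_distrib_left Qr_def mult.commute)
qed

lemma pointwise: "\<exists>C\<ge>0. AE p in L T. integrand p - J p \<le> C * rel p - 1/2 * Fdev p"
proof -
  obtain K where K: "K > 0"
    "\<And>t x. t \<in> {0..T} \<Longrightarrow> norm (U t x) \<le> K" "\<And>t x. t \<in> {0..T} \<Longrightarrow> \<bar>h t x \<bullet> U t x\<bar> \<le> K"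
    "\<And>t x. t \<in> {0..T} \<Longrightarrow> \<bar>dv t x\<bar> \<le> K"
    "\<And>t x. t \<in> {0..T} \<Longrightarrow> r t x powr (- \<gamma>) \<le> K" "\<And>t x. t \<in> {0..T} \<Longrightarrow> \<gamma> / sqrt (r t x) \<le> K"
    "\<And>t x v. t \<in> {0..T} \<Longrightarrow> norm (\<chi> j. \<Sum>i\<in>UNIV. v $ i * pd i (W t) x $ j) \<le> K * norm v"
    by (rule bounds) (rule that; assumption)
  \<comment> \<open>The constant of \<open>relative_energy_balance\<close> with every bound replaced
    by \<open>K\<close>.\<close>
  define C where "C = 2 * (K + (1 + K)\<^sup>2) + (2 * K\<^sup>2 + K) * K + K * K"
  have "C \<ge> 0" using K(1) by (simp add: C_def)
  moreover have "AE p in L T. integrand p - J p \<le> C * rel p - 1/2 * Fdev p"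
    using young AE_L_in
  proof eventually_elim
    case (elim p)
    obtain t x where p: "p = (t, x)" by (cases p)
    have t: "t \<in> {0<..<T}" "t \<in> {0..T}" using elim p by auto
    have y: "young_measure (\<V> t x) \<gamma>" using elim p by simp
    note bal = young_measure.relative_energy_balance[OF y, where W = "W t x" and h = "h t x"
        and U = "U t x" and u = K and B = "\<lambda>i j. pd i (W t) x $ j" and \<beta> = K and A = "tderiv T W t x"
        and g = "grad (\<psi> t) x" and r = "r t x" and a = "pt t x" and d = "dv t x" and k = K and \<delta> = K
        and ?m1.0 = K and ?m2.0 = K, OF U_def K(2)[OF t(2)] K(7)[OF t(2)] less_imp_le[OF K(1)]
        transport_eq[OF t(1)] psi_grad[OF t(2)] positive[OF t(2)] pressure_eq[OF t(1)]
        K(3)[OF t(2)] K(4)[OF t(2)] K(5)[OF t(2)] K(6)[OF t(2)], unfolded young_expect[OF y]]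
    show ?case
      using bal unfolding p rel_eq[OF y] J_eq[OF t(2)] C_def[symmetric] integrand_def FF_def zF_def fm_def fc_def
        Fdev_def prod.case expect_def psi_t[OF t(2)] P_t[OF t(2)] by simp
  qed
  ultimately show ?thesis by blast
qed

lemma rel_nonneg: "AE p in L T. 0 \<le> rel p"
  using young AE_L_in
proof eventually_elim
  case (elim p)
  obtain t x where p: "p = (t, x)" by (cases p)
  have t: "t \<in> {0..T}" using elim p by auto
  have y: "young_measure (\<V> t x) \<gamma>" using elim p by simp
  show ?case unfolding p rel_eq[OF y] by (rule young_measure.rel_energy_parts(3)[OF y positive[OF t]])
qed

lemma Fdev_nonneg: "0 \<le> Fdev p"
  unfolding Fdev_def case_prod_unfold by (rule Bochner_Integration.integral_nonneg) simp

lemma const_integrable: "integrable (L \<tau>) (\<lambda>p. c :: real)" "integrable X (\<lambda>x. c :: real)" "integrable (I \<tau>) (\<lambda>x. c :: real)"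
proof -
  have *: "integrable (lebesgue_on S) (\<lambda>p. c)" if "S \<in> sets lebesgue" "bounded S" for S :: "'a::euclidean_space set"
    using that by (intro finite_measure.integrable_const finite_measure_lebesgue_on bounded_set_imp_lmeasurable)
  have "bounded {0<..<\<tau>}" by (rule bounded_subset[of "{0..\<tau>}"]) auto
  then show "integrable (L \<tau>) (\<lambda>p. c)" "integrable X (\<lambda>x. c)" "integrable (I \<tau>) (\<lambda>x. c)"
    by (auto intro!: * space_time_box_bounded torus_bounded)
qed

lemma smooth_measurable:
  assumes "continuous_on ({0..T} \<times> UNIV) (\<lambda>(t, x). f t x :: real)"
  shows "(\<lambda>(t, x). f t x) \<in> borel_measurable (L T)"
  by (rule continuous_measurable_lebesgue_on[OF assms _ space_time_box_borel]) auto

lemma smooth_integrable: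
  assumes "continuous_on ({0..T} \<times> UNIV) (\<lambda>(t, x). f t x :: real)" "\<And>t. t \<in> {0..T} \<Longrightarrow> periodic (f t)" "\<tau> \<le> T"
  shows "integrable (L \<tau>) (\<lambda>(t, x). f t x)"
  using set_integrable_space_time_continuous[OF assms] by (simp add: to_on)

text \<open>At almost every time \<open>\<phi> i t\<close> is an admissible test function for the
  weak gradient, and the divergence theorem handles the strong part. Integrating these identities in
  time needs joint integrability, which square integrability on a bounded set provides.\<close>

lemma J_zero: "integrable (L T) J" "\<tau> \<le> T \<Longrightarrow> (\<integral>p. J p \<partial>L \<tau>) = 0"
proof -
  obtain K where K: "K > 0" "\<And>t x i. t \<in> {0..T} \<Longrightarrow> \<bar>\<phi> i t x\<bar> \<le> K"
    "\<And>t x i. t \<in> {0..T} \<Longrightarrow> \<bar>pd i (\<phi> i t) x\<bar> \<le> K"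
    by (rule bounds) (rule that; assumption)
  define t1 where "t1 i = (\<lambda>(t, x). Fmean \<V> t x $ i * \<phi> i t x)" for i
  define t2 where "t2 i = (\<lambda>(t, x). Qfun \<gamma> (dn t x) * pd i (\<phi> i t) x)" for i
  define t3 where "t3 i = (\<lambda>(t, x). pd i (\<lambda>x. \<phi> i t x * Qr t x) x)" for i
  have J: "J p = (\<Sum>i\<in>UNIV. t1 i p + t2 i p) - (\<Sum>i\<in>UNIV. t3 i p)" for p
    by (cases p) (simp add: J_def t1_def t2_def t3_def)
  have "L2_W12 T (\<lambda>t x. Qfun \<gamma> (dn t x)) (Fmean \<V>)" using reg by (simp add: mv_regularity_def)
  then have mq: "(\<lambda>(t, x). Qfun \<gamma> (dn t x)) \<in> borel_measurable (L T)"
    and mg: "(\<lambda>(t, x). Fmean \<V> t x) \<in> borel_measurable (L T)"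
    and iq: "integrable (L T) (\<lambda>(t, x). (Qfun \<gamma> (dn t x))\<^sup>2)"
    and ig: "integrable (L T) (\<lambda>(t, x). (norm (Fmean \<V> t x))\<^sup>2)"
    and wg: "AE t in I T. has_weak_gradient (\<lambda>x. Qfun \<gamma> (dn t x)) (Fmean \<V> t)"
    by (simp_all add: L2_W12_def to_on)
  \<comment> \<open>Dominates a square integrable function times a bounded one by an integrable
    function.\<close>
  have sq: "\<bar>a * b\<bar> \<le> K * (1 + c\<^sup>2)" if "\<bar>a\<bar> \<le> c" "\<bar>b\<bar> \<le> K" for a b c :: real
  proof -
    have "\<bar>a * b\<bar> \<le> c * K" unfolding abs_mult using that by (intro mult_mono) auto
    also have "c \<le> 1 + c\<^sup>2"
      using sum_squares_bound[of c 1] that(1) by (simp add: power2_eq_square)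
    finally show ?thesis using K(1) by (simp add: mult.commute)
  qed
  have i1: "integrable (L T) (t1 i)" for i
  proof (rule Bochner_Integration.integrable_bound)
    show "integrable (L T) (\<lambda>p. K * (1 + (case p of (t, x) \<Rightarrow> (norm (Fmean \<V> t x))\<^sup>2)))"
      by (intro integrable_mult_right Bochner_Integration.integrable_add const_integrable ig)
    have "(\<lambda>p. (case p of (t, x) \<Rightarrow> Fmean \<V> t x) $ i) \<in> borel_measurable (L T)"
      by (rule borel_measurable_continuous_on[OF _ mg]) (intro continuous_intros)
    then show "t1 i \<in> borel_measurable (L T)"
      using borel_measurable_times[OF _ smooth_measurable[OF space_C1_continuous[OF phiS[of i]]]]
      by (simp add: t1_def case_prod_unfold)
    show "AE p in L T. norm (t1 i p) \<le> norm (K * (1 + (case p of (t, x) \<Rightarrow> (norm (Fmean \<V> t x))\<^sup>2)))"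
      using AE_L_in
    proof eventually_elim
      case (elim p)
      obtain t x where p: "p = (t, x)" by (cases p)
      have "\<bar>Fmean \<V> t x $ i * \<phi> i t x\<bar> \<le> K * (1 + (norm (Fmean \<V> t x))\<^sup>2)"
        using elim by (intro sq component_le_norm_cart K) (auto simp: p)
      then show ?case using K(1) by (simp add: t1_def p)
    qed
  qed
  have i2: "integrable (L T) (t2 i)" for i
  proof (rule Bochner_Integration.integrable_bound)
    show "integrable (L T) (\<lambda>p. K * (1 + (case p of (t, x) \<Rightarrow> (Qfun \<gamma> (dn t x))\<^sup>2)))"
      by (intro integrable_mult_right Bochner_Integration.integrable_add const_integrable iq)
    show "t2 i \<in> borel_measurable (L T)"
      using borel_measurable_times[OF mq smooth_measurable[OF space_C1_continuous_pd[OF phiS[of i], of i]]]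
      by (simp add: t2_def case_prod_unfold)
    show "AE p in L T. norm (t2 i p) \<le> norm (K * (1 + (case p of (t, x) \<Rightarrow> (Qfun \<gamma> (dn t x))\<^sup>2)))"
      using AE_L_in
    proof eventually_elim
      case (elim p)
      obtain t x where p: "p = (t, x)" by (cases p)
      have "\<bar>Qfun \<gamma> (dn t x) * pd i (\<phi> i t) x\<bar> \<le> K * (1 + \<bar>Qfun \<gamma> (dn t x)\<bar>\<^sup>2)"
        using elim by (intro sq K) (auto simp: p)
      then show ?case using K(1) by (simp add: t2_def p)
    qed
  qed
  have phiQ: "space_C1 T (\<lambda>t x. \<phi> i t x * Qr t x)" for i by (rule space_C1_mult[OF phiS QrS])
  then have perQ: "t \<in> {0..T} \<Longrightarrow> periodic (pd i (\<lambda>x. \<phi> i t x * Qr t x))" for i t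
    by (intro periodic_pd) (simp add: space_C1_def)
  have i3: "integrable (L T) (t3 i)" for i
    unfolding t3_def by (rule smooth_integrable[OF space_C1_continuous_pd[OF phiQ] perQ]) auto
  have J': "J = (\<lambda>p. (\<Sum>i\<in>UNIV. t1 i p + t2 i p) - (\<Sum>i\<in>UNIV. t3 i p))" using J by auto
  show JT: "integrable (L T) J"
    unfolding J' by (intro Bochner_Integration.integrable_diff Bochner_Integration.integrable_sum
        Bochner_Integration.integrable_add i1 i2 i3)
  assume \<tau>: "\<tau> \<le> T"
  have a1: "AE t in I T. \<forall>i. integrable X (\<lambda>x. t1 i (t, x))"
    and a2: "AE t in I T. \<forall>i. integrable X (\<lambda>x. t2 i (t, x))"
    and a3: "AE t in I T. \<forall>i. integrable X (\<lambda>x. t3 i (t, x))"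
    unfolding AE_all_countable using L_Fubini(1)[OF i1] L_Fubini(1)[OF i2] L_Fubini(1)[OF i3] by blast+
  from a1 a2 a3 wg AE_I_in have "AE t in I T. (\<integral>x. J (t, x) \<partial>X) = 0"
  proof eventually_elim
    case (elim t)
    then have t: "t \<in> {0..T}" by auto
    \<comment> \<open>The weak gradient identity, component by component.\<close>
    have 12: "(\<integral>x. t2 i (t, x) \<partial>X) = - (\<integral>x. t1 i (t, x) \<partial>X)" for i
      using elim(4) space_C1_C1_torus[OF phiS[of i] t] unfolding has_weak_gradient_def t1_def t2_def
      by (simp add: to_on)
    have 3: "(\<integral>x. t3 i (t, x) \<partial>X) = 0" for i
      using integral_torus_pd[OF space_C1_C1_torus[OF phiQ[of i] t]] by (simp add: t3_def to_on)
    have "(\<integral>x. J (t, x) \<partial>X) = (\<Sum>i\<in>UNIV. (\<integral>x. t1 i (t, x) \<partial>X) + (\<integral>x. t2 i (t, x) \<partial>X))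
        - (\<Sum>i\<in>UNIV. (\<integral>x. t3 i (t, x) \<partial>X))"
      unfolding J using elim(1-3)
      by (subst Bochner_Integration.integral_diff) (auto simp: Bochner_Integration.integral_sum)
    then show ?case unfolding 12 3 by simp
  qed
  then have "AE t in I \<tau>. (\<integral>x. J (t, x) \<partial>X) = 0" using \<tau> by (rule AE_I_sub)
  then have "(\<integral>t. (\<integral>x. J (t, x) \<partial>X) \<partial>I \<tau>) = 0" by (rule integral_eq_zero_AE)
  then show "(\<integral>p. J p \<partial>L \<tau>) = 0" using L_Fubini(3)[OF integrable_L_sub[OF JT \<tau>]] by simp
qed

section \<open>Defect, initial data and energy in scalar form\<close>

lemma defect_facts:
  obtains KD where "\<D> \<in> borel_measurable (I T)" "AE t in I T. 0 \<le> \<D> t" "AE t in I T. \<D> t \<le> KD"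
    "integrable (I T) \<D>"
proof -
  obtain K where m: "\<D> \<in> borel_measurable (I T)" and 0: "AE t in I T. 0 \<le> \<D> t" and K: "AE t in I T. \<D> t \<le> K"
    using defect unfolding dissipation_defect_def by (auto simp: to_on)
  have "AE t in I T. \<bar>\<D> t\<bar> \<le> K" using 0 K by eventually_elim auto
  then have "integrable (I T) \<D>"
    using set_integrable_bounded[of "{0<..<T}" \<D> K] m by (simp add: to_on)
  then show thesis using m 0 K that by blast
qed

text \<open>Equality of the two Dirac measures identifies their atoms, hence the initial density,
  energy and momentum.\<close>

lemma initial_facts:
  "AE x in X. \<rho>0 x = r 0 x \<and>
     (\<integral>(s, z). 1/2 * (norm z)\<^sup>2 + Epot \<gamma> s \<partial>initial_measure \<rho>0 w0 x) = 1/2 * r 0 x * (W 0 x \<bullet> W 0 x) + Epot \<gamma> (r 0 x) \<and>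
     (\<integral>(s, z). sqrt s *\<^sub>R z \<partial>initial_measure \<rho>0 w0 x) = r 0 x *\<^sub>R W 0 x"
proof -
  let ?N = "restrict_space borel ({0..} \<times> UNIV) :: (real \<times> (real^'d)) measure"
  have sp: "space ?N = {0..} \<times> UNIV" by (simp add: space_restrict_space)
  have "AE x in X. \<rho>0 x \<ge> 0" using init by (simp add: initial_data_def)
  with same_init show ?thesis
  proof eventually_elim
    case (elim x)
    have r0: "r 0 x > 0" using positive[of 0 x] T by simp
    have "(\<rho>0 x, sqrt (\<rho>0 x) *\<^sub>R w0 x) = (r 0 x, sqrt (r 0 x) *\<^sub>R W 0 x)"
    proof (rule return_eq_imp_eq)
      show "return ?N (\<rho>0 x, sqrt (\<rho>0 x) *\<^sub>R w0 x) = return ?N (r 0 x, sqrt (r 0 x) *\<^sub>R W 0 x)"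
        using elim(1) by (simp add: initial_measure_def)
      show "(\<rho>0 x, sqrt (\<rho>0 x) *\<^sub>R w0 x) \<in> space ?N" using elim(2) by (simp add: sp)
      then show "{(\<rho>0 x, sqrt (\<rho>0 x) *\<^sub>R w0 x)} \<in> sets ?N"
        unfolding sp by (auto simp: sets_restrict_space intro!: image_eqI[where x = "{(\<rho>0 x, sqrt (\<rho>0 x) *\<^sub>R w0 x)}"])
    qed
    then have "\<rho>0 x = r 0 x" by simp
    moreover have im: "initial_measure \<rho>0 w0 x = return ?N (r 0 x, sqrt (r 0 x) *\<^sub>R W 0 x)"
      using elim(1) by (simp add: initial_measure_def)
    have pt: "(r 0 x, sqrt (r 0 x) *\<^sub>R W 0 x) \<in> space ?N" using r0 by (simp add: sp)
    have c: "continuous_on ({0..} \<times> UNIV) (\<lambda>p :: real \<times> (real^'d). Epot \<gamma> (fst p))"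
      by (rule continuous_on_compose2[OF continuous_on_Epot[OF gamma]]) (auto intro!: continuous_intros)
    have "(\<integral>(s, z). 1/2 * (norm z)\<^sup>2 + Epot \<gamma> s \<partial>initial_measure \<rho>0 w0 x)
        = 1/2 * r 0 x * (W 0 x \<bullet> W 0 x) + Epot \<gamma> (r 0 x)"
      unfolding im
    proof (subst integral_return[OF pt])
      show "(\<lambda>(s, z). 1/2 * (norm z)\<^sup>2 + Epot \<gamma> s) \<in> borel_measurable ?N"
        unfolding case_prod_unfold
        by (intro borel_measurable_continuous_on_restrict continuous_intros c)
    qed (use r0 in \<open>simp add: power_mult_distrib power2_norm_eq_inner\<close>)
    moreover have "(\<integral>(s, z). sqrt s *\<^sub>R z \<partial>initial_measure \<rho>0 w0 x) = r 0 x *\<^sub>R W 0 x"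
      unfolding im
    proof (subst integral_return[OF pt])
      show "(\<lambda>(s, z). sqrt s *\<^sub>R z) \<in> borel_measurable ?N"
        unfolding case_prod_unfold
        by (intro borel_measurable_continuous_on_restrict continuous_intros)
    qed (use r0 in simp)
    ultimately show ?case by simp
  qed
qed

definition e0 :: "real^'d \<Rightarrow> real" where
  "e0 x = (\<integral>(s, z). 1/2 * (norm z)\<^sup>2 + Epot \<gamma> s \<partial>initial_measure \<rho>0 w0 x)"

definition u0 :: "real^'d \<Rightarrow> real^'d" where
  "u0 x = (\<integral>(s, z). sqrt s *\<^sub>R z \<partial>initial_measure \<rho>0 w0 x)"

text \<open>Packaging the remainder as a number \<open>R\<close> with its bound makes the inequality
  a scalar estimate at one time and one \<epsilon>.\<close>

definition energy_bound :: "real \<Rightarrow> real \<Rightarrow> real \<Rightarrow> bool" where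
  "energy_bound C \<epsilon> \<tau> \<longleftrightarrow>
     integrable X (en \<tau>) \<and> integrable X e0 \<and> integrable (L \<tau>) FF \<and> integrable (L \<tau>) zF \<and>
     (\<exists>R. (\<integral>x. en \<tau> x \<partial>X) + (\<integral>p. FF p \<partial>L \<tau>) + \<D> \<tau> \<le> (\<integral>x. e0 x \<partial>X) + (\<integral>p. zF p \<partial>L \<tau>) + R \<and>
        \<bar>R\<bar> \<le> C * (1 + 1 / (4 * \<epsilon>)) * (\<integral>t. \<D> t \<partial>I \<tau>) + \<epsilon> * \<D> \<tau>)"

lemma energy_facts: "\<exists>C. AE \<tau> in I T. \<forall>\<epsilon>>0. energy_bound C \<epsilon> \<tau>"
  using ener unfolding mv_energy_def
proof (elim exE conjE, goal_cases)
  case (1 \<mu> \<nu> C)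
  have e0: "e0 = (\<lambda>x. \<integral>(s, z). 1/2 * (norm z)\<^sup>2 + Epot \<gamma> s \<partial>initial_measure \<rho>0 w0 x)"
    by (simp add: e0_def fun_eq_iff)
  have "AE \<tau> in I T. \<forall>\<epsilon>>0. energy_bound C \<epsilon> \<tau>"
    using 1(4)
    by eventually_elim (unfold energy_bound_def en_def e0 FF_def zF_def Let_def, simp add: to_on, blast)
  then show ?case by blast
qed

text \<open>The definition guarantees integrability of \<open>zF\<close> up to almost every single
  \<sigma> < T. Fixing such a \<sigma> bounds the energy for almost all earlier times; the bound may
  grow as \<sigma> approaches T.\<close>

lemma energy_locally_bounded:
  "AE \<sigma> in I T. \<exists>E. AE \<tau> in I \<sigma>. integrable X (en \<tau>) \<and> (\<integral>x. en \<tau> x \<partial>X) \<le> E"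
proof -
  obtain C where C: "AE \<tau> in I T. \<forall>\<epsilon>>0. energy_bound C \<epsilon> \<tau>"
    using energy_facts by blast
  obtain KD where D: "\<D> \<in> borel_measurable (I T)" "AE t in I T. 0 \<le> \<D> t" "AE t in I T. \<D> t \<le> KD"
    "integrable (I T) \<D>"
    by (rule defect_facts)
  show ?thesis using C AE_I_in
  proof eventually_elim
    case (elim \<sigma>)
    have zs: "integrable (L \<sigma>) zF" using elim(1) zero_less_one unfolding energy_bound_def by blast
    have \<sigma>: "\<sigma> \<le> T" using elim(2) by simp
    define E where "E = (\<integral>x. e0 x \<partial>X) + (\<integral>p. \<bar>zF p\<bar> \<partial>L \<sigma>) + \<bar>C\<bar> * (1 + 1 / 4) * (\<integral>t. \<D> t \<partial>I T)"
    have "AE \<tau> in I \<sigma>. integrable X (en \<tau>) \<and> (\<integral>x. en \<tau> x \<partial>X) \<le> E"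
      using AE_I_sub[OF C \<sigma>] AE_I_in
    proof eventually_elim
      case (elim \<tau>)
      \<comment> \<open>With \<epsilon> = 1 the term \<open>1 * \<D> \<tau>\<close> in the remainder
        bound is cancelled by the \<open>\<D> \<tau>\<close> on the left.\<close>
      obtain R where R: "(\<integral>x. en \<tau> x \<partial>X) + (\<integral>p. FF p \<partial>L \<tau>) + \<D> \<tau> \<le> (\<integral>x. e0 x \<partial>X) + (\<integral>p. zF p \<partial>L \<tau>) + R"
        "\<bar>R\<bar> \<le> C * (1 + 1 / (4 * 1)) * (\<integral>t. \<D> t \<partial>I \<tau>) + 1 * \<D> \<tau>" and ie: "integrable X (en \<tau>)"
        and iz: "integrable (L \<tau>) zF"
        using elim(1) zero_less_one unfolding energy_bound_def by blast
      have \<tau>: "\<tau> \<le> \<sigma>" "\<tau> \<le> T" using elim(2) \<sigma> by auto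
      have "0 \<le> (\<integral>p. FF p \<partial>L \<tau>)"
        by (intro Bochner_Integration.integral_nonneg) (auto simp: FF_def expect_def intro!: Bochner_Integration.integral_nonneg)
      moreover have "(\<integral>p. zF p \<partial>L \<tau>) \<le> (\<integral>p. \<bar>zF p\<bar> \<partial>L \<tau>)"
        using iz by (intro integral_mono) auto
      moreover have "(\<integral>p. \<bar>zF p\<bar> \<partial>L \<tau>) \<le> (\<integral>p. \<bar>zF p\<bar> \<partial>L \<sigma>)"
        using zs by (intro integral_lebesgue_on_mono box_mono \<tau>) auto
      moreover have "(\<integral>t. \<D> t \<partial>I \<tau>) \<le> (\<integral>t. \<D> t \<partial>I T)"
        using D \<tau> by (intro integral_lebesgue_on_mono) auto
      moreover have "0 \<le> (\<integral>t. \<D> t \<partial>I \<tau>)"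
        by (rule integral_nonneg_AE[OF AE_I_sub[OF D(2) \<tau>(2)]])
      ultimately have "C * (1 + 1 / (4 * 1)) * (\<integral>t. \<D> t \<partial>I \<tau>) \<le> \<bar>C\<bar> * (1 + 1 / 4) * (\<integral>t. \<D> t \<partial>I T)"
        by (intro mult_mono) auto
      then have "(\<integral>x. en \<tau> x \<partial>X) \<le> E"
        unfolding E_def using R \<open>0 \<le> (\<integral>p. FF p \<partial>L \<tau>)\<close> \<open>(\<integral>p. zF p \<partial>L \<tau>) \<le> (\<integral>p. \<bar>zF p\<bar> \<partial>L \<tau>)\<close>
          \<open>(\<integral>p. \<bar>zF p\<bar> \<partial>L \<tau>) \<le> (\<integral>p. \<bar>zF p\<bar> \<partial>L \<sigma>)\<close> by linarith
      then show ?case using ie by simp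
    qed
    then show ?case by blast
  qed
qed

section \<open>Measurability and integrability of the relative energy\<close>

lemma continuous_phase_energy:
  "continuous_on phase_space (\<lambda>(s, z :: real^'d, F :: real^'d). 1/2 * (norm z)\<^sup>2 + Epot \<gamma> s)"
proof -
  have "continuous_on phase_space (\<lambda>y :: 'd phase. Epot \<gamma> (fst y))"
    by (rule continuous_on_compose2[OF continuous_on_Epot[OF gamma]])
      (auto simp: phase_space_def intro!: continuous_intros)
  then show ?thesis unfolding case_prod_unfold by (intro continuous_intros)
qed

lemma en_measurable: "(\<lambda>(t, x). en t x) \<in> borel_measurable (L T)"
proof -
  have "AE (t, x) in L T. integrable (\<V> t x) (\<lambda>(s, z, F). 1/2 * (norm z)\<^sup>2 + Epot \<gamma> s)"
    using young by eventually_elim (use young_measure.int_energy in \<open>auto simp: case_prod_unfold\<close>)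
  from set_borel_measurable_expect[OF param continuous_phase_energy this]
  show ?thesis unfolding en_def by (simp add: to_on)
qed

lemma dn_measurable: "(\<lambda>(t, x). dn t x) \<in> borel_measurable (L T)"
proof -
  have "AE (t, x) in L T. integrable (\<V> t x) (\<lambda>(s, z, F). s)"
    using young by eventually_elim (use young_measure.int_s in \<open>auto simp: case_prod_unfold\<close>)
  moreover have "continuous_on phase_space (\<lambda>(s :: real, z :: real^'d, F :: real^'d). s)"
    unfolding case_prod_unfold by (intro continuous_intros)
  ultimately show ?thesis
    using set_borel_measurable_expect[OF param] by (simp add: to_on)
qed

lemma zmean_measurable: "(\<lambda>(t, x). zmean \<V> t x) \<in> borel_measurable (L T)"
  using reg unfolding mv_regularity_def Linf_L2_def by (simp add: to_on)

lemma W_measurable: "(\<lambda>(t, x). W t x) \<in> borel_measurable (L T)"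
proof -
  have "set_borel_measurable lebesgue ({0<..<T} \<times> torus) (\<lambda>(t, x). W t x)"
    by (rule set_borel_measurable_continuous_subset[OF space_C1_continuous[OF WS] _ space_time_box_borel]) auto
  then show ?thesis by (simp add: to_on)
qed

lemma rel_measurable: "rel \<in> borel_measurable (L T)"
proof -
  note psi = smooth_measurable[OF space_C1_continuous[OF C1_space_time_space_C1[OF psiC]]]
    and PP = smooth_measurable[OF space_C1_continuous[OF C1_space_time_space_C1[OF PC]]]
  have "(\<lambda>p. (case p of (t, x) \<Rightarrow> en t x)
      - sqrt (case p of (t, x) \<Rightarrow> dn t x) * ((case p of (t, x) \<Rightarrow> zmean \<V> t x) \<bullet> (case p of (t, x) \<Rightarrow> W t x))
      + (case p of (t, x) \<Rightarrow> dn t x) * (case p of (t, x) \<Rightarrow> \<psi> t x) + (case p of (t, x) \<Rightarrow> P t x)) \<in> borel_measurable (L T)"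
    by (intro borel_measurable_add borel_measurable_diff borel_measurable_times borel_measurable_inner
        en_measurable zmean_measurable W_measurable dn_measurable psi PP measurable_compose[OF dn_measurable borel_measurable_sqrt])
  then show ?thesis by (simp add: rel_def case_prod_unfold)
qed

lemma en_nonneg: "AE p in L T. 0 \<le> en (fst p) (snd p)"
  using young
proof eventually_elim
  case (elim p)
  then interpret young_measure "\<V> (fst p) (snd p)" \<gamma> .
  have "AE y in \<V> (fst p) (snd p). 0 \<le> (case y of (s, z, F) \<Rightarrow> 1/2 * (norm z)\<^sup>2 + Epot \<gamma> s)"
    using AE_nonneg by eventually_elim (use gamma in \<open>auto simp: Epot_eq intro!: add_nonneg_nonneg\<close>)
  then show ?case unfolding en_def expect_def by (rule integral_nonneg_AE)
qed

lemma rel_le: "\<exists>C\<ge>0. \<exists>c. AE p in L T. rel p \<le> C * en (fst p) (snd p) + c"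
proof -
  obtain K where K: "K > 0" "\<And>t x. t \<in> {0..T} \<Longrightarrow> norm (W t x) \<le> K"
    "\<And>t x. t \<in> {0..T} \<Longrightarrow> r t x powr \<gamma> * r t x \<le> K"
    by (rule bounds) (rule that; assumption)
  have "AE p in L T. rel p \<le> (2 + K\<^sup>2 * (\<gamma> + 1)) * en (fst p) (snd p) + (K\<^sup>2 + K)"
    using young AE_L_in
  proof eventually_elim
    case (elim p)
    obtain t x where p: "p = (t, x)" by (cases p)
    have t: "t \<in> {0..T}" using elim p by auto
    have y: "young_measure (\<V> t x) \<gamma>" using elim p by simp
    show ?case
      using young_measure.rel_energy_le[OF y positive[OF t, of x] K(2)[OF t, of x] K(3)[OF t, of x]]
      unfolding p rel_eq[OF y] fst_conv snd_conv en_def expect_def by linarith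
  qed
  moreover have "0 \<le> 2 + K\<^sup>2 * (\<gamma> + 1)" using gamma by simp
  ultimately show ?thesis by blast
qed

text \<open>The local energy bound and Tonelli's theorem make the energy density integrable on
  space-time; the relative energy is nonnegative and dominated by an affine function of it.\<close>

lemma rel_integrable:
  assumes \<sigma>: "\<sigma> \<le> T" and E: "AE \<tau> in I \<sigma>. integrable X (en \<tau>) \<and> (\<integral>x. en \<tau> x \<partial>X) \<le> E"
  shows "integrable (L \<sigma>) rel" and "\<exists>M. AE t in I \<sigma>. (\<integral>x. rel (t, x) \<partial>X) \<le> M"
proof -
  obtain C c where C: "C \<ge> 0" "AE p in L T. rel p \<le> C * en (fst p) (snd p) + c" using rel_le by blast
  let ?S = "{0<..<\<sigma>} \<times> (torus :: (real^'d) set)"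
  let ?e = "\<lambda>p. indicator ?S p *\<^sub>R (case p of (t, x) \<Rightarrow> en t x)"
  have inner: "(\<lambda>x. ?e (t, x)) = (\<lambda>x. indicator {0<..<\<sigma>} t *\<^sub>R (indicator torus x *\<^sub>R en t x))" for t
    by (auto simp: indicator_def fun_eq_iff)
  have "integrable lebesgue ?e"
  proof (rule lebesgue_Tonelli)
    have "(\<lambda>(t, x). en t x) \<in> borel_measurable (L \<sigma>)"
      using measurable_lebesgue_on_subset[OF en_measurable box_mono[OF \<sigma>]] .
    then show "?e \<in> borel_measurable lebesgue"
      by (simp add: set_borel_measurable_lebesgue_on[symmetric] set_borel_measurable_def)
    have "AE p in lebesgue. p \<in> ?S \<longrightarrow> 0 \<le> en (fst p) (snd p)"
      using AE_L_sub[OF en_nonneg \<sigma>] by (simp add: AE_restrict_space_iff)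
    then show "AE p in lebesgue. 0 \<le> ?e p"
      by eventually_elim (auto simp: indicator_def)
    show "integrable lebesgue (\<lambda>t. indicator {0<..<\<sigma>} t *\<^sub>R \<bar>E\<bar>)"
      using const_integrable(3)[of \<sigma> "\<bar>E\<bar>"] by (simp add: to_on(1)[symmetric] set_integrable_def)
    have "AE t in lebesgue. t \<in> {0<..<\<sigma>} \<longrightarrow> integrable X (en t) \<and> (\<integral>x. en t x \<partial>X) \<le> E"
      using E by (auto simp: AE_restrict_space_iff)
    then show "AE t in lebesgue. integrable lebesgue (\<lambda>x. ?e (t, x)) \<and>
        (\<integral>x. ?e (t, x) \<partial>lebesgue) \<le> indicator {0<..<\<sigma>} t *\<^sub>R \<bar>E\<bar>"
    proof eventually_elim
      case (elim t)
      show ?case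
      proof (cases "t \<in> {0<..<\<sigma>}")
        case True
        have "integrable lebesgue (\<lambda>x. indicator torus x *\<^sub>R en t x)"
          and "(\<integral>x. indicator torus x *\<^sub>R en t x \<partial>lebesgue) \<le> E"
          using elim True by (simp_all add: to_on(1,2)[symmetric] set_integrable_def set_lebesgue_integral_def)
        then show ?thesis unfolding inner using True by simp
      next
        case False
        then show ?thesis unfolding inner by simp
      qed
    qed
  qed
  then have ei: "integrable (L \<sigma>) (\<lambda>(t, x). en t x)"
    by (simp add: to_on(1)[symmetric] set_integrable_def)
  show ri: "integrable (L \<sigma>) rel"
  proof (rule Bochner_Integration.integrable_bound)
    show "integrable (L \<sigma>) (\<lambda>p. C * (case p of (t, x) \<Rightarrow> en t x) + c)"
      by (intro Bochner_Integration.integrable_add integrable_mult_right ei const_integrable)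
    show "rel \<in> borel_measurable (L \<sigma>)"
      using measurable_lebesgue_on_subset[OF rel_measurable box_mono[OF \<sigma>]] .
    show "AE p in L \<sigma>. norm (rel p) \<le> norm (C * (case p of (t, x) \<Rightarrow> en t x) + c)"
      using AE_L_sub[OF C(2) \<sigma>] AE_L_sub[OF rel_nonneg \<sigma>] by eventually_elim (auto simp: case_prod_unfold)
  qed
  have "AE t in I \<sigma>. (\<integral>x. rel (t, x) \<partial>X) \<le> C * E + (\<integral>x. c \<partial>X)"
    using AE_L[OF AE_L_sub[OF C(2) \<sigma>]] E L_Fubini(1)[OF ri]
  proof eventually_elim
    case (elim t)
    have "(\<integral>x. rel (t, x) \<partial>X) \<le> (\<integral>x. C * en t x + c \<partial>X)"
    proof (rule integral_mono_AE)
      show "integrable X (\<lambda>x. C * en t x + c)"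
        using elim by (intro Bochner_Integration.integrable_add integrable_mult_right const_integrable) auto
    qed (use elim in auto)
    also have "\<dots> = C * (\<integral>x. en t x \<partial>X) + (\<integral>x. c \<partial>X)"
      using elim const_integrable(2)[of c] by simp
    also have "\<dots> \<le> C * E + (\<integral>x. c \<partial>X)" using elim C(1) by (intro add_right_mono mult_left_mono) auto
    finally show ?case .
  qed
  then show "\<exists>M. AE t in I \<sigma>. (\<integral>x. rel (t, x) \<partial>X) \<le> M" by blast
qed

lemma norm_bounds:
  obtains N where "N > 0" "\<And>t. t \<in> {0..T} \<Longrightarrow> 0 \<le> C1_norm (W t)" "\<And>t. t \<in> {0..T} \<Longrightarrow> C1_norm (W t) \<le> N"
    "\<And>\<tau>. \<tau> \<in> {0<..<T} \<Longrightarrow> C1_space_time_norm T \<tau> W \<le> N"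
proof -
  obtain K where K: "K > 0"
    "\<And>t x. t \<in> {0..T} \<Longrightarrow> norm (W t x) \<le> K" "\<And>t x. t \<in> {0..T} \<Longrightarrow> norm (tderiv T W t x) \<le> K"
    "\<And>t x i. t \<in> {0..T} \<Longrightarrow> norm (pd i (W t) x) \<le> K"
    by (rule bounds) (rule that; assumption)
  define N where "N = K + K + (\<Sum>i\<in>(UNIV :: 'd set). K)"
  have S0: "0 \<le> (\<Sum>i\<in>(UNIV :: 'd set). K)" using K(1) by (intro sum_nonneg) auto
  show thesis
  proof (rule that[of N])
    show "N > 0" using K(1) S0 unfolding N_def by linarith
    fix t assume t: "t \<in> {0..T}"
    have "0 \<le> norm (W t 0)" by simp
    also have "\<dots> \<le> C1_norm (W t)" by (rule C1_norm_ge(1)[OF space_C1_C1_torus[OF WS t]])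
    finally show "0 \<le> C1_norm (W t)" .
    have "C1_norm (W t) \<le> K + (\<Sum>i\<in>(UNIV :: 'd set). K)"
      unfolding C1_norm_def by (intro add_mono sum_mono cSUP_least K t) auto
    then show "C1_norm (W t) \<le> N" using K(1) by (simp add: N_def)
  next
    fix \<tau> assume \<tau>: "\<tau> \<in> {0<..<T}"
    have "(0, 0) \<in> {0..\<tau>} \<times> (UNIV :: (real^'d) set)" using \<tau> by auto
    then have ne: "{0..\<tau>} \<times> (UNIV :: (real^'d) set) \<noteq> {}" by blast
    show "C1_space_time_norm T \<tau> W \<le> N"
      unfolding C1_space_time_norm_def N_def
      by (intro add_mono sum_mono cSUP_least ne) (use \<tau> K in auto)
  qed
qed

section \<open>Testing the balances with the strong solution\<close>

lemma continuity_test: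
  "AE \<tau> in I T. integrable X (\<lambda>x. dn \<tau> x * \<psi> \<tau> x) \<and> integrable X (\<lambda>x. \<rho>0 x * \<psi> 0 x) \<and> integrable (L \<tau>) fc \<and>
     (\<integral>x. dn \<tau> x * \<psi> \<tau> x \<partial>X) - (\<integral>x. \<rho>0 x * \<psi> 0 x \<partial>X) = (\<integral>p. fc p \<partial>L \<tau>)"
  using cont[unfolded mv_continuity_def]
proof eventually_elim
  case (elim \<tau>)
  from elim[rule_format, OF psiC] show ?case
    unfolding fc_def Let_def by (simp add: to_on)
qed

definition momentum_bound :: "(real \<Rightarrow> real) \<Rightarrow> real \<Rightarrow> real \<Rightarrow> bool" where
  "momentum_bound \<xi> \<epsilon> \<tau> \<longleftrightarrow> integrable X (\<lambda>x. sqrt (dn \<tau> x) * (zmean \<V> \<tau> x \<bullet> W \<tau> x)) \<and>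
     integrable X (\<lambda>x. u0 x \<bullet> W 0 x) \<and> integrable (L \<tau>) fm \<and>
     (\<exists>R. (\<integral>x. sqrt (dn \<tau> x) * (zmean \<V> \<tau> x \<bullet> W \<tau> x) \<partial>X) - (\<integral>x. u0 x \<bullet> W 0 x \<partial>X)
          = (\<integral>p. fm p \<partial>L \<tau>) + R \<and>
        \<bar>R\<bar> \<le> (1 + 1 / (4 * \<epsilon>)) * (\<integral>t. \<xi> t * \<D> t * C1_norm (W t) \<partial>I \<tau>)
           + \<epsilon> * C1_space_time_norm T \<tau> W * \<D> \<tau>)"

lemma momentum_test: "\<exists>\<xi>. integrable (I T) \<xi> \<and> (AE \<tau> in I T. \<forall>\<epsilon>>0. momentum_bound \<xi> \<epsilon> \<tau>)"
  using mom unfolding mv_momentum_def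
proof (elim exE conjE, goal_cases)
  case (1 \<mu> \<nu> \<xi>)
  have "AE \<tau> in I T. \<forall>\<epsilon>>0. momentum_bound \<xi> \<epsilon> \<tau>"
    using 1(4)
  proof eventually_elim
    case (elim \<tau>)
    show ?case
    proof (intro allI impI)
      fix \<epsilon> :: real
      assume "\<epsilon> > 0"
      note e = elim[rule_format, OF this WC, unfolded Let_def]
      show "momentum_bound \<xi> \<epsilon> \<tau>"
        unfolding momentum_bound_def fm_def u0_def using e
        by (intro conjI exI[of _ "matrix_pairing T \<mu> \<nu> \<tau> (\<lambda>i j t x. pd i (W t) x $ j)"])
          (simp_all add: to_on)
    qed
  qed
  then show ?case using 1(3) by (auto simp: to_on)
qed

lemma P_difference:
  assumes "\<tau> \<in> {0<..<T}"
  shows "integrable X (P \<tau>)" "integrable X (P 0)" "integrable (L \<tau>) (\<lambda>(t, x). tderiv T P t x)"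
    "(\<integral>x. P \<tau> x \<partial>X) - (\<integral>x. P 0 x \<partial>X) = (\<integral>p. (\<lambda>(t, x). tderiv T P t x) p \<partial>L \<tau>)"
proof -
  have PS: "space_C1 T P" by (rule C1_space_time_space_C1[OF PC])
  have "integrable X (P t)" if "t \<in> {0..T}" for t
    using set_integrable_torus_continuous[OF C1_torus_continuous[OF space_C1_C1_torus[OF PS that]]] PS that
    by (simp add: to_on space_C1_def)
  then show "integrable X (P \<tau>)" "integrable X (P 0)" using assms by auto
  have per: "\<And>t. t \<in> {0..T} \<Longrightarrow> periodic (P t)" using PS by (simp add: space_C1_def)
  show "integrable (L \<tau>) (\<lambda>(t, x). tderiv T P t x)"
    by (rule smooth_integrable[OF C1_space_time_continuous_tderiv[OF PC] periodic_tderiv[OF per]]) (use assms in auto)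
  show "(\<integral>x. P \<tau> x \<partial>X) - (\<integral>x. P 0 x \<partial>X) = (\<integral>p. (\<lambda>(t, x). tderiv T P t x) p \<partial>L \<tau>)"
    using integral_torus_time_difference[OF PC, of \<tau>] assms by (simp add: to_on)
qed

text \<open>The integrand is the expanded relative energy of the initial Dirac measure with respect
  to itself.\<close>

lemma initial_balance:
  assumes "integrable X e0" "integrable X (\<lambda>x. u0 x \<bullet> W 0 x)" "integrable X (\<lambda>x. \<rho>0 x * \<psi> 0 x)" "integrable X (P 0)"
  shows "(\<integral>x. e0 x \<partial>X) - (\<integral>x. u0 x \<bullet> W 0 x \<partial>X) + (\<integral>x. \<rho>0 x * \<psi> 0 x \<partial>X) + (\<integral>x. P 0 x \<partial>X) = 0"
proof -
  have "(\<integral>x. e0 x - u0 x \<bullet> W 0 x + \<rho>0 x * \<psi> 0 x + P 0 x \<partial>X) = 0"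
  proof (rule integral_eq_zero_AE)
    show "AE x in X. e0 x - u0 x \<bullet> W 0 x + \<rho>0 x * \<psi> 0 x + P 0 x = 0"
      using initial_facts
      by eventually_elim (simp add: e0_def u0_def \<psi>_def P_def algebra_simps)
  qed
  then show ?thesis using assms by simp
qed

text \<open>The energy inequality minus the momentum equation, plus the continuity equation and the
  identity for \<open>P\<close>. The initial terms cancel, and half of the defect survives on the
  left.\<close>

lemma balance:
  obtains \<kappa> where "integrable (I T) \<kappa>" "AE t in I T. 0 \<le> \<kappa> t"
    "integrable (I T) (\<lambda>t. \<kappa> t * \<D> t)"
    "AE \<tau> in I T. integrable (L \<tau>) integrand \<and>
      (\<integral>x. rel (\<tau>, x) \<partial>X) + 1/2 * \<D> \<tau> \<le> (\<integral>t. \<kappa> t * \<D> t \<partial>I \<tau>) + (\<integral>p. integrand p \<partial>L \<tau>)"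
proof -
  obtain C where C: "AE \<tau> in I T. \<forall>\<epsilon>>0. energy_bound C \<epsilon> \<tau>"
    using energy_facts by blast
  obtain KD where D: "\<D> \<in> borel_measurable (I T)" "AE t in I T. 0 \<le> \<D> t" "AE t in I T. \<D> t \<le> KD"
    "integrable (I T) \<D>"
    by (rule defect_facts)
  obtain \<xi> where \<xi>: "integrable (I T) \<xi>" and M: "AE \<tau> in I T. \<forall>\<epsilon>>0. momentum_bound \<xi> \<epsilon> \<tau>"
    using momentum_test by blast
  obtain N where N: "N > 0" "\<And>t. t \<in> {0..T} \<Longrightarrow> 0 \<le> C1_norm (W t)" "\<And>t. t \<in> {0..T} \<Longrightarrow> C1_norm (W t) \<le> N"
    "\<And>\<tau>. \<tau> \<in> {0<..<T} \<Longrightarrow> C1_space_time_norm T \<tau> W \<le> N"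
    by (rule norm_bounds) (rule that; assumption)
  \<comment> \<open>Chosen so that the energy defect, contributing \<epsilon>, and the momentum
    defect, contributing at most \<epsilon> N, together cost half of
    \<open>\<D> \<tau>\<close>.\<close>
  define \<epsilon> where "\<epsilon> = 1 / (2 * (1 + N))"
  have \<epsilon>: "\<epsilon> > 0" "\<epsilon> + \<epsilon> * N = 1/2" using N(1) by (auto simp: \<epsilon>_def field_simps)
  define c where "c = 1 + 1 / (4 * \<epsilon>)"
  have c: "c > 0" using \<epsilon> by (simp add: c_def add_pos_pos)
  define \<kappa> where "\<kappa> t = c * (\<bar>C\<bar> + N * \<bar>\<xi> t\<bar>)" for t
  have ik: "integrable (I T) \<kappa>"
    unfolding \<kappa>_def[abs_def] using \<xi>
    by (intro integrable_mult_right Bochner_Integration.integrable_add const_integrable) auto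
  have k0: "0 \<le> \<kappa> t" for t using c N(1) by (simp add: \<kappa>_def)
  have bD: "integrable (I T) (\<lambda>t. g t * \<D> t)" if "integrable (I T) g" for g
  proof (rule Bochner_Integration.integrable_bound)
    show "integrable (I T) (\<lambda>t. KD * g t)" using that by simp
    show "(\<lambda>t. g t * \<D> t) \<in> borel_measurable (I T)" using that D(1) by auto
    show "AE t in I T. norm (g t * \<D> t) \<le> norm (KD * g t)"
      using D(2,3)
    proof eventually_elim
      case (elim t)
      then show ?case using mult_right_mono[of "\<D> t" KD "\<bar>g t\<bar>"] by (simp add: abs_mult mult.commute)
    qed
  qed
  show thesis
  proof (rule that[of \<kappa>])
    show "integrable (I T) \<kappa>" by (rule ik)
    show "AE t in I T. 0 \<le> \<kappa> t" using k0 by simp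
    show kD: "integrable (I T) (\<lambda>t. \<kappa> t * \<D> t)" by (rule bD[OF ik])
    show "AE \<tau> in I T. integrable (L \<tau>) integrand \<and>
      (\<integral>x. rel (\<tau>, x) \<partial>X) + 1/2 * \<D> \<tau> \<le> (\<integral>t. \<kappa> t * \<D> t \<partial>I \<tau>) + (\<integral>p. integrand p \<partial>L \<tau>)"
      using C M continuity_test D(2) AE_I_in
    proof eventually_elim
      case (elim \<tau>)
      have \<tau>: "\<tau> \<in> {0<..<T}" "\<tau> \<le> T" using elim(5) by auto
      obtain R where ie: "integrable X (en \<tau>)" and ie0: "integrable X e0" and iF: "integrable (L \<tau>) FF" and iz: "integrable (L \<tau>) zF"
        and R: "(\<integral>x. en \<tau> x \<partial>X) + (\<integral>p. FF p \<partial>L \<tau>) + \<D> \<tau> \<le> (\<integral>x. e0 x \<partial>X) + (\<integral>p. zF p \<partial>L \<tau>) + R"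
          "\<bar>R\<bar> \<le> C * c * (\<integral>t. \<D> t \<partial>I \<tau>) + \<epsilon> * \<D> \<tau>"
        using elim(1) \<epsilon>(1) unfolding energy_bound_def c_def by blast
      obtain R' where im: "integrable X (\<lambda>x. sqrt (dn \<tau> x) * (zmean \<V> \<tau> x \<bullet> W \<tau> x))"
        and iu: "integrable X (\<lambda>x. u0 x \<bullet> W 0 x)" and ifm: "integrable (L \<tau>) fm"
        and R': "(\<integral>x. sqrt (dn \<tau> x) * (zmean \<V> \<tau> x \<bullet> W \<tau> x) \<partial>X) - (\<integral>x. u0 x \<bullet> W 0 x \<partial>X) = (\<integral>p. fm p \<partial>L \<tau>) + R'"
          "\<bar>R'\<bar> \<le> c * (\<integral>t. \<xi> t * \<D> t * C1_norm (W t) \<partial>I \<tau>) + \<epsilon> * C1_space_time_norm T \<tau> W * \<D> \<tau>"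
        using elim(2) \<epsilon>(1) unfolding momentum_bound_def c_def by blast
      note ct = elim(3) and Pd = P_difference[OF \<tau>(1)]
      have int: "integrable (L \<tau>) integrand"
        unfolding integrand_def[abs_def]
        using iF iz ifm ct Pd(3)
        by (intro Bochner_Integration.integrable_add Bochner_Integration.integrable_diff Bochner_Integration.integrable_minus) auto
      have int_eq: "(\<integral>p. integrand p \<partial>L \<tau>) = - (\<integral>p. FF p \<partial>L \<tau>) + (\<integral>p. zF p \<partial>L \<tau>) - (\<integral>p. fm p \<partial>L \<tau>)
          + (\<integral>p. fc p \<partial>L \<tau>) + (\<integral>p. (\<lambda>(t, x). tderiv T P t x) p \<partial>L \<tau>)"
        unfolding integrand_def using iF iz ifm ct Pd(3) by simp
      have rel_int: "(\<integral>x. rel (\<tau>, x) \<partial>X) = (\<integral>x. en \<tau> x \<partial>X)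
          - (\<integral>x. sqrt (dn \<tau> x) * (zmean \<V> \<tau> x \<bullet> W \<tau> x) \<partial>X) + (\<integral>x. dn \<tau> x * \<psi> \<tau> x \<partial>X) + (\<integral>x. P \<tau> x \<partial>X)"
        unfolding rel_def prod.case using ie im ct Pd(1) by simp
      have D0: "0 \<le> (\<integral>t. \<D> t \<partial>I \<tau>)" by (rule integral_nonneg_AE[OF AE_I_sub[OF D(2) \<tau>(2)]])
      have iDt: "integrable (I \<tau>) \<D>" by (rule integrable_I_sub[OF D(4) \<tau>(2)])
      have ixD: "integrable (I \<tau>) (\<lambda>t. \<bar>\<xi> t\<bar> * \<D> t)"
        by (rule integrable_I_sub[OF bD \<tau>(2)]) (use \<xi> in auto)
      \<comment> \<open>If the product on the left is not integrable, its integral is 0 by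
        convention and the bound still holds, as the right side is nonnegative.\<close>
      have x: "(\<integral>t. \<xi> t * \<D> t * C1_norm (W t) \<partial>I \<tau>) \<le> N * (\<integral>t. \<bar>\<xi> t\<bar> * \<D> t \<partial>I \<tau>)"
      proof (cases "integrable (I \<tau>) (\<lambda>t. \<xi> t * \<D> t * C1_norm (W t))")
        case True
        have "(\<integral>t. \<xi> t * \<D> t * C1_norm (W t) \<partial>I \<tau>) \<le> (\<integral>t. N * (\<bar>\<xi> t\<bar> * \<D> t) \<partial>I \<tau>)"
        proof (rule integral_mono_AE[OF True])
          show "integrable (I \<tau>) (\<lambda>t. N * (\<bar>\<xi> t\<bar> * \<D> t))" using ixD by simp
          show "AE t in I \<tau>. \<xi> t * \<D> t * C1_norm (W t) \<le> N * (\<bar>\<xi> t\<bar> * \<D> t)"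
            using AE_I_sub[OF D(2) \<tau>(2)] AE_I_in
          proof eventually_elim
            case (elim t)
            then have t: "t \<in> {0..T}" using \<tau> by auto
            have "\<xi> t * \<D> t * C1_norm (W t) \<le> (\<bar>\<xi> t\<bar> * \<D> t) * C1_norm (W t)"
              using elim N(2)[OF t] by (intro mult_right_mono) auto
            also have "\<dots> \<le> (\<bar>\<xi> t\<bar> * \<D> t) * N" using elim N(3)[OF t] by (intro mult_left_mono) auto
            finally show ?case by (simp add: mult.commute)
          qed
        qed
        then show ?thesis by simp
      next
        case False
        have "0 \<le> (\<integral>t. \<bar>\<xi> t\<bar> * \<D> t \<partial>I \<tau>)"
          by (rule integral_nonneg_AE) (use AE_I_sub[OF D(2) \<tau>(2)] in eventually_elim, simp)
        then show ?thesis using False N(1) by (simp add: not_integrable_integral_eq)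
      qed
      have "C * c * (\<integral>t. \<D> t \<partial>I \<tau>) \<le> c * \<bar>C\<bar> * (\<integral>t. \<D> t \<partial>I \<tau>)"
        using c D0 by (intro mult_right_mono) (auto simp: mult.commute)
      moreover have "c * (\<integral>t. \<xi> t * \<D> t * C1_norm (W t) \<partial>I \<tau>) \<le> c * (N * (\<integral>t. \<bar>\<xi> t\<bar> * \<D> t \<partial>I \<tau>))"
        using x c by (intro mult_left_mono) auto
      moreover have "\<epsilon> * C1_space_time_norm T \<tau> W * \<D> \<tau> \<le> \<epsilon> * N * \<D> \<tau>"
        using N(4)[OF \<tau>(1)] \<epsilon> elim(4) by (intro mult_right_mono mult_left_mono) auto
      moreover have "(\<integral>t. \<kappa> t * \<D> t \<partial>I \<tau>) = c * \<bar>C\<bar> * (\<integral>t. \<D> t \<partial>I \<tau>) + c * (N * (\<integral>t. \<bar>\<xi> t\<bar> * \<D> t \<partial>I \<tau>))"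
      proof -
        have "(\<integral>t. \<kappa> t * \<D> t \<partial>I \<tau>) = (\<integral>t. c * \<bar>C\<bar> * \<D> t + c * (N * (\<bar>\<xi> t\<bar> * \<D> t)) \<partial>I \<tau>)"
          by (simp add: \<kappa>_def algebra_simps)
        also have "\<dots> = c * \<bar>C\<bar> * (\<integral>t. \<D> t \<partial>I \<tau>) + c * (N * (\<integral>t. \<bar>\<xi> t\<bar> * \<D> t \<partial>I \<tau>))"
          using iDt ixD by simp
        finally show ?thesis .
      qed
      moreover have "\<epsilon> * \<D> \<tau> + \<epsilon> * N * \<D> \<tau> = 1/2 * \<D> \<tau>"
        unfolding \<epsilon>(2)[symmetric] by (simp add: distrib_right)
      ultimately have "R - R' \<le> (\<integral>t. \<kappa> t * \<D> t \<partial>I \<tau>) + 1/2 * \<D> \<tau>"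
        using R(2) R'(2) by linarith
      moreover have "(\<integral>x. rel (\<tau>, x) \<partial>X) + \<D> \<tau> \<le> R - R' + (\<integral>p. integrand p \<partial>L \<tau>)"
        using R(1) R'(1) ct Pd(4) initial_balance[OF ie0 iu _ Pd(2)] unfolding int_eq rel_int by linarith
      ultimately have "(\<integral>x. rel (\<tau>, x) \<partial>X) + 1/2 * \<D> \<tau> \<le> (\<integral>t. \<kappa> t * \<D> t \<partial>I \<tau>) + (\<integral>p. integrand p \<partial>L \<tau>)"
        by linarith
      then show ?case using int by simp
    qed
  qed
qed

text \<open>The balance is exploited twice: Gronwall's lemma makes the relative energy and the
  defect vanish, and evaluating the balance again at \<sigma> forces the retained dissipation
  \<open>Fdev\<close> to vanish as well.\<close>

lemma uniqueness_local:
  "AE \<sigma> in I T. (AE t in I \<sigma>. \<D> t = 0) \<and>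
    (AE p in L \<sigma>. \<V> (fst p) (snd p) = return phase_borel
      (r (fst p) (snd p), sqrt (r (fst p) (snd p)) *\<^sub>R W (fst p) (snd p),
       grad (\<lambda>y. Qfun \<gamma> (r (fst p) y)) (snd p)))"
proof -
  obtain \<kappa> where k: "integrable (I T) \<kappa>" "AE t in I T. 0 \<le> \<kappa> t" "integrable (I T) (\<lambda>t. \<kappa> t * \<D> t)"
    and bal: "AE \<tau> in I T. integrable (L \<tau>) integrand \<and>
      (\<integral>x. rel (\<tau>, x) \<partial>X) + 1/2 * \<D> \<tau> \<le> (\<integral>t. \<kappa> t * \<D> t \<partial>I \<tau>) + (\<integral>p. integrand p \<partial>L \<tau>)"
    by (rule balance)
  obtain C where C: "C \<ge> 0" "AE p in L T. integrand p - J p \<le> C * rel p - 1/2 * Fdev p"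
    using pointwise by blast
  obtain KD where D: "\<D> \<in> borel_measurable (I T)" "AE t in I T. 0 \<le> \<D> t" "AE t in I T. \<D> t \<le> KD"
    "integrable (I T) \<D>"
    by (rule defect_facts)
  define y where "y t = (\<integral>x. rel (t, x) \<partial>X) + 1/2 * \<D> t" for t
  \<comment> \<open>The factor 2 compensates the weight 1/2 of the defect in
    \<open>y\<close>.\<close>
  define \<kappa>' where "\<kappa>' t = C + 2 * \<kappa> t" for t
  have rel0: "AE t in I T. 0 \<le> (\<integral>x. rel (t, x) \<partial>X)"
    using AE_L[OF rel_nonneg] by eventually_elim (rule integral_nonneg_AE)
  have y0: "AE t in I T. 0 \<le> y t"
    using rel0 D(2) by eventually_elim (simp add: y_def)
  \<comment> \<open>Subtracting \<open>J\<close> does not change the integral, but only the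
    difference admits the pointwise estimate.\<close>
  have shifted: "(\<integral>p. integrand p \<partial>L \<tau>) = (\<integral>p. integrand p - J p \<partial>L \<tau>)"
    if "integrable (L \<tau>) integrand" "\<tau> \<le> T" for \<tau>
    using that J_zero(2)[OF that(2)] integrable_L_sub[OF J_zero(1) that(2)] by simp
  show ?thesis
    using energy_locally_bounded bal y0 AE_I_in
  proof eventually_elim
    case (elim \<sigma>)
    have \<sigma>: "0 < \<sigma>" "\<sigma> \<le> T" using elim(4) by auto
    obtain E where E: "AE \<tau> in I \<sigma>. integrable X (en \<tau>) \<and> (\<integral>x. en \<tau> x \<partial>X) \<le> E" using elim(1) by blast
    note ri = rel_integrable(1)[OF \<sigma>(2) E]
    obtain M where M: "AE t in I \<sigma>. (\<integral>x. rel (t, x) \<partial>X) \<le> M" using rel_integrable(2)[OF \<sigma>(2) E] by blast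
    have yi: "integrable (I \<sigma>) y"
      unfolding y_def[abs_def]
      by (intro Bochner_Integration.integrable_add integrable_mult_right L_Fubini(2)[OF ri] integrable_I_sub[OF D(4) \<sigma>(2)])
    have yM: "AE t in I \<sigma>. y t \<le> M + 1/2 * KD"
      using M AE_I_sub[OF D(3) \<sigma>(2)] by eventually_elim (simp add: y_def)
    have y0': "AE t in I \<sigma>. 0 \<le> y t" by (rule AE_I_sub[OF y0 \<sigma>(2)])
    have k'0: "AE t in I \<sigma>. 0 \<le> \<kappa>' t"
      using AE_I_sub[OF k(2) \<sigma>(2)] by eventually_elim (use C(1) in \<open>simp add: \<kappa>'_def\<close>)
    have k'i: "integrable (I \<sigma>) \<kappa>'"
      unfolding \<kappa>'_def[abs_def]
      by (intro Bochner_Integration.integrable_add integrable_mult_right const_integrable integrable_I_sub[OF k(1) \<sigma>(2)])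
    have kyi: "integrable (I \<sigma>) (\<lambda>t. \<kappa>' t * y t)"
    proof (rule Bochner_Integration.integrable_bound)
      show "integrable (I \<sigma>) (\<lambda>t. (M + 1/2 * KD) * \<kappa>' t)" using k'i by simp
      show "(\<lambda>t. \<kappa>' t * y t) \<in> borel_measurable (I \<sigma>)"
        by (rule borel_measurable_times[OF borel_measurable_integrable[OF k'i] borel_measurable_integrable[OF yi]])
      show "AE t in I \<sigma>. norm (\<kappa>' t * y t) \<le> norm ((M + 1/2 * KD) * \<kappa>' t)"
        using yM y0' k'0
      proof eventually_elim
        case (elim t)
        then show ?case using mult_right_mono[of "y t" "M + 1/2 * KD" "\<kappa>' t"]
          by (simp add: abs_mult mult.commute)
      qed
    qed
    have "AE \<tau> in I \<sigma>. y \<tau> \<le> (\<integral>t. \<kappa>' t * y t \<partial>I \<tau>)"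
      using AE_I_sub[OF bal \<sigma>(2)] AE_I_in
    proof eventually_elim
      case (elim \<tau>)
      have \<tau>: "\<tau> \<le> \<sigma>" "\<tau> \<le> T" using elim(2) \<sigma> by auto
      note rt = integrable_L_sub[OF ri \<tau>(1)]
      have it: "integrable (L \<tau>) (\<lambda>p. integrand p - J p)"
        using elim(1) integrable_L_sub[OF J_zero(1) \<tau>(2)] by simp
      have "(\<integral>p. integrand p - J p \<partial>L \<tau>) \<le> (\<integral>p. C * rel p \<partial>L \<tau>)"
      proof (rule integral_mono_AE[OF it])
        show "integrable (L \<tau>) (\<lambda>p. C * rel p)" using rt by simp
        show "AE p in L \<tau>. integrand p - J p \<le> C * rel p"
          using AE_L_sub[OF C(2) \<tau>(2)]
        proof eventually_elim
          case (elim p)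
          then show ?case using Fdev_nonneg[of p] by linarith
        qed
      qed
      also have "\<dots> = C * (\<integral>t. (\<integral>x. rel (t, x) \<partial>X) \<partial>I \<tau>)" using L_Fubini(3)[OF rt] by simp
      finally have "y \<tau> \<le> (\<integral>t. \<kappa> t * \<D> t \<partial>I \<tau>) + C * (\<integral>t. (\<integral>x. rel (t, x) \<partial>X) \<partial>I \<tau>)"
        using elim(1) shifted[OF _ \<tau>(2)] by (simp add: y_def)
      also have "\<dots> = (\<integral>t. \<kappa> t * \<D> t + C * (\<integral>x. rel (t, x) \<partial>X) \<partial>I \<tau>)"
        using integrable_I_sub[OF k(3) \<tau>(2)] L_Fubini(2)[OF rt] by simp
      also have "\<dots> \<le> (\<integral>t. \<kappa>' t * y t \<partial>I \<tau>)"
      proof (rule integral_mono_AE)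
        show "integrable (I \<tau>) (\<lambda>t. \<kappa> t * \<D> t + C * (\<integral>x. rel (t, x) \<partial>X))"
          by (intro Bochner_Integration.integrable_add integrable_mult_right integrable_I_sub[OF k(3) \<tau>(2)] L_Fubini(2)[OF rt])
        show "integrable (I \<tau>) (\<lambda>t. \<kappa>' t * y t)" by (rule integrable_I_sub[OF kyi \<tau>(1)])
        show "AE t in I \<tau>. \<kappa> t * \<D> t + C * (\<integral>x. rel (t, x) \<partial>X) \<le> \<kappa>' t * y t"
          using AE_I_sub[OF rel0 \<tau>(2)] AE_I_sub[OF D(2) \<tau>(2)] AE_I_sub[OF k(2) \<tau>(2)]
        proof eventually_elim
          case (elim t)
          have "0 \<le> C * \<D> t" "0 \<le> \<kappa> t * (\<integral>x. rel (t, x) \<partial>X)" using elim C(1) by auto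
          then show ?case by (simp add: \<kappa>'_def y_def algebra_simps)
        qed
      qed
      finally show ?case .
    qed
    then have "AE t in I \<sigma>. y t = 0"
      using gronwall_zero[OF \<sigma>(1) y0' yM k'0] k'i kyi by (simp add: to_on)
    with AE_I_sub[OF rel0 \<sigma>(2)] AE_I_sub[OF D(2) \<sigma>(2)]
    have zero: "AE t in I \<sigma>. \<D> t = 0 \<and> (\<integral>x. rel (t, x) \<partial>X) = 0"
      by eventually_elim (auto simp: y_def)
    then have D0: "AE t in I \<sigma>. \<D> t = 0" by eventually_elim simp
    have "(\<integral>p. rel p \<partial>L \<sigma>) = 0"
      unfolding L_Fubini(3)[OF ri, symmetric]
      by (rule integral_eq_zero_AE) (use zero in eventually_elim, simp)
    then have rel_zero: "AE p in L \<sigma>. rel p = 0"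
      using integral_nonneg_eq_0_iff_AE[OF ri AE_L_sub[OF rel_nonneg \<sigma>(2)]] by simp
    \<comment> \<open>Second use of the balance, at \<sigma> itself: with
      \<open>y \<sigma> \<ge> 0\<close> and zero defect it bounds the integrated right-hand side
      from below.\<close>
    have "(\<integral>t. \<kappa> t * \<D> t \<partial>I \<sigma>) = 0"
      by (rule integral_eq_zero_AE) (use D0 in eventually_elim, simp)
    then have ge: "0 \<le> (\<integral>p. integrand p - J p \<partial>L \<sigma>)"
      using elim(2,3) shifted[OF _ \<sigma>(2)] by (simp add: y_def)
    have Ji: "integrable (L \<sigma>) (\<lambda>p. J p - integrand p)"
      using elim(2) integrable_L_sub[OF J_zero(1) \<sigma>(2)] by simp
    \<comment> \<open>With the relative energy gone, \<open>J - integrand\<close> is an integrable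
      majorant of \<open>1/2 * Fdev\<close>. Its integral is both nonnegative and nonpositive, so
      the majorant vanishes almost everywhere and \<open>Fdev\<close> with it.\<close>
    have dev: "AE p in L \<sigma>. 1/2 * Fdev p \<le> J p - integrand p"
      using AE_L_sub[OF C(2) \<sigma>(2)] rel_zero by eventually_elim simp
    have pos: "AE p in L \<sigma>. 0 \<le> J p - integrand p"
      using dev
    proof eventually_elim
      case (elim p)
      then show ?case using Fdev_nonneg[of p] by linarith
    qed
    have "(\<integral>p. J p - integrand p \<partial>L \<sigma>) = - (\<integral>p. integrand p - J p \<partial>L \<sigma>)"
      using elim(2) integrable_L_sub[OF J_zero(1) \<sigma>(2)] by simp
    moreover have "0 \<le> (\<integral>p. J p - integrand p \<partial>L \<sigma>)" by (rule integral_nonneg_AE[OF pos])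
    ultimately have "(\<integral>p. J p - integrand p \<partial>L \<sigma>) = 0" using ge by linarith
    then have "AE p in L \<sigma>. J p - integrand p = 0"
      using integral_nonneg_eq_0_iff_AE[OF Ji pos] by simp
    with dev have Fdev_zero: "AE p in L \<sigma>. Fdev p = 0"
    proof eventually_elim
      case (elim p)
      then show ?case using Fdev_nonneg[of p] by linarith
    qed
    have "AE p in L \<sigma>. \<V> (fst p) (snd p) = return phase_borel
      (r (fst p) (snd p), sqrt (r (fst p) (snd p)) *\<^sub>R W (fst p) (snd p),
       grad (\<lambda>y. Qfun \<gamma> (r (fst p) y)) (snd p))"
      using AE_L_sub[OF young \<sigma>(2)] rel_zero Fdev_zero AE_L_in
    proof eventually_elim
      case (elim p)
      obtain t x where p: "p = (t, x)" by (cases p)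
      have t: "t \<in> {0..T}" using elim(4) \<sigma> by (auto simp: p)
      have ym: "young_measure (\<V> t x) \<gamma>" using elim(1) by (simp add: p)
      have "grad (\<lambda>y. Qfun \<gamma> (r t y)) x = sqrt (r t x) *\<^sub>R h t x"
        using Qr_grad[OF t] by (simp add: vec_eq_iff grad_def Qr_def[abs_def])
      moreover have "\<V> t x = return phase_borel (r t x, sqrt (r t x) *\<^sub>R W t x, sqrt (r t x) *\<^sub>R h t x)"
      proof (rule young_measure.eq_return[OF ym positive[OF t]])
        show "young_measure.rel_energy (\<V> t x) \<gamma> (W t x) (r t x) = 0"
          using elim(2) unfolding p rel_eq[OF ym] .
        show "(\<integral>(s, z, F). (norm (F - sqrt (young_measure.\<rho> (\<V> t x)) *\<^sub>R h t x))\<^sup>2 \<partial>\<V> t x) = 0"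
          using elim(3) unfolding p Fdev_def prod.case young_expect[OF ym] .
      qed
      ultimately show ?case by (simp add: p)
    qed
    with D0 show ?case by blast
  qed
qed

text \<open>Countably many intervals (0, \<tau>_n) exhaust (0, T), and a countable union of
  exceptional null sets is null.\<close>

lemma uniqueness:
  "(AE t in I T. \<D> t = 0) \<and>
    (AE (t, x) in L T. \<V> t x = return phase_borel
      (r t x, sqrt (r t x) *\<^sub>R W t x, grad (\<lambda>y. Qfun \<gamma> (r t y)) x))"
proof -
  let ?Q = "\<lambda>p. \<V> (fst p) (snd p) = return phase_borel
      (r (fst p) (snd p), sqrt (r (fst p) (snd p)) *\<^sub>R W (fst p) (snd p),
       grad (\<lambda>y. Qfun \<gamma> (r (fst p) y)) (snd p))"
  define Z where "Z \<sigma> \<longleftrightarrow> (AE t in I \<sigma>. \<D> t = 0) \<and> (AE p in L \<sigma>. ?Q p)" for \<sigma>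
  have "AE \<sigma> in I T. Z \<sigma>" using uniqueness_local unfolding Z_def .
  from AE_interval_exhaust[OF T this]
  obtain \<tau> :: "nat \<Rightarrow> real" where *: "(\<forall>n. Z (\<tau> n)) \<and> {0<..<T} = (\<Union>n. {0<..<\<tau> n})" ..
  then have Z: "Z (\<tau> n)" for n by (rule conjE) (erule spec)
  have un: "{0<..<T} = (\<Union>n. {0<..<\<tau> n})" using * by (rule conjunct2)
  have \<tau>: "AE t in I (\<tau> n). \<D> t = 0" "AE p in L (\<tau> n). ?Q p" for n
    using Z[of n] unfolding Z_def by (rule conjunct1, rule conjunct2)
  have "AE t in lebesgue. \<forall>n. t \<in> {0<..<\<tau> n} \<longrightarrow> \<D> t = 0"
    unfolding AE_all_countable using \<tau>(1) by (simp add: AE_restrict_space_iff)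
  then have "AE t in lebesgue. t \<in> {0<..<T} \<longrightarrow> \<D> t = 0"
    unfolding un by eventually_elim auto
  moreover have "AE p in lebesgue. \<forall>n. p \<in> {0<..<\<tau> n} \<times> torus \<longrightarrow> ?Q p"
    unfolding AE_all_countable
  proof
    fix n
    show "AE p in lebesgue. p \<in> {0<..<\<tau> n} \<times> torus \<longrightarrow> ?Q p"
      using \<tau>(2)[of n] by (simp add: AE_restrict_space_iff)
  qed
  then have "AE p in lebesgue. p \<in> {0<..<T} \<times> torus \<longrightarrow> ?Q p"
    unfolding un by eventually_elim auto
  ultimately show ?thesis
    by (simp add: AE_restrict_space_iff case_prod_unfold)
qed

end

theorem theorem4:
  fixes \<gamma> T :: real
    and \<rho>0 \<rho>b0 :: "real^'d \<Rightarrow> real" and w0 wb0 :: "real^'d \<Rightarrow> real^'d"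
    and \<V> :: "'d young" and \<D> :: "real \<Rightarrow> real"
    and \<rho>b :: "real \<Rightarrow> real^'d \<Rightarrow> real" and wb :: "real \<Rightarrow> real^'d \<Rightarrow> real^'d"
  assumes dim: "CARD('d) \<in> {2, 3}" and gamma: "\<gamma> \<ge> 1" and T: "T > 0"
    and mv: "mv_solution \<gamma> T \<rho>0 w0 \<V> \<D>"
    and strong: "strong_solution \<gamma> T \<rho>b wb"
    and regular: "C1_C2 T \<rho>b" "C1_C2 T wb"
    and positive: "\<forall>t\<in>{0..T}. \<forall>x. \<rho>b t x > 0"
    and strong_init: "\<forall>x. \<rho>b 0 x = \<rho>b0 x" "\<forall>x. wb 0 x = wb0 x"
    and init_regular: "C2_torus \<rho>b0" "C2_torus wb0" "\<forall>x. \<rho>b0 x > 0"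
    and same_init: "AE x in lebesgue_on torus. initial_measure \<rho>0 w0 x = initial_measure \<rho>b0 wb0 x"
  shows "(AE t in lebesgue_on {0<..<T}. \<D> t = 0) \<and>
    (AE (\<tau>, x) in lebesgue_on ({0<..<T} \<times> torus).
       \<V> \<tau> x = return phase_borel
         (\<rho>b \<tau> x, sqrt (\<rho>b \<tau> x) *\<^sub>R wb \<tau> x, grad (\<lambda>y. Qfun \<gamma> (\<rho>b \<tau> y)) x))"
proof -
  have eq: "\<rho>b 0 = \<rho>b0" "wb 0 = wb0" using strong_init by auto
  interpret weak_strong \<gamma> T \<rho>b wb \<rho>0 w0 \<V> \<D>
    by (unfold_locales; (fact gamma T strong regular mv same_init[folded eq] | simp add: positive))
  show ?thesis by (rule uniqueness)
qed

end
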